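(* Let $T$ be a trivalent leafless tree, let $P$ be the set of bi-infinite paths (bips) on $T$ constructed as described in the context, and let $A\in\{\mathbb{Z},\mathbb{Z}_2\}$. Then the map \[ \ell^\infty(P)\to H^{\mathrm{suf}}_1(T,A)\cong H^{\mathrm{uf}}_1(T,A),\qquad f\mapsto c_f:=\Big[e\mapsto \sum_{p\in P,\ e\in p} f(p)\Big] \] is an isomorphism (continuous when $A=\mathbb{Z}$ and $H^{\mathrm{suf}}_1(T,A)$ carries the $\ell^\infty$ norm).
   Context: $H^{\mathrm{suf}}_1(T,A)$ is the first simplicial uniformly finite homology of $T$ (homology of the complex of uniformly bounded $A$-valued simplicial chains), and $H^{\mathrm{uf}}_1(T,A)$ is the first uniformly finite homology of Block–Weinberger (direct limit over Rips complexes); since $T$ is a tree, $H^{\mathrm{suf}}_1(T,A)$ is just the space of uniformly bounded $A$-valued flows on $T$ satisfying in-flow $=$ out-flow at every vertex. A trivalent tree is a tree all of whose vertices have degree $2$ or $3$. A bip is a bi-infinite path, i.e. a graph morphism $\mathbb{Z}\to T$ injective on edges, viewed as an oriented $1$-cycle. Construction of $T$: start with $T_0=\{v_0\}$; $T_1$ is a copy of $\mathbb{Z}$ with $v_0=0$ (i.e. two rays issuing from $v_0$). Inductively, choose a set $B_n$ of vertices of $T_n$ not in $T_{n-1}$ (branching points of depth $n$), and at each $v\in B_n$ glue a new ray $R_v\cong\mathbb{N}$ at its origin $0_v=v$; write $\infty_v$ for its end. $T_{n+1}$ is the result and $T=\bigcup_n T_n$ (every trivalent leafless tree arises this way up to one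 edge). Every new branching point lies on a ray created at the previous step; for such a ray $R_u$, order the branching points lying on it (other than $u$) by their position along $R_u$ as $v_{u,0},v_{u,1},\dots$. Construction of $P$: $P_0=\emptyset$, $P_1=\{T_1\}$ (the unique bip of $T_1$). Then $P_{n+1}=P_n\sqcup P'_{n+1}$ where, for each ray $R_u$ created at the previous stage, the new bips along $R_u$ are: for each consecutive pair, the path $R_{v_{u,i}}^{-1}+[v_{u,i},v_{u,i+1}]+R_{v_{u,i+1}}$ (come in along the ray at $v_{u,i}$, follow $R_u$ to $v_{u,i+1}$, go out along the ray at $v_{u,i+1}$); and if there are only finitely many branching points $v_{u,0},\dots,v_{u,k}$ on $R_u$, additionally the bip $R_{v_{u,k}}^{-1}+[v_{u,k},\infty_u]$ (come in along the ray at $v_{u,k}$ and follow $R_u$ out to its end). $P=\bigcup_n P_n$. Partially order $P$ by declaring $p\le q$ whenever $p\in P_n$, $q\in P_{n+1}$ share an edge, and taking the transitive closure; this can be refined to a well-order with finite initial segments. The resulting $P$ is "tame": each edge is covered by at most three bips, $P_n$ covers $T_n$, each $p$ has finitely many predecessors and is the last bip over a nonempty connected set of edges $M_p$, and for every edge $e$ on which $p$ is last there is an edge $e'$ on which exactly the predecessors of $p$ through $e$ run. *)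

theory Defs
  imports Complex_Main "HOL-Algebra.Coset" "HOL-Library.Z2"
begin

section \<open>Coefficients and bounded functions\<close>

class coeff_ring = comm_ring_1 +
  fixes cnorm :: "'a \<Rightarrow> real"

instantiation int :: coeff_ring
begin
definition cnorm_int :: "int \<Rightarrow> real" where "cnorm_int a = \<bar>real_of_int a\<bar>"
instance ..
end

instantiation bit :: coeff_ring
begin
definition cnorm_bit :: "bit \<Rightarrow> real" where "cnorm_bit a = of_bool (a \<noteq> 0)"
instance ..
end

definition bounded_fun :: "('x \<Rightarrow> 'a::coeff_ring) \<Rightarrow> bool" where
  "bounded_fun f \<longleftrightarrow> (\<exists>K. \<forall>x. cnorm (f x) \<le> K)"

definition sup_norm :: "('x \<Rightarrow> 'a::coeff_ring) \<Rightarrow> real" where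
  "sup_norm f = (SUP x. cnorm (f x))"

definition fun_group :: "('x \<Rightarrow> 'a::ab_group_add) set \<Rightarrow> ('x \<Rightarrow> 'a) monoid" where
  "fun_group S = \<lparr>carrier = S, mult = (\<lambda>f g x. f x + g x), one = (\<lambda>x. 0)\<rparr>"

text \<open>Functions on \<open>P\<close> are represented by their extension by \<open>0\<close>.\<close>

definition linf :: "'x set \<Rightarrow> ('x \<Rightarrow> 'a::coeff_ring) monoid" where
  "linf P = fun_group {f. (\<forall>x. x \<notin> P \<longrightarrow> f x = 0) \<and> bounded_fun f}"


section \<open>Simplicial uniformly finite homology\<close>

text \<open>
  A simplicial complex is given by its set \<open>K\<close> of simplices, each a finite nonempty set of
  vertices. An \<open>n\<close>-chain is a bounded alternating function on the ordered \<open>n\<close>-simplices: the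
  value at \<open>[x\<^sub>0, \<dots>, x\<^sub>n]\<close> is the coefficient of that oriented simplex. The sum in
  \<open>bdry\<close> is finite if \<open>K\<close> is locally finite.
\<close>

definition chains :: "'v set set \<Rightarrow> nat \<Rightarrow> ('v list \<Rightarrow> 'a::coeff_ring) set" where
  "chains K n = {c. bounded_fun c \<and>
     (\<forall>xs. c xs \<noteq> 0 \<longrightarrow> length xs = Suc n \<and> distinct xs \<and> set xs \<in> K) \<and>
     (\<forall>xs i j. i < j \<and> j < length xs \<longrightarrow> c (xs[i := xs ! j, j := xs ! i]) = - c xs)}"

definition bdry :: "('v list \<Rightarrow> 'a::coeff_ring) \<Rightarrow> 'v list \<Rightarrow> 'a" where
  "bdry c ys = (if ys = [] then 0 else \<Sum>x | c (x # ys) \<noteq> 0. c (x # ys))"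

definition cycles :: "'v set set \<Rightarrow> nat \<Rightarrow> ('v list \<Rightarrow> 'a::coeff_ring) set" where
  "cycles K n = {c \<in> chains K n. bdry c = (\<lambda>ys. 0)}"

definition boundaries :: "'v set set \<Rightarrow> nat \<Rightarrow> ('v list \<Rightarrow> 'a::coeff_ring) set" where
  "boundaries K n = bdry ` chains K (Suc n)"

definition H_suf :: "'v set set \<Rightarrow> nat \<Rightarrow> ('v list \<Rightarrow> 'a::coeff_ring) set monoid" where
  "H_suf K n = fun_group (cycles K n) Mod boundaries K n"

definition hclass :: "'v set set \<Rightarrow> nat \<Rightarrow> ('v list \<Rightarrow> 'a::coeff_ring) \<Rightarrow> ('v list \<Rightarrow> 'a) set" where
  "hclass K n z = boundaries K n #>\<^bsub>fun_group (cycles K n)\<^esub> z"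

text \<open>The map \<open>H_suf K n \<rightarrow> H_suf K' n\<close> induced by an inclusion \<open>K \<subseteq> K'\<close>.\<close>

definition incl_map ::
  "'v set set \<Rightarrow> nat \<Rightarrow> ('v list \<Rightarrow> 'a::coeff_ring) set \<Rightarrow> ('v list \<Rightarrow> 'a) set" where
  "incl_map K' n X = (\<Union>z\<in>X. hclass K' n z)"

text \<open>The quotient (semi)norm of the sup norm, and the distance it induces.\<close>

definition class_norm :: "('x \<Rightarrow> 'a::coeff_ring) set \<Rightarrow> real" where
  "class_norm X = (INF z\<in>X. sup_norm z)"

definition class_dist :: "('x \<Rightarrow> 'a::coeff_ring) set \<Rightarrow> ('x \<Rightarrow> 'a) set \<Rightarrow> real" where
  "class_dist X Y = class_norm {(\<lambda>x. y x - z x) |y z. y \<in> X \<and> z \<in> Y}"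


section \<open>Graphs and trees\<close>

definition simple_graph :: "'v set \<Rightarrow> 'v set set \<Rightarrow> bool" where
  "simple_graph V E \<longleftrightarrow> (\<forall>e\<in>E. \<exists>x\<in>V. \<exists>y\<in>V. x \<noteq> y \<and> e = {x, y})"

definition walk :: "'v set \<Rightarrow> 'v set set \<Rightarrow> 'v list \<Rightarrow> bool" where
  "walk V E xs \<longleftrightarrow> xs \<noteq> [] \<and> set xs \<subseteq> V \<and> successively (\<lambda>x y. {x, y} \<in> E) xs"

definition tree :: "'v set \<Rightarrow> 'v set set \<Rightarrow> bool" where
  "tree V E \<longleftrightarrow> simple_graph V E \<and> V \<noteq> {} \<and>
     (\<forall>x\<in>V. \<forall>y\<in>V. \<exists>xs. walk V E xs \<and> hd xs = x \<and> last xs = y) \<and>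
     \<not> (\<exists>xs. walk V E xs \<and> distinct xs \<and> length xs \<ge> 3 \<and> {last xs, hd xs} \<in> E)"

definition vdegree :: "'v set set \<Rightarrow> 'v \<Rightarrow> nat" where
  "vdegree E v = card {e \<in> E. v \<in> e}"

definition trivalent_tree :: "'v set \<Rightarrow> 'v set set \<Rightarrow> bool" where
  "trivalent_tree V E \<longleftrightarrow> tree V E \<and> (\<forall>v\<in>V. vdegree E v \<in> {2, 3})"

definition leafless :: "'v set \<Rightarrow> 'v set set \<Rightarrow> bool" where
  "leafless V E \<longleftrightarrow> (\<forall>v\<in>V. vdegree E v \<noteq> 1)"

definition gdist :: "'v set \<Rightarrow> 'v set set \<Rightarrow> 'v \<Rightarrow> 'v \<Rightarrow> nat" where
  "gdist V E x y = (LEAST n. \<exists>xs. walk V E xs \<and> hd xs = x \<and> last xs = y \<and> length xs = Suc n)"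

definition graph_complex :: "'v set \<Rightarrow> 'v set set \<Rightarrow> 'v set set" where
  "graph_complex V E = (\<lambda>v. {v}) ` V \<union> E"


section \<open>Uniformly finite homology\<close>

definition rips :: "'v set \<Rightarrow> 'v set set \<Rightarrow> nat \<Rightarrow> 'v set set" where
  "rips V E r = {s. s \<noteq> {} \<and> finite s \<and> s \<subseteq> V \<and> (\<forall>x\<in>s. \<forall>y\<in>s. gdist V E x y \<le> r)}"

definition dirlim_rel ::
  "(nat \<Rightarrow> 'g monoid) \<Rightarrow> (nat \<Rightarrow> nat \<Rightarrow> 'g \<Rightarrow> 'g) \<Rightarrow> ((nat \<times> 'g) \<times> (nat \<times> 'g)) set" where
  "dirlim_rel G \<phi> = {((m, a), (n, b)). a \<in> carrier (G m) \<and> b \<in> carrier (G n) \<and>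
     (\<exists>k. m \<le> k \<and> n \<le> k \<and> \<phi> m k a = \<phi> n k b)}"

definition dirlim ::
  "(nat \<Rightarrow> 'g monoid) \<Rightarrow> (nat \<Rightarrow> nat \<Rightarrow> 'g \<Rightarrow> 'g) \<Rightarrow> (nat \<times> 'g) set monoid" where
  "dirlim G \<phi> =
     \<lparr>carrier = (SIGMA m:UNIV. carrier (G m)) // dirlim_rel G \<phi>,
      mult = (\<lambda>X Y. \<Union>(m, a)\<in>X. \<Union>(n, b)\<in>Y. let k = max m n in
                dirlim_rel G \<phi> `` {(k, \<phi> m k a \<otimes>\<^bsub>G k\<^esub> \<phi> n k b)}),
      one = dirlim_rel G \<phi> `` {(0, \<one>\<^bsub>G 0\<^esub>)}\<rparr>"

text \<open>
  The vertex set carries the path metric, which is integer valued, so that integer scales of the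
  Rips complex suffice.
\<close>

definition H_uf ::
  "'v set \<Rightarrow> 'v set set \<Rightarrow> nat \<Rightarrow> (nat \<times> ('v list \<Rightarrow> 'a::coeff_ring) set) set monoid" where
  "H_uf V E n = dirlim (\<lambda>r. H_suf (rips V E r) n) (\<lambda>r s. incl_map (rips V E s) n)"

text \<open>
  The canonical map from \<open>H_suf\<close> of a graph to \<open>H_uf\<close>, induced by the inclusion of the graph in
  its Rips complex at scale \<open>1\<close>.
\<close>

definition suf_to_uf ::
  "'v set \<Rightarrow> 'v set set \<Rightarrow> nat \<Rightarrow> ('v list \<Rightarrow> 'a::coeff_ring) set \<Rightarrow>
     (nat \<times> ('v list \<Rightarrow> 'a) set) set" where
  "suf_to_uf V E n X =
     dirlim_rel (\<lambda>r. H_suf (rips V E r) n) (\<lambda>r s. incl_map (rips V E s) n)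
       `` {(1, incl_map (rips V E 1) n X)}"


section \<open>Building the tree from rays\<close>

text \<open>
  \<open>L\<close> parametrises the line \<open>T\<^sub>1\<close>, \<open>B n\<close> is the set of branching points of depth \<open>n \<ge> 1\<close>, and
  \<open>R v\<close> is the ray glued at the branching point \<open>v\<close>.

  The flag \<open>mid\<close> tells where the root \<open>v\<^sub>0\<close> is. If it is false, then \<open>v\<^sub>0 = L 0\<close>; this vertex
  never branches, so it has degree \<open>2\<close> in the final tree. A tree all of whose vertices have
  degree \<open>3\<close> is only obtained up to suppressing this degree \<open>2\<close> vertex, i.e. merging the two edges
  at \<open>v\<^sub>0\<close> into one. This is the case where \<open>mid\<close> is true: \<open>v\<^sub>0\<close> is the midpoint of the edge
  \<open>{L 0, L 1}\<close> and not a vertex. In both cases the vertices other than \<open>v\<^sub>0\<close> on the two rays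
  issuing from \<open>v\<^sub>0\<close> are the values of the two functions in \<open>rays \<dots> (Suc 0)\<close> at positions
  \<open>i \<ge> 1\<close>; if \<open>mid\<close> is true, each of the two functions starts by crossing the whole edge
  \<open>{L 0, L 1}\<close>.
\<close>

fun stage_verts ::
  "bool \<Rightarrow> (int \<Rightarrow> 'v) \<Rightarrow> (nat \<Rightarrow> 'v set) \<Rightarrow> ('v \<Rightarrow> nat \<Rightarrow> 'v) \<Rightarrow> nat \<Rightarrow> 'v set" where
  "stage_verts mid L B R 0 = (if mid then {} else {L 0})"
| "stage_verts mid L B R (Suc 0) = range L"
| "stage_verts mid L B R (Suc (Suc n)) =
     stage_verts mid L B R (Suc n) \<union> (\<Union>v\<in>B (Suc n). range (R v))"

fun stage_edges ::
  "(int \<Rightarrow> 'v) \<Rightarrow> (nat \<Rightarrow> 'v set) \<Rightarrow> ('v \<Rightarrow> nat \<Rightarrow> 'v) \<Rightarrow> nat \<Rightarrow> 'v set set" where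
  "stage_edges L B R 0 = {}"
| "stage_edges L B R (Suc 0) = range (\<lambda>k. {L k, L (k + 1)})"
| "stage_edges L B R (Suc (Suc n)) =
     stage_edges L B R (Suc n) \<union> (\<Union>v\<in>B (Suc n). range (\<lambda>i. {R v i, R v (Suc i)}))"

definition ray_construction ::
  "'v set \<Rightarrow> 'v set set \<Rightarrow> bool \<Rightarrow> (int \<Rightarrow> 'v) \<Rightarrow> (nat \<Rightarrow> 'v set) \<Rightarrow> ('v \<Rightarrow> nat \<Rightarrow> 'v) \<Rightarrow> bool" where
  "ray_construction V E mid L B R \<longleftrightarrow>
     inj L \<and>
     (\<forall>n\<ge>1. B n \<subseteq> stage_verts mid L B R n - stage_verts mid L B R (n - 1)) \<and>
     (\<forall>n\<ge>1. \<forall>v\<in>B n. R v 0 = v \<and> inj (R v) \<and> (\<forall>i. R v (Suc i) \<notin> stage_verts mid L B R n)) \<and>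
     (\<forall>n\<ge>1. \<forall>v\<in>B n. \<forall>w\<in>B n. v \<noteq> w \<longrightarrow> range (R v) \<inter> range (R w) = {}) \<and>
     V = (\<Union>n. stage_verts mid L B R n) \<and>
     E = (\<Union>n. stage_edges L B R n)"

fun rays ::
  "bool \<Rightarrow> (int \<Rightarrow> 'v) \<Rightarrow> (nat \<Rightarrow> 'v set) \<Rightarrow> ('v \<Rightarrow> nat \<Rightarrow> 'v) \<Rightarrow> nat \<Rightarrow> (nat \<Rightarrow> 'v) set" where
  "rays mid L B R 0 = {}"
| "rays mid L B R (Suc 0) = {\<lambda>i. L (int i), \<lambda>i. L (of_bool mid - int i)}"
| "rays mid L B R (Suc (Suc n)) = R ` B (Suc n)"


section \<open>The bi-infinite paths\<close>

text \<open>For a ray \<open>r\<close> with branching points \<open>v = r i\<close> and \<open>w = r j\<close>, \<open>i < j\<close>: the path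
  \<open>R\<^sub>v\<^sup>-\<^sup>1 + [v, w] + R\<^sub>w\<close>, and the path \<open>R\<^sub>v\<^sup>-\<^sup>1 + [v, \<infinity>]\<close>, both passing through \<open>v\<close> at time \<open>0\<close>.\<close>

definition join_bip :: "('v \<Rightarrow> nat \<Rightarrow> 'v) \<Rightarrow> (nat \<Rightarrow> 'v) \<Rightarrow> nat \<Rightarrow> nat \<Rightarrow> int \<Rightarrow> 'v" where
  "join_bip R r i j k =
     (if k \<le> 0 then R (r i) (nat (- k))
      else if k \<le> int (j - i) then r (i + nat k)
      else R (r j) (nat (k - int (j - i))))"

definition end_bip :: "('v \<Rightarrow> nat \<Rightarrow> 'v) \<Rightarrow> (nat \<Rightarrow> 'v) \<Rightarrow> nat \<Rightarrow> int \<Rightarrow> 'v" where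
  "end_bip R r i k = (if k \<le> 0 then R (r i) (nat (- k)) else r (i + nat k))"

definition branch_pos :: "'v set \<Rightarrow> (nat \<Rightarrow> 'v) \<Rightarrow> nat set" where
  "branch_pos S r = {i. 1 \<le> i \<and> r i \<in> S}"

definition ray_bips :: "('v \<Rightarrow> nat \<Rightarrow> 'v) \<Rightarrow> 'v set \<Rightarrow> (nat \<Rightarrow> 'v) \<Rightarrow> (int \<Rightarrow> 'v) set" where
  "ray_bips R S r =
     {join_bip R r i j |i j. i \<in> branch_pos S r \<and> j \<in> branch_pos S r \<and> i < j \<and>
        (\<forall>k\<in>branch_pos S r. \<not> (i < k \<and> k < j))} \<union>
     {end_bip R r i |i. i \<in> branch_pos S r \<and> (\<forall>k\<in>branch_pos S r. k \<le> i)}"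

fun bips_upto ::
  "bool \<Rightarrow> (int \<Rightarrow> 'v) \<Rightarrow> (nat \<Rightarrow> 'v set) \<Rightarrow> ('v \<Rightarrow> nat \<Rightarrow> 'v) \<Rightarrow> nat \<Rightarrow> (int \<Rightarrow> 'v) set" where
  "bips_upto mid L B R 0 = {}"
| "bips_upto mid L B R (Suc 0) = {L}"
| "bips_upto mid L B R (Suc (Suc n)) =
     bips_upto mid L B R (Suc n) \<union> (\<Union>r\<in>rays mid L B R (Suc n). ray_bips R (B (Suc n)) r)"

definition bips ::
  "bool \<Rightarrow> (int \<Rightarrow> 'v) \<Rightarrow> (nat \<Rightarrow> 'v set) \<Rightarrow> ('v \<Rightarrow> nat \<Rightarrow> 'v) \<Rightarrow> (int \<Rightarrow> 'v) set" where
  "bips mid L B R = (\<Union>n. bips_upto mid L B R n)"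

text \<open>The oriented \<open>1\<close>-cycle of a path that crosses every edge at most once.\<close>

definition bip_chain :: "(int \<Rightarrow> 'v) \<Rightarrow> 'v list \<Rightarrow> 'a::coeff_ring" where
  "bip_chain p xs =
     (if \<exists>k. xs = [p k, p (k + 1)] then 1
      else if \<exists>k. xs = [p (k + 1), p k] then - 1
      else 0)"

definition bip_edges :: "(int \<Rightarrow> 'v) \<Rightarrow> 'v set set" where
  "bip_edges p = range (\<lambda>k. {p k, p (k + 1)})"

definition bip_sum :: "(int \<Rightarrow> 'v) set \<Rightarrow> ((int \<Rightarrow> 'v) \<Rightarrow> 'a::coeff_ring) \<Rightarrow> 'v list \<Rightarrow> 'a" where
  "bip_sum P f xs = (\<Sum>p | p \<in> P \<and> set xs \<in> bip_edges p. f p * bip_chain p xs)"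

definition bip_map ::
  "'v set \<Rightarrow> 'v set set \<Rightarrow> (int \<Rightarrow> 'v) set \<Rightarrow> ((int \<Rightarrow> 'v) \<Rightarrow> 'a::coeff_ring) \<Rightarrow>
     ('v list \<Rightarrow> 'a) set" where
  "bip_map V E P f = hclass (graph_complex V E) 1 (bip_sum P f)"

end

theory Submission
  imports Defs
begin

text \<open>
  A tree carries no \<open>2\<close>-simplices, so \<open>H_suf\<close> in degree \<open>1\<close> is the group of bounded flows.

  Every ray \<open>r\<close> of the construction is crossed with constant multiplicity by the bips that use
  \<open>r\<close> as an end, and besides these each of its edges lies on at most one bip, namely the one
  issuing from the last branching point before that edge. Hence the flow \<open>c\<close> of \<open>f\<close> satisfies
  \<open>f(p) = c[r i, r (i+1)] - c[r 0, r 1]\<close> for the bip \<open>p\<close> that starts at the branching point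
  \<open>r i\<close>, and \<open>f(L) = c[L 0, L 1]\<close>. For an arbitrary flow \<open>c\<close> these formulas define a bounded
  preimage: by the conservation law both flows agree along each ray once they agree on its first
  edge, and on the first edge of the ray at \<open>v\<close> both are the defect at \<open>v\<close> of the ray through \<open>v\<close>.

  For uniformly finite homology, a \<open>1\<close>-cycle at scale \<open>r + 1\<close> is pushed to scale \<open>r\<close> by
  replacing each longest edge by the two other sides of a triangle through an intermediate vertex,
  which gives surjectivity. Conversely, removing an edge splits the tree in two, and the total
  amount a boundary carries from one part to the other vanishes by antisymmetry, while a flow
  carries its value on that edge; so a flow that bounds at some scale is zero.
\<close>

section \<open>Coefficients and groups of functions\<close>

class normed_coeff_ring = coeff_ring +
  assumes cnorm_zero [simp]: "cnorm 0 = 0"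
    and cnorm_minus [simp]: "cnorm (- a) = cnorm a"
    and cnorm_add: "cnorm (a + b) \<le> cnorm a + cnorm b"
begin

lemma cnorm_nonneg: "0 \<le> cnorm a"
  using cnorm_add[of a "- a"] by simp

lemma cnorm_diff: "cnorm (a - b) \<le> cnorm a + cnorm b"
  using cnorm_add[of a "- b"] by simp

lemma cnorm_sum: "cnorm (\<Sum>x\<in>A. f x) \<le> (\<Sum>x\<in>A. cnorm (f x))"
  by (induction A rule: infinite_finite_induct) (auto intro: order_trans[OF cnorm_add])

end

instance int :: normed_coeff_ring
  by standard (auto simp: cnorm_int_def)

instance bit :: normed_coeff_ring
proof
  fix a b :: bit
  show "cnorm (a + b) \<le> cnorm a + cnorm b" by (cases a; cases b) (auto simp: cnorm_bit_def)
qed (auto simp: cnorm_bit_def)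

lemma bounded_funI: "(\<And>x. cnorm (f x) \<le> M) \<Longrightarrow> bounded_fun f"
  unfolding bounded_fun_def by blast

lemma bounded_funE:
  fixes f :: "'x \<Rightarrow> 'a::normed_coeff_ring"
  assumes "bounded_fun f"
  obtains M where "M \<ge> 0" "\<And>x. cnorm (f x) \<le> M"
proof -
  obtain M where "\<forall>x. cnorm (f x) \<le> M" using assms unfolding bounded_fun_def by blast
  then show ?thesis using that[of M] cnorm_nonneg order_trans by blast
qed

lemma bounded_fun_minus: "bounded_fun f \<Longrightarrow> bounded_fun (\<lambda>x. - f x :: 'a::normed_coeff_ring)"
  unfolding bounded_fun_def by auto

lemma bounded_fun_add:
  fixes f g :: "'x \<Rightarrow> 'a::normed_coeff_ring"
  assumes "bounded_fun f" "bounded_fun g"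
  shows "bounded_fun (\<lambda>x. f x + g x)"
proof -
  obtain M N where "\<And>x. cnorm (f x) \<le> M" "\<And>x. cnorm (g x) \<le> N"
    using assms unfolding bounded_fun_def by blast
  then show ?thesis by (intro bounded_funI[of _ "M + N"] order_trans[OF cnorm_add] add_mono)
qed

lemma sup_norm_upper: "bounded_fun f \<Longrightarrow> cnorm (f x) \<le> sup_norm f"
  unfolding sup_norm_def bounded_fun_def by (intro cSUP_upper) (auto simp: bdd_above_def)

lemma carrier_fun_group [simp]: "carrier (fun_group S) = S"
  and mult_fun_group [simp]: "f \<otimes>\<^bsub>fun_group S\<^esub> g = (\<lambda>x. f x + g x)"
  and one_fun_group [simp]: "\<one>\<^bsub>fun_group S\<^esub> = (\<lambda>x. 0)"
  by (simp_all add: fun_group_def)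

locale additive_fun_set =
  fixes S :: "('x \<Rightarrow> 'a::ab_group_add) set"
  assumes zero_mem: "(\<lambda>x. 0) \<in> S"
    and add_mem: "f \<in> S \<Longrightarrow> g \<in> S \<Longrightarrow> (\<lambda>x. f x + g x) \<in> S"
    and minus_mem: "f \<in> S \<Longrightarrow> (\<lambda>x. - f x) \<in> S"
begin

lemma diff_mem: "f \<in> S \<Longrightarrow> g \<in> S \<Longrightarrow> (\<lambda>x. f x - g x) \<in> S"
  using add_mem[OF _ minus_mem, of f g] by simp

lemma comm_group_fun_group: "comm_group (fun_group S)"
proof (rule comm_groupI)
  show "\<exists>g\<in>carrier (fun_group S). g \<otimes>\<^bsub>fun_group S\<^esub> f = \<one>\<^bsub>fun_group S\<^esub>"
    if "f \<in> carrier (fun_group S)" for f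
    using that minus_mem[of f] by (auto intro!: bexI[of _ "\<lambda>x. - f x"])
qed (auto simp: zero_mem add_mem add_ac)

sublocale fun_group: comm_group "fun_group S"
  by (rule comm_group_fun_group)

lemma inv_fun_group: "f \<in> S \<Longrightarrow> inv\<^bsub>fun_group S\<^esub> f = (\<lambda>x. - f x)"
  by (rule fun_group.inv_equality) (auto simp: minus_mem)

lemma normal_fun_group:
  assumes "additive_fun_set U" "U \<subseteq> S"
  shows "U \<lhd> fun_group S"
proof (rule fun_group.subgroup_imp_normal, rule fun_group.subgroupI)
  interpret U: additive_fun_set U by fact
  show "U \<noteq> {}" using U.zero_mem by blast
  show "inv\<^bsub>fun_group S\<^esub> f \<in> U" if "f \<in> U" for f
    using that inv_fun_group[of f] U.minus_mem assms(2) by auto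
  show "f \<otimes>\<^bsub>fun_group S\<^esub> g \<in> U" if "f \<in> U" "g \<in> U" for f g
    using that U.add_mem by simp
qed (use assms(2) in simp)

end

lemma linf_additive:
  "additive_fun_set {f :: 'x \<Rightarrow> 'a::normed_coeff_ring. (\<forall>x. x \<notin> P \<longrightarrow> f x = 0) \<and> bounded_fun f}"
  by standard (auto intro: bounded_fun_add bounded_fun_minus bounded_funI[of _ 0])

lemma group_linf: "group (linf P :: ('x \<Rightarrow> 'a::normed_coeff_ring) monoid)"
  unfolding linf_def
  by (intro comm_group.axioms(2) additive_fun_set.comm_group_fun_group linf_additive)

lemma carrier_linf: "f \<in> carrier (linf P) \<longleftrightarrow> (\<forall>x. x \<notin> P \<longrightarrow> f x = 0) \<and> bounded_fun f"
  by (simp add: linf_def)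

section \<open>Bounded chains\<close>

lemma chains_additive: "additive_fun_set (chains K n :: ('v list \<Rightarrow> 'a::normed_coeff_ring) set)"
proof
  fix c d :: "'v list \<Rightarrow> 'a" assume "c \<in> chains K n" "d \<in> chains K n"
  then show "(\<lambda>xs. c xs + d xs) \<in> chains K n"
    unfolding chains_def by (auto simp: bounded_fun_add) (metis add_0)+
qed (auto simp: chains_def bounded_fun_minus intro: bounded_funI[of _ 0])

lemmas chains_zero = additive_fun_set.zero_mem[OF chains_additive]
  and chains_add = additive_fun_set.add_mem[OF chains_additive]
  and chains_minus = additive_fun_set.minus_mem[OF chains_additive]

lemma chains_mono: "K \<subseteq> K' \<Longrightarrow> chains K n \<subseteq> chains K' n"
  unfolding chains_def by blast

lemma cycles_mono: "K \<subseteq> K' \<Longrightarrow> cycles K n \<subseteq> cycles K' n"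
  unfolding cycles_def using chains_mono by blast

lemma boundaries_mono: "K \<subseteq> K' \<Longrightarrow> boundaries K n \<subseteq> boundaries K' n"
  unfolding boundaries_def by (intro image_mono chains_mono)

lemma chains_bounded: "c \<in> chains K n \<Longrightarrow> bounded_fun c"
  unfolding chains_def by blast

lemma chains_nonzeroD:
  "c \<in> chains K n \<Longrightarrow> c xs \<noteq> 0 \<Longrightarrow> length xs = Suc n \<and> distinct xs \<and> set xs \<in> K"
  unfolding chains_def by blast

lemma chains_swap:
  "c \<in> chains K n \<Longrightarrow> i < j \<Longrightarrow> j < length xs \<Longrightarrow> c (xs[i := xs ! j, j := xs ! i]) = - c xs"
  unfolding chains_def by blast

lemma chains_swap_hd: "c \<in> chains K n \<Longrightarrow> c (y # x # ys) = - c (x # y # ys)"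
  using chains_swap[of c K n 0 1 "x # y # ys"] by simp

lemma chainsI:
  assumes bounded: "bounded_fun c"
    and support: "\<And>xs. c xs \<noteq> 0 \<Longrightarrow> length xs = Suc n \<and> distinct xs \<and> set xs \<in> K"
    and swap: "\<And>xs i j. length xs = Suc n \<Longrightarrow> i < j \<Longrightarrow> j \<le> n \<Longrightarrow>
      c (xs[i := xs ! j, j := xs ! i]) = - c xs"
  shows "c \<in> chains K n"
proof -
  have "c (xs[i := xs ! j, j := xs ! i]) = - c xs" if "i < j" "j < length xs" for xs i j
  proof (cases "length xs = Suc n")
    case True
    then show ?thesis using swap that by simp
  next
    case False
    then have "c xs = 0" "c (xs[i := xs ! j, j := xs ! i]) = 0"
      using support[of xs] support[of "xs[i := xs ! j, j := xs ! i]"] by auto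
    then show ?thesis by simp
  qed
  then show ?thesis using bounded support unfolding chains_def by blast
qed

lemma chains_1I:
  assumes "bounded_fun c"
    and support: "\<And>xs. c xs \<noteq> 0 \<Longrightarrow> \<exists>x y. xs = [x, y] \<and> x \<noteq> y \<and> {x, y} \<in> K"
    and antisym: "\<And>x y. c [y, x] = - c [x, y]"
  shows "c \<in> chains K 1"
proof (rule chainsI[OF assms(1)])
  show "length xs = Suc 1 \<and> distinct xs \<and> set xs \<in> K" if "c xs \<noteq> 0" for xs
    using support[OF that] by auto
  show "c (xs[i := xs ! j, j := xs ! i]) = - c xs"
    if size: "length xs = Suc 1" and bounds: "i < j" "j \<le> 1" for xs i j
  proof -
    obtain x y where "xs = [x, y]" using size by (auto simp: length_Suc_conv)
    moreover have "i = 0" "j = 1" using bounds by auto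
    ultimately show ?thesis using antisym[of y x] by simp
  qed
qed

lemma chains_1D: "c \<in> chains K 1 \<Longrightarrow> c xs \<noteq> 0 \<Longrightarrow> \<exists>x y. xs = [x, y] \<and> x \<noteq> y \<and> {x, y} \<in> K"
  using chains_nonzeroD[of c K 1 xs] by (auto simp: length_Suc_conv)

lemma chains_1_antisym: "c \<in> chains K 1 \<Longrightarrow> c [y, x] = - c [x, y]"
  by (rule chains_swap_hd)

lemma chains_1_subI:
  assumes "c \<in> chains K 1" and "\<And>x y. c [x, y] \<noteq> 0 \<Longrightarrow> {x, y} \<in> K'"
  shows "c \<in> chains K' 1"
proof (rule chains_1I[OF chains_bounded[OF assms(1)] _ chains_1_antisym[OF assms(1)]])
  show "\<exists>x y. xs = [x, y] \<and> x \<noteq> y \<and> {x, y} \<in> K'" if "c xs \<noteq> 0" for xs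
    using chains_1D[OF assms(1) that] assms(2) that by blast
qed

lemma chains_2I:
  assumes "bounded_fun d"
    and support: "\<And>xs. d xs \<noteq> 0 \<Longrightarrow>
      \<exists>x y z. xs = [x, y, z] \<and> distinct [x, y, z] \<and> {x, y, z} \<in> K"
    and swap_first: "\<And>x y z. d [y, x, z] = - d [x, y, z]"
    and swap_last: "\<And>x y z. d [x, z, y] = - d [x, y, z]"
  shows "d \<in> chains K 2"
proof (rule chainsI[OF assms(1)])
  show "length xs = Suc 2 \<and> distinct xs \<and> set xs \<in> K" if "d xs \<noteq> 0" for xs
    using support[OF that] by auto
  have swap_outer: "d [z, y, x] = - d [x, y, z]" for x y z
    unfolding swap_first[of y z x] swap_last[of y x z] swap_first[of x y z] by simp
  show "d (xs[i := xs ! j, j := xs ! i]) = - d xs"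
    if size: "length xs = Suc 2" and bounds: "i < j" "j \<le> 2" for xs i j
  proof -
    obtain x y z where "xs = [x, y, z]"
      using size by (auto simp: numeral_2_eq_2 length_Suc_conv)
    moreover have "i = 0 \<and> j = 1 \<or> i = 0 \<and> j = 2 \<or> i = 1 \<and> j = 2" using bounds by auto
    ultimately show ?thesis
      using swap_first[of x y z] swap_last[of x y z] swap_outer[of x y z] by (elim disjE) simp_all
  qed
qed

lemma chains_2_cyclic:
  fixes g :: "'v \<Rightarrow> 'v \<Rightarrow> 'v \<Rightarrow> 'a::normed_coeff_ring"
  assumes bound: "\<And>x y z. cnorm (g x y z) \<le> N"
    and support: "\<And>x y z. g x y z \<noteq> 0 \<Longrightarrow> distinct [x, y, z] \<and> {x, y, z} \<in> K"
    and antisym: "\<And>x y z. g z y x = - g x y z"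
  shows "(\<lambda>xs. case xs of [x, y, z] \<Rightarrow> g x y z + g y z x + g z x y | _ \<Rightarrow> 0) \<in> chains K 2"
    (is "?d \<in> _")
proof (rule chains_2I)
  have triple: "\<exists>x y z. xs = [x, y, z]" if "?d xs \<noteq> 0" for xs
    using that by (auto split: list.splits)
  have "0 \<le> N" using bound cnorm_nonneg order_trans by blast
  have "cnorm (?d xs) \<le> N + N + N" for xs
  proof (cases "?d xs = 0")
    case False
    then obtain x y z where xs_eq: "xs = [x, y, z]" using triple by blast
    have "cnorm (g x y z + g y z x + g z x y) \<le> N + N + N"
      by (intro order_trans[OF cnorm_add] add_mono bound)
    then show ?thesis by (simp add: xs_eq)
  qed (use \<open>0 \<le> N\<close> in simp)
  then show "bounded_fun ?d" by (rule bounded_funI)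
  show "\<exists>x y z. xs = [x, y, z] \<and> distinct [x, y, z] \<and> {x, y, z} \<in> K" if nonzero: "?d xs \<noteq> 0" for xs
  proof -
    obtain x y z where xs_eq: "xs = [x, y, z]" using triple[OF nonzero] by blast
    then have "g x y z \<noteq> 0 \<or> g y z x \<noteq> 0 \<or> g z x y \<noteq> 0" using nonzero by auto
    moreover have "{y, z, x} = {x, y, z}" "{z, x, y} = {x, y, z}" by auto
    ultimately show ?thesis using support[of x y z] support[of y z x] support[of z x y] xs_eq
      by auto
  qed
  show "?d [y, x, z] = - ?d [x, y, z]" "?d [x, z, y] = - ?d [x, y, z]" for x y z
    using antisym[of x y z] antisym[of y z x] antisym[of z x y] by simp_all
qed

lemma bdry_eq_sum:
  assumes "finite X" "{x. c (x # ys) \<noteq> 0} \<subseteq> X" "ys \<noteq> []"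
  shows "bdry c ys = (\<Sum>x\<in>X. c (x # ys))"
  using assms unfolding bdry_def by (auto intro!: sum.mono_neutral_left)

lemma bdry_zero: "bdry (\<lambda>xs. 0) = (\<lambda>ys. 0)"
  unfolding bdry_def by auto

lemma bdry_minus: "bdry (\<lambda>xs. - c xs) = (\<lambda>ys. - bdry c ys)"
  unfolding bdry_def by (auto simp: sum_negf)

lemma sum_antisymmetric_eq_0:
  fixes g :: "'x \<Rightarrow> 'x \<Rightarrow> 'a::ab_group_add"
  assumes "finite A" "\<And>x y. g x y = - g y x" "\<And>x. g x x = 0"
  shows "(\<Sum>x\<in>A. \<Sum>y\<in>A. g x y) = 0"
  using assms(1)
proof (induction A rule: finite_induct)
  case (insert a A)
  have "(\<Sum>x\<in>insert a A. \<Sum>y\<in>insert a A. g x y) = (\<Sum>y\<in>A. g a y) + (\<Sum>x\<in>A. g x a)"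
    using insert assms(3) by (simp add: sum.distrib)
  also have "(\<Sum>x\<in>A. g x a) = - (\<Sum>y\<in>A. g a y)"
    using assms(2)[of _ a] by (simp add: sum_negf)
  finally show ?case by simp
qed simp

lemma sum_bdry_across_cut:
  fixes d :: "'v list \<Rightarrow> 'a::normed_coeff_ring"
  assumes d_chain: "d \<in> chains K 2" and finite_parts: "finite A" "finite C"
    and disjoint: "A \<inter> C = {}"
    and near: "\<And>x y z. x \<in> A \<Longrightarrow> y \<in> C \<Longrightarrow> d [z, x, y] \<noteq> 0 \<Longrightarrow> z \<in> A \<union> C"
  shows "(\<Sum>x\<in>A. \<Sum>y\<in>C. bdry d [x, y]) = 0"
proof -
  have sum_A: "(\<Sum>x\<in>A. \<Sum>z\<in>A. d [z, x, y]) = 0" for y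
  proof (rule sum_antisymmetric_eq_0[OF finite_parts(1)])
    show "d [z, x, y] = - d [x, z, y]" for x z by (rule chains_swap_hd[OF d_chain])
    show "d [x, x, y] = 0" for x using chains_nonzeroD[OF d_chain, of "[x, x, y]"] by auto
  qed
  have sum_C: "(\<Sum>y\<in>C. \<Sum>z\<in>C. d [z, x, y]) = 0" for x
  proof (rule sum_antisymmetric_eq_0[OF finite_parts(2)])
    show "d [z, x, y] = - d [y, x, z]" for y z
      using chains_swap[OF d_chain, of 0 2 "[y, x, z]"] by simp
    show "d [y, x, y] = 0" for y using chains_nonzeroD[OF d_chain, of "[y, x, y]"] by auto
  qed
  have "bdry d [x, y] = (\<Sum>z\<in>A. d [z, x, y]) + (\<Sum>z\<in>C. d [z, x, y])" if "x \<in> A" "y \<in> C" for x y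
  proof -
    have "bdry d [x, y] = (\<Sum>z\<in>A \<union> C. d [z, x, y])"
      by (rule bdry_eq_sum) (use near[OF that] finite_parts in auto)
    then show ?thesis using finite_parts disjoint by (simp add: sum.union_disjoint)
  qed
  then have "(\<Sum>x\<in>A. \<Sum>y\<in>C. bdry d [x, y]) =
      (\<Sum>x\<in>A. \<Sum>y\<in>C. (\<Sum>z\<in>A. d [z, x, y]) + (\<Sum>z\<in>C. d [z, x, y]))"
    by (intro sum.cong) auto
  also have "\<dots> = (\<Sum>y\<in>C. \<Sum>x\<in>A. \<Sum>z\<in>A. d [z, x, y]) + (\<Sum>x\<in>A. \<Sum>y\<in>C. \<Sum>z\<in>C. d [z, x, y])"
    unfolding sum.distrib by (subst sum.swap) simp
  finally show ?thesis unfolding sum_A sum_C by simp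
qed

section \<open>Homology of complexes of bounded geometry\<close>

definition star :: "'v set set \<Rightarrow> 'v \<Rightarrow> 'v set" where
  "star K v = \<Union>{s \<in> K. v \<in> s}"

lemma chain_support_star:
  assumes "c \<in> chains K n" "c xs \<noteq> 0" "x \<in> set xs" "y \<in> set xs"
  shows "x \<in> star K y"
  using chains_nonzeroD[OF assms(1,2)] assms unfolding star_def by blast

locale bounded_complex =
  fixes K :: "'v set set"
  assumes face: "s \<in> K \<Longrightarrow> t \<subseteq> s \<Longrightarrow> t \<noteq> {} \<Longrightarrow> t \<in> K"
    and bounded_geometry: "\<exists>N. \<forall>v. finite (star K v) \<and> card (star K v) \<le> N"
begin

lemma finite_star: "finite (star K v)"
  using bounded_geometry by blast

lemma bdry_star:
  assumes "c \<in> chains K n" "ys \<noteq> []"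
  shows "bdry c ys = (\<Sum>x\<in>star K (hd ys). c (x # ys))"
  by (rule bdry_eq_sum)
    (use assms in \<open>auto intro: finite_star chain_support_star[where xs = "_ # ys"]\<close>)

lemma bdry_add:
  fixes c d :: "'v list \<Rightarrow> 'a::normed_coeff_ring"
  assumes "c \<in> chains K n" "d \<in> chains K n"
  shows "bdry (\<lambda>xs. c xs + d xs) = (\<lambda>ys. bdry c ys + bdry d ys)"
proof
  fix ys
  show "bdry (\<lambda>xs. c xs + d xs) ys = bdry c ys + bdry d ys"
  proof (cases "ys = []")
    case False
    then show ?thesis
      using bdry_star[OF assms(1)] bdry_star[OF assms(2)] bdry_star[OF chains_add[OF assms]]
      by (simp add: sum.distrib)
  qed (simp add: bdry_def)
qed

lemma bounded_fun_bdry: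
  fixes c :: "'v list \<Rightarrow> 'a::normed_coeff_ring"
  assumes chain: "c \<in> chains K n"
  shows "bounded_fun (bdry c)"
proof -
  obtain M where bound: "M \<ge> 0" "\<And>xs. cnorm (c xs) \<le> M"
    using bounded_funE[OF chains_bounded[OF chain]] by blast
  obtain N where card_star: "\<And>v. card (star K v) \<le> N" using bounded_geometry by blast
  have "cnorm (bdry c ys) \<le> real N * M" for ys
  proof (cases "ys = []")
    case False
    have "cnorm (bdry c ys) \<le> (\<Sum>x\<in>star K (hd ys). cnorm (c (x # ys)))"
      unfolding bdry_star[OF chain False] by (rule cnorm_sum)
    also have "\<dots> \<le> real (card (star K (hd ys))) * M" using bound by (intro sum_bounded_above) auto
    also have "\<dots> \<le> real N * M" using card_star bound by (intro mult_right_mono) auto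
    finally show ?thesis .
  qed (use bound in \<open>simp add: bdry_def\<close>)
  then show ?thesis by (rule bounded_funI)
qed

lemma bdry_chain:
  fixes c :: "'v list \<Rightarrow> 'a::normed_coeff_ring"
  assumes chain: "c \<in> chains K (Suc n)"
  shows "bdry c \<in> chains K n"
proof -
  have "length ys = Suc n \<and> distinct ys \<and> set ys \<in> K" if nonzero: "bdry c ys \<noteq> 0" for ys
  proof -
    have nonempty: "ys \<noteq> []" using nonzero unfolding bdry_def by auto
    then obtain x where "c (x # ys) \<noteq> 0"
      using nonzero unfolding bdry_star[OF chain nonempty]
      by (meson sum.not_neutral_contains_not_neutral)
    then show ?thesis
      using chains_nonzeroD[OF chain, of "x # ys"] face[of "insert x (set ys)" "set ys"] nonempty
      by auto
  qed
  moreover have "bdry c (ys[i := ys ! j, j := ys ! i]) = - bdry c ys"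
    if bounds: "i < j" "j < length ys" for ys i j
  proof -
    have "c (x # ys[i := ys ! j, j := ys ! i]) = - c (x # ys)" for x
      using chains_swap[OF chain, of "Suc i" "Suc j" "x # ys"] bounds by simp
    then show ?thesis using bounds unfolding bdry_def by (auto simp: sum_negf)
  qed
  ultimately show ?thesis using bounded_fun_bdry[OF chain] unfolding chains_def by blast
qed

lemma bdry_bdry:
  fixes c :: "'v list \<Rightarrow> 'a::normed_coeff_ring"
  assumes chain: "c \<in> chains K (Suc n)"
  shows "bdry (bdry c) = (\<lambda>ys. 0)"
proof
  fix ys
  show "bdry (bdry c) ys = 0"
  proof (cases "ys = []")
    case False
    let ?X = "star K (hd ys)"
    have "bdry c (y # ys) = (\<Sum>x\<in>?X. c (x # y # ys))" for y
      by (rule bdry_eq_sum) (use False in \<open>auto intro: finite_star chain_support_star[OF chain]\<close>)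
    then have "bdry (bdry c) ys = (\<Sum>y\<in>?X. \<Sum>x\<in>?X. c (x # y # ys))"
      unfolding bdry_star[OF bdry_chain[OF chain] False] by simp
    also have "\<dots> = 0"
      using chains_nonzeroD[OF chain]
      by (intro sum_antisymmetric_eq_0 finite_star chains_swap_hd[OF chain]) fastforce
    finally show ?thesis .
  qed (simp add: bdry_def)
qed

lemma cycles_additive: "additive_fun_set (cycles K n :: ('v list \<Rightarrow> 'a::normed_coeff_ring) set)"
  by standard (auto simp: cycles_def chains_zero chains_add chains_minus
      bdry_zero bdry_add bdry_minus)

lemma boundaries_additive:
  "additive_fun_set (boundaries K n :: ('v list \<Rightarrow> 'a::normed_coeff_ring) set)"
proof
  show "(\<lambda>xs. 0 :: 'a) \<in> boundaries K n"
    unfolding boundaries_def by (rule image_eqI[OF _ chains_zero]) (simp add: bdry_zero)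
next
  fix b b' :: "'v list \<Rightarrow> 'a" assume "b \<in> boundaries K n" "b' \<in> boundaries K n"
  then show "(\<lambda>xs. b xs + b' xs) \<in> boundaries K n"
    unfolding boundaries_def by (auto simp: bdry_add[symmetric] intro!: imageI chains_add)
next
  fix b :: "'v list \<Rightarrow> 'a" assume "b \<in> boundaries K n"
  then show "(\<lambda>xs. - b xs) \<in> boundaries K n"
    unfolding boundaries_def by (auto simp: bdry_minus[symmetric] intro!: imageI chains_minus)
qed

lemma boundaries_subset_cycles:
  "boundaries K n \<subseteq> (cycles K n :: ('v list \<Rightarrow> 'a::normed_coeff_ring) set)"
  unfolding boundaries_def cycles_def using bdry_chain bdry_bdry by blast

lemmas cycles_add = additive_fun_set.add_mem[OF cycles_additive]
  and cycles_diff = additive_fun_set.diff_mem[OF cycles_additive]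
  and boundaries_zero = additive_fun_set.zero_mem[OF boundaries_additive]
  and boundaries_add = additive_fun_set.add_mem[OF boundaries_additive]
  and boundaries_minus = additive_fun_set.minus_mem[OF boundaries_additive]

lemma group_cycles: "group (fun_group (cycles K n :: ('v list \<Rightarrow> 'a::normed_coeff_ring) set))"
  by (intro comm_group.axioms(2) additive_fun_set.comm_group_fun_group cycles_additive)

lemma boundaries_normal:
  "boundaries K n \<lhd> fun_group (cycles K n :: ('v list \<Rightarrow> 'a::normed_coeff_ring) set)"
  by (intro additive_fun_set.normal_fun_group cycles_additive boundaries_additive
      boundaries_subset_cycles)

lemma group_H_suf: "group (H_suf K n :: ('v list \<Rightarrow> 'a::normed_coeff_ring) set monoid)"
  unfolding H_suf_def by (rule normal.factorgroup_is_group[OF boundaries_normal])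

lemma hclass_hom:
  "hclass K n \<in> hom (fun_group (cycles K n))
    (H_suf K n :: ('v list \<Rightarrow> 'a::normed_coeff_ring) set monoid)"
  unfolding H_suf_def hclass_def by (rule normal.r_coset_hom_Mod[OF boundaries_normal])

lemma carrier_H_suf: "carrier (H_suf K n) = hclass K n ` cycles K n"
  unfolding H_suf_def hclass_def by (simp add: carrier_FactGroup)

lemma hclass_eq: "hclass K n z = (\<lambda>b xs. b xs + z xs) ` boundaries K n"
  unfolding hclass_def r_coset_def by auto

lemma hclass_eq_iff:
  fixes z z' :: "'v list \<Rightarrow> 'a::normed_coeff_ring"
  assumes cycles: "z \<in> cycles K n" "z' \<in> cycles K n"
  shows "hclass K n z = hclass K n z' \<longleftrightarrow> (\<lambda>xs. z xs - z' xs) \<in> boundaries K n"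
proof -
  interpret Z: additive_fun_set "cycles K n :: ('v list \<Rightarrow> 'a) set" by (rule cycles_additive)
  interpret normal "boundaries K n" "fun_group (cycles K n :: ('v list \<Rightarrow> 'a) set)"
    by (rule boundaries_normal)
  have "z \<in> hclass K n z"
    unfolding hclass_def using Z.fun_group.rcos_self[OF _ subgroup_axioms] cycles by simp
  moreover have "hclass K n z' = hclass K n z" if "z \<in> hclass K n z'"
    using Z.fun_group.repr_independence[OF _ _ subgroup_axioms] that cycles unfolding hclass_def
    by simp
  ultimately have "hclass K n z = hclass K n z' \<longleftrightarrow> z \<in> hclass K n z'" by blast
  also have "\<dots> \<longleftrightarrow> (\<lambda>xs. z xs - z' xs) \<in> boundaries K n"
    unfolding hclass_def using rcos_module[OF Z.fun_group.is_group, of z' z] cycles Z.inv_fun_group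
    by simp
  finally show ?thesis .
qed

end

locale bounded_complex_pair = sub: bounded_complex K + super: bounded_complex K'
  for K K' :: "'v set set" +
  assumes subset: "K \<subseteq> K'"
begin

lemma incl_map_hclass:
  fixes z :: "'v list \<Rightarrow> 'a::normed_coeff_ring"
  assumes cycle: "z \<in> cycles K n"
  shows "incl_map K' n (hclass K n z) = hclass K' n z"
proof -
  have "hclass K' n (\<lambda>xs. b xs + z xs) = hclass K' n z" if boundary: "b \<in> boundaries K n" for b
  proof -
    have "b \<in> cycles K n" using boundary sub.boundaries_subset_cycles by blast
    then have "(\<lambda>xs. b xs + z xs) \<in> cycles K' n" "z \<in> cycles K' n"
      using cycle sub.cycles_add cycles_mono[OF subset] by blast+
    then show ?thesis using boundary boundaries_mono[OF subset] by (auto simp: super.hclass_eq_iff)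
  qed
  then show ?thesis
    using sub.boundaries_zero[where 'a = 'a, of n] unfolding incl_map_def sub.hclass_eq by auto
qed

lemma incl_map_hom:
  "incl_map K' n \<in> hom (H_suf K n :: ('v list \<Rightarrow> 'a::normed_coeff_ring) set monoid) (H_suf K' n)"
proof (rule homI)
  have cycles_subset: "cycles K n \<subseteq> (cycles K' n :: ('v list \<Rightarrow> 'a) set)"
    by (rule cycles_mono[OF subset])
  fix X :: "('v list \<Rightarrow> 'a) set" assume "X \<in> carrier (H_suf K n)"
  then obtain x where x_rep: "x \<in> cycles K n" "X = hclass K n x"
    unfolding sub.carrier_H_suf by blast
  then show "incl_map K' n X \<in> carrier (H_suf K' n)"
    unfolding super.carrier_H_suf x_rep(2) incl_map_hclass[OF x_rep(1)] using cycles_subset by blast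
  fix Y :: "('v list \<Rightarrow> 'a) set" assume "Y \<in> carrier (H_suf K n)"
  then obtain y where y_rep: "y \<in> cycles K n" "Y = hclass K n y"
    unfolding sub.carrier_H_suf by blast
  have "X \<otimes>\<^bsub>H_suf K n\<^esub> Y = hclass K n (\<lambda>xs. x xs + y xs)"
    using hom_mult[OF sub.hclass_hom, of x n y] x_rep y_rep by simp
  moreover have "hclass K' n x \<otimes>\<^bsub>H_suf K' n\<^esub> hclass K' n y = hclass K' n (\<lambda>xs. x xs + y xs)"
    using hom_mult[OF super.hclass_hom, of x n y] x_rep(1) y_rep(1) cycles_subset by auto
  ultimately show "incl_map K' n (X \<otimes>\<^bsub>H_suf K n\<^esub> Y) = incl_map K' n X \<otimes>\<^bsub>H_suf K' n\<^esub> incl_map K' n Y"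
    using x_rep y_rep incl_map_hclass[OF sub.cycles_add[OF x_rep(1) y_rep(1)]]
    by (simp add: incl_map_hclass)
qed

end

section \<open>Direct limits\<close>

locale direct_system =
  fixes G :: "nat \<Rightarrow> 'g monoid" and \<phi> :: "nat \<Rightarrow> nat \<Rightarrow> 'g \<Rightarrow> 'g"
  assumes monoid: "monoid (G m)"
    and trans_hom: "m \<le> n \<Longrightarrow> \<phi> m n \<in> hom (G m) (G n)"
    and trans_comp: "k \<le> m \<Longrightarrow> m \<le> n \<Longrightarrow> a \<in> carrier (G k) \<Longrightarrow> \<phi> m n (\<phi> k m a) = \<phi> k n a"
begin

abbreviation rel :: "((nat \<times> 'g) \<times> (nat \<times> 'g)) set" where
  "rel \<equiv> dirlim_rel G \<phi>"

abbreviation germ :: "nat \<Rightarrow> 'g \<Rightarrow> (nat \<times> 'g) set" where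
  "germ m a \<equiv> rel `` {(m, a)}"

lemma mult_closed: "a \<in> carrier (G m) \<Longrightarrow> b \<in> carrier (G m) \<Longrightarrow> a \<otimes>\<^bsub>G m\<^esub> b \<in> carrier (G m)"
  by (rule monoid.m_closed[OF monoid])

lemma trans_closed: "m \<le> n \<Longrightarrow> a \<in> carrier (G m) \<Longrightarrow> \<phi> m n a \<in> carrier (G n)"
  using trans_hom hom_in_carrier by metis

lemma trans_mult:
  "m \<le> n \<Longrightarrow> a \<in> carrier (G m) \<Longrightarrow> b \<in> carrier (G m) \<Longrightarrow>
    \<phi> m n (a \<otimes>\<^bsub>G m\<^esub> b) = \<phi> m n a \<otimes>\<^bsub>G n\<^esub> \<phi> m n b"
  using trans_hom hom_mult by metis

lemma rel_iff: "((m, a), (n, b)) \<in> rel \<longleftrightarrow> a \<in> carrier (G m) \<and> b \<in> carrier (G n) \<and>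
     (\<exists>k. m \<le> k \<and> n \<le> k \<and> \<phi> m k a = \<phi> n k b)"
  unfolding dirlim_rel_def by auto

lemma relE:
  assumes "((m, a), (n, b)) \<in> rel"
  obtains k where "m \<le> k" "n \<le> k" "a \<in> carrier (G m)" "b \<in> carrier (G n)"
    "\<And>q. k \<le> q \<Longrightarrow> \<phi> m q a = \<phi> n q b"
proof -
  obtain k where agree: "a \<in> carrier (G m)" "b \<in> carrier (G n)" "m \<le> k" "n \<le> k" "\<phi> m k a = \<phi> n k b"
    using assms unfolding rel_iff by blast
  have "\<phi> m q a = \<phi> n q b" if "k \<le> q" for q
    using trans_comp[of m k q a] trans_comp[of n k q b] agree that by simp
  then show ?thesis using that agree by blast
qed

lemma equiv_rel: "equiv (SIGMA m:UNIV. carrier (G m)) rel"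
proof (rule equivI)
  show "trans rel"
  proof (rule transI)
    fix x y z assume rels: "(x, y) \<in> rel" "(y, z) \<in> rel"
    obtain m a n b p c where [simp]: "x = (m, a)" "y = (n, b)" "z = (p, c)" by (meson surj_pair)
    obtain k where agree_ab: "m \<le> k" "a \<in> carrier (G m)" "\<And>q. k \<le> q \<Longrightarrow> \<phi> m q a = \<phi> n q b"
      using rels(1) by (auto elim: relE)
    obtain l where agree_bc: "p \<le> l" "c \<in> carrier (G p)" "\<And>q. l \<le> q \<Longrightarrow> \<phi> n q b = \<phi> p q c"
      using rels(2) by (auto elim: relE)
    have "\<phi> m (max k l) a = \<phi> p (max k l) c"
      using agree_ab(3)[of "max k l"] agree_bc(3)[of "max k l"] by simp
    then show "(x, z) \<in> rel"
      using agree_ab(1,2) agree_bc(1,2) by (auto simp: rel_iff intro!: exI[of _ "max k l"])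
  qed
qed (auto simp: rel_iff refl_on_def sym_def)

lemma germ_eq_iff:
  assumes "a \<in> carrier (G m)" "b \<in> carrier (G n)"
  shows "germ m a = germ n b \<longleftrightarrow> (\<exists>k. m \<le> k \<and> n \<le> k \<and> \<phi> m k a = \<phi> n k b)"
  using eq_equiv_class_iff[OF equiv_rel, of "(m, a)" "(n, b)"] assms by (auto simp: rel_iff)

lemma germ_trans: "m \<le> n \<Longrightarrow> a \<in> carrier (G m) \<Longrightarrow> germ n (\<phi> m n a) = germ m a"
  by (subst germ_eq_iff) (auto simp: trans_closed trans_comp)

lemma carrier_dirlim: "carrier (dirlim G \<phi>) = (\<Union>m. germ m ` carrier (G m))"
  unfolding dirlim_def quotient_def by auto

lemma germ_mult_stable:
  assumes "m \<le> s" "n \<le> s" "s \<le> q" "a \<in> carrier (G m)" "b \<in> carrier (G n)"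
  shows "germ s (\<phi> m s a \<otimes>\<^bsub>G s\<^esub> \<phi> n s b) = germ q (\<phi> m q a \<otimes>\<^bsub>G q\<^esub> \<phi> n q b)"
proof -
  have "\<phi> s q (\<phi> m s a \<otimes>\<^bsub>G s\<^esub> \<phi> n s b) = \<phi> m q a \<otimes>\<^bsub>G q\<^esub> \<phi> n q b"
    using assms by (simp add: trans_mult trans_closed trans_comp)
  then show ?thesis using assms germ_trans[of s q] mult_closed trans_closed by metis
qed

lemma dirlim_mult:
  assumes "a \<in> carrier (G m)" "b \<in> carrier (G n)" "m \<le> k" "n \<le> k"
  shows "germ m a \<otimes>\<^bsub>dirlim G \<phi>\<^esub> germ n b = germ k (\<phi> m k a \<otimes>\<^bsub>G k\<^esub> \<phi> n k b)" (is "_ = ?R")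
proof -
  have well_defined:
    "germ (max m' n') (\<phi> m' (max m' n') a' \<otimes>\<^bsub>G (max m' n')\<^esub> \<phi> n' (max m' n') b') = ?R"
    if rels: "((m, a), (m', a')) \<in> rel" "((n, b), (n', b')) \<in> rel" for m' n' a' b'
  proof -
    obtain i where agree_a: "m' \<le> i" "a' \<in> carrier (G m')" "\<And>q. i \<le> q \<Longrightarrow> \<phi> m q a = \<phi> m' q a'"
      using rels(1) by (auto elim: relE)
    obtain j where agree_b: "n' \<le> j" "b' \<in> carrier (G n')" "\<And>q. j \<le> q \<Longrightarrow> \<phi> n q b = \<phi> n' q b'"
      using rels(2) by (auto elim: relE)
    define q where "q = max k (max i j)"
    have "germ (max m' n') (\<phi> m' (max m' n') a' \<otimes>\<^bsub>G (max m' n')\<^esub> \<phi> n' (max m' n') b') =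
        germ q (\<phi> m' q a' \<otimes>\<^bsub>G q\<^esub> \<phi> n' q b')"
      using agree_a agree_b by (intro germ_mult_stable) (auto simp: q_def)
    also have "\<dots> = germ q (\<phi> m q a \<otimes>\<^bsub>G q\<^esub> \<phi> n q b)"
      using agree_a(3)[of q] agree_b(3)[of q] by (simp add: q_def)
    also have "\<dots> = ?R" using assms by (intro germ_mult_stable[symmetric]) (auto simp: q_def)
    finally show ?thesis .
  qed
  have "(m, a) \<in> germ m a" "(n, b) \<in> germ n b" using assms by (auto simp: rel_iff)
  then have "(\<Union>(m', a')\<in>germ m a. \<Union>(n', b')\<in>germ n b. ?R) = ?R" by auto
  moreover have "germ m a \<otimes>\<^bsub>dirlim G \<phi>\<^esub> germ n b = (\<Union>(m', a')\<in>germ m a. \<Union>(n', b')\<in>germ n b. ?R)"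
    unfolding dirlim_def monoid.simps Let_def
    by (intro SUP_cong prod.case_cong refl, rule well_defined) auto
  ultimately show ?thesis by simp
qed

lemma germ_hom: "germ p \<in> hom (G p) (dirlim G \<phi>)"
proof (rule homI)
  fix a b assume carrier: "a \<in> carrier (G p)" "b \<in> carrier (G p)"
  have "germ p (a \<otimes>\<^bsub>G p\<^esub> b) = germ p (\<phi> p p (a \<otimes>\<^bsub>G p\<^esub> b))"
    using carrier mult_closed by (intro germ_trans[symmetric]) auto
  then show "germ p (a \<otimes>\<^bsub>G p\<^esub> b) = germ p a \<otimes>\<^bsub>dirlim G \<phi>\<^esub> germ p b"
    using carrier by (simp add: trans_mult dirlim_mult[of _ p _ p p])
qed (auto simp: carrier_dirlim)

lemma iso_dirlim:
  assumes hom_h: "h \<in> hom H (G p)"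
    and inj: "\<And>x y k. x \<in> carrier H \<Longrightarrow> y \<in> carrier H \<Longrightarrow> p \<le> k \<Longrightarrow> \<phi> p k (h x) = \<phi> p k (h y) \<Longrightarrow> x = y"
    and surj: "\<And>m a. a \<in> carrier (G m) \<Longrightarrow> \<exists>x\<in>carrier H. \<exists>k. p \<le> k \<and> m \<le> k \<and> \<phi> p k (h x) = \<phi> m k a"
  shows "(\<lambda>x. germ p (h x)) \<in> iso H (dirlim G \<phi>)"
proof (rule isoI)
  have closed: "h x \<in> carrier (G p)" if "x \<in> carrier H" for x
    using hom_h that hom_in_carrier by metis
  show hom_germ: "(\<lambda>x. germ p (h x)) \<in> hom H (dirlim G \<phi>)"
    using hom_compose[OF hom_h germ_hom] by (simp add: comp_def)
  show "bij_betw (\<lambda>x. germ p (h x)) (carrier H) (carrier (dirlim G \<phi>))"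
  proof (rule bij_betw_imageI)
    show "inj_on (\<lambda>x. germ p (h x)) (carrier H)"
      using germ_eq_iff inj closed unfolding inj_on_def by metis
    have "\<exists>x\<in>carrier H. germ m a = germ p (h x)" if "a \<in> carrier (G m)" for m a
      using surj[OF that] germ_eq_iff[OF closed that] by metis
    then have "carrier (dirlim G \<phi>) \<subseteq> (\<lambda>x. germ p (h x)) ` carrier H"
      unfolding carrier_dirlim by blast
    then show "(\<lambda>x. germ p (h x)) ` carrier H = carrier (dirlim G \<phi>)"
      using hom_carrier[OF hom_germ] by blast
  qed
qed

end

lemma direct_system_H_suf:
  assumes "\<And>r. bounded_complex (K r)" and "mono K"
  shows "direct_system (\<lambda>r. H_suf (K r) n :: ('v list \<Rightarrow> 'a::normed_coeff_ring) set monoid)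
    (\<lambda>r s. incl_map (K s) n)"
proof (rule direct_system.intro)
  have pair: "bounded_complex_pair (K r) (K s)" if "r \<le> s" for r s
    using assms that
    by (auto simp: bounded_complex_pair_def bounded_complex_pair_axioms_def mono_def)
  show "monoid (H_suf (K m) n :: ('v list \<Rightarrow> 'a) set monoid)" for m
    by (intro group.is_monoid bounded_complex.group_H_suf assms)
  show "incl_map (K s) n \<in> hom (H_suf (K r) n :: ('v list \<Rightarrow> 'a) set monoid) (H_suf (K s) n)"
    if "r \<le> s" for r s
    by (rule bounded_complex_pair.incl_map_hom[OF pair[OF that]])
  fix k m l and X :: "('v list \<Rightarrow> 'a) set"
  assume ordered: "k \<le> m" "m \<le> l" and "X \<in> carrier (H_suf (K k) n)"
  then obtain z where cycle: "z \<in> cycles (K k) n" "X = hclass (K k) n z"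
    using bounded_complex.carrier_H_suf[OF assms(1)] by blast
  have cycle_m: "z \<in> cycles (K m) n"
    using cycle(1) cycles_mono monoD[OF assms(2) ordered(1)] by blast
  note incl = bounded_complex_pair.incl_map_hclass[OF pair]
  show "incl_map (K l) n (incl_map (K m) n X) = incl_map (K l) n X"
    using incl[OF ordered(1) cycle(1)] incl[OF ordered(2) cycle_m]
      incl[OF order_trans[OF ordered] cycle(1)] cycle(2) by simp
qed

section \<open>Graphs of bounded degree\<close>

definition adj :: "'v set set \<Rightarrow> ('v \<times> 'v) set" where
  "adj E = {(x, y). {x, y} \<in> E}"

definition nbrs :: "'v set set \<Rightarrow> 'v \<Rightarrow> 'v set" where
  "nbrs E v = {x. {x, v} \<in> E}"

lemma adj_iff [simp]: "(x, y) \<in> adj E \<longleftrightarrow> {x, y} \<in> E"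
  by (simp add: adj_def)

lemma sym_adj: "sym (adj E)"
  by (auto simp: sym_def insert_commute)

lemma nbrs_outside: "simple_graph V E \<Longrightarrow> v \<notin> V \<Longrightarrow> nbrs E v = {}"
  unfolding nbrs_def simple_graph_def by (auto simp: doubleton_eq_iff)

locale bounded_degree_graph =
  fixes V :: "'v set" and E :: "'v set set"
  assumes simple: "simple_graph V E"
    and bounded_degree: "\<exists>N. \<forall>v. finite (nbrs E v) \<and> card (nbrs E v) \<le> N"
begin

abbreviation T :: "'v set set" where
  "T \<equiv> graph_complex V E"

lemma finite_nbrs: "finite (nbrs E v)"
  using bounded_degree by blast

lemma edgeE:
  assumes "e \<in> E"
  obtains x y where "e = {x, y}" "x \<noteq> y" "x \<in> V" "y \<in> V"
  using assms simple unfolding simple_graph_def by metis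

lemma edgeD: "{x, y} \<in> E \<Longrightarrow> x \<noteq> y \<and> x \<in> V \<and> y \<in> V"
  by (rule edgeE[of "{x, y}"]) (auto simp: doubleton_eq_iff)

lemma graph_complex_cases:
  assumes "s \<in> T"
  obtains (vertex) v where "s = {v}" "v \<in> V"
    | (edge) x y where "s = {x, y}" "{x, y} \<in> E" "x \<noteq> y" "x \<in> V" "y \<in> V"
proof -
  consider v where "v \<in> V" "s = {v}" | "s \<in> E" using assms unfolding graph_complex_def by blast
  then show ?thesis using that by cases (blast elim: edgeE)+
qed

lemma edge_graph_complex: "x \<noteq> y \<Longrightarrow> {x, y} \<in> T \<longleftrightarrow> {x, y} \<in> E"
  unfolding graph_complex_def by auto

lemma star_graph_complex: "star T v \<subseteq> insert v (nbrs E v)"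
proof
  fix x assume "x \<in> star T v"
  then obtain s where simplex: "s \<in> T" "x \<in> s" "v \<in> s" unfolding star_def by blast
  from simplex(1) show "x \<in> insert v (nbrs E v)"
    by (cases rule: graph_complex_cases) (use simplex(2,3) in \<open>auto simp: nbrs_def insert_commute\<close>)
qed

sublocale graph: bounded_complex T
proof
  fix s t assume "s \<in> T" and subset: "t \<subseteq> s" "t \<noteq> {}"
  then show "t \<in> T"
  proof (cases rule: graph_complex_cases)
    case (vertex v)
    then have "t = {v}" using subset by auto
    then show ?thesis using vertex unfolding graph_complex_def by auto
  next
    case (edge x y)
    then have "t = {x} \<or> t = {y} \<or> t = s" using subset by auto
    then show ?thesis using edge unfolding graph_complex_def by auto
  qed
next
  obtain N where card_nbrs: "\<And>v. card (nbrs E v) \<le> N" using bounded_degree by blast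
  have "finite (star T v) \<and> card (star T v) \<le> Suc N" for v
  proof -
    have "card (insert v (nbrs E v)) \<le> Suc N"
      using card_nbrs[of v] by (simp add: card_insert_if finite_nbrs)
    then show ?thesis
      using card_mono[OF _ star_graph_complex] finite_subset[OF star_graph_complex] finite_nbrs
      by (meson finite_insert order_trans)
  qed
  then show "\<exists>N. \<forall>v. finite (star T v) \<and> card (star T v) \<le> N" by blast
qed

lemma boundaries_graph: "boundaries T 1 = {\<lambda>xs. 0 :: 'a::normed_coeff_ring}"
proof -
  have "c xs = 0" if chain: "c \<in> chains T (Suc 1)" for c :: "'v list \<Rightarrow> 'a" and xs
  proof (rule ccontr)
    assume "c xs \<noteq> 0"
    then have "length xs = 3" "distinct xs" "set xs \<in> T"
      using chains_nonzeroD[OF chain, of xs] by auto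
    then have "card (set xs) = 3" by (simp add: distinct_card)
    moreover from \<open>set xs \<in> T\<close> have "card (set xs) \<le> 2" by (cases rule: graph_complex_cases) auto
    ultimately show False by simp
  qed
  then have "chains T (Suc 1) = {\<lambda>xs. 0 :: 'a}" using chains_zero by (auto simp: fun_eq_iff)
  then show ?thesis unfolding boundaries_def by (simp add: bdry_zero)
qed

lemma hclass_graph: "hclass T 1 z = {z :: 'v list \<Rightarrow> 'a::normed_coeff_ring}"
  unfolding graph.hclass_eq boundaries_graph by simp

lemma hclass_graph_iso:
  "hclass T 1 \<in> iso (fun_group (cycles T 1))
    (H_suf T 1 :: ('v list \<Rightarrow> 'a::normed_coeff_ring) set monoid)"
proof (rule isoI[OF graph.hclass_hom])
  show "bij_betw (hclass T 1) (carrier (fun_group (cycles T 1)))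
      (carrier (H_suf T 1 :: ('v list \<Rightarrow> 'a) set monoid))"
    by (rule bij_betw_imageI)
      (simp_all add: inj_on_def hclass_graph graph.carrier_H_suf del: One_nat_def)
qed

lemma graph_chain_edge: "c \<in> chains T 1 \<Longrightarrow> c xs \<noteq> 0 \<Longrightarrow> \<exists>x y. xs = [x, y] \<and> {x, y} \<in> E"
  using chains_1D[of c T xs] edge_graph_complex by blast

lemma bdry_graph:
  fixes c :: "'v list \<Rightarrow> 'a::normed_coeff_ring"
  assumes chain: "c \<in> chains T 1"
  shows "bdry c ys = (case ys of [y] \<Rightarrow> (\<Sum>x\<in>nbrs E y. c [x, y]) | _ \<Rightarrow> 0)"
proof (cases "\<exists>y. ys = [y]")
  case True
  then obtain y where singleton: "ys = [y]" by blast
  have "bdry c [y] = (\<Sum>x\<in>nbrs E y. c [x, y])"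
    by (rule bdry_eq_sum) (use finite_nbrs graph_chain_edge[OF chain] in \<open>auto simp: nbrs_def\<close>)
  then show ?thesis using singleton by simp
next
  case False
  then have "c (x # ys) = 0" for x using chains_1D[OF chain, of "x # ys"] by auto
  then have "bdry c ys = 0" unfolding bdry_def by simp
  then show ?thesis using False by (auto split: list.split)
qed

lemma cycles_graph_iff:
  fixes c :: "'v list \<Rightarrow> 'a::normed_coeff_ring"
  shows "c \<in> cycles T 1 \<longleftrightarrow> c \<in> chains T 1 \<and> (\<forall>y. (\<Sum>x\<in>nbrs E y. c [x, y]) = 0)"
proof (cases "c \<in> chains T 1")
  case True
  have "bdry c = (\<lambda>ys. 0) \<longleftrightarrow> (\<forall>y. (\<Sum>x\<in>nbrs E y. c [x, y]) = 0)"
    unfolding fun_eq_iff bdry_graph[OF True] by (auto split: list.split)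
  then show ?thesis using True unfolding cycles_def by simp
qed (simp add: cycles_def)

end

section \<open>Rips complexes of connected graphs\<close>

lemma sym_relpow: "sym r \<Longrightarrow> sym (r ^^ n)"
proof (induction n)
  case (Suc n)
  then have "(r O r ^^ n)\<inverse> = r ^^ n O r" by (simp add: converse_relcomp sym_conv_converse_eq)
  then show ?case by (simp add: sym_conv_converse_eq relpow_commute)
qed (simp add: sym_Id)

locale connected_graph = bounded_degree_graph V E
  for V :: "'v set" and E :: "'v set set" +
  assumes connected: "x \<in> V \<Longrightarrow> y \<in> V \<Longrightarrow> \<exists>xs. walk V E xs \<and> hd xs = x \<and> last xs = y"
begin

abbreviation dist :: "'v \<Rightarrow> 'v \<Rightarrow> nat" where
  "dist \<equiv> gdist V E"

lemma walk_imp_relpow: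
  "walk V E xs \<Longrightarrow> length xs \<le> Suc n \<Longrightarrow> (hd xs, last xs) \<in> ((adj E)\<^sup>=) ^^ n"
proof (induction xs arbitrary: n)
  case (Cons x xs)
  have refl: "(x, x) \<in> ((adj E)\<^sup>=) ^^ n" for n by (induction n) (auto intro: relpow_Suc_I)
  show ?case
  proof (cases xs)
    case (Cons y ys)
    then obtain m where n_eq: "n = Suc m" using Cons.prems by (cases n) auto
    have "walk V E xs" "{x, y} \<in> E" using Cons.prems Cons unfolding walk_def by auto
    then have "(x, y) \<in> (adj E)\<^sup>=" "(y, last xs) \<in> ((adj E)\<^sup>=) ^^ m"
      using Cons.IH[of m] Cons.prems Cons n_eq by auto
    then have "(x, last xs) \<in> ((adj E)\<^sup>=) ^^ Suc m" by (rule relpow_Suc_I2)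
    then show ?thesis using Cons n_eq by simp
  qed (use refl in simp)
qed (simp add: walk_def)

lemma relpow_imp_walk:
  assumes "(x, y) \<in> ((adj E)\<^sup>=) ^^ n" "x \<in> V"
  shows "\<exists>xs. walk V E xs \<and> hd xs = x \<and> last xs = y \<and> length xs \<le> Suc n"
  using assms
proof (induction n arbitrary: x)
  case 0
  then show ?case by (intro exI[of _ "[x]"]) (auto simp: walk_def)
next
  case (Suc n)
  then obtain z where step: "(x, z) \<in> (adj E)\<^sup>=" "(z, y) \<in> ((adj E)\<^sup>=) ^^ n"
    by (meson relpow_Suc_D2)
  then have "z \<in> V" using edgeD Suc.prems by auto
  then obtain xs where tail_walk: "walk V E xs" "hd xs = z" "last xs = y" "length xs \<le> Suc n"
    using Suc.IH step by blast
  show ?case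
  proof (cases "x = z")
    case True
    then show ?thesis using tail_walk by (intro exI[of _ xs]) auto
  next
    case False
    then have "walk V E (x # xs)"
      using step tail_walk Suc.prems unfolding walk_def by (auto simp: successively_Cons)
    then show ?thesis using tail_walk by (intro exI[of _ "x # xs"]) (auto simp: walk_def)
  qed
qed

lemma dist_le_iff:
  assumes "x \<in> V" "y \<in> V"
  shows "dist x y \<le> n \<longleftrightarrow> (x, y) \<in> ((adj E)\<^sup>=) ^^ n"
proof
  have "\<exists>m xs. walk V E xs \<and> hd xs = x \<and> last xs = y \<and> length xs = Suc m"
    using connected[OF assms] unfolding walk_def by (metis Suc_pred length_greater_0_conv)
  then have "\<exists>xs. walk V E xs \<and> hd xs = x \<and> last xs = y \<and> length xs = Suc (dist x y)"
    unfolding gdist_def by (rule LeastI_ex)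
  then show "(x, y) \<in> ((adj E)\<^sup>=) ^^ n" if "dist x y \<le> n" using walk_imp_relpow[of _ n] that by auto
next
  assume "(x, y) \<in> ((adj E)\<^sup>=) ^^ n"
  then obtain xs where short_walk: "walk V E xs" "hd xs = x" "last xs = y" "length xs \<le> Suc n"
    using relpow_imp_walk assms by blast
  then have "length xs = Suc (length xs - 1)" unfolding walk_def by (cases xs) auto
  then have "dist x y \<le> length xs - 1" unfolding gdist_def
    using short_walk by (intro Least_le) blast
  then show "dist x y \<le> n" using short_walk(4) by simp
qed

lemma dist_eq_0_iff: "x \<in> V \<Longrightarrow> y \<in> V \<Longrightarrow> dist x y = 0 \<longleftrightarrow> x = y"
  using dist_le_iff[of x y 0] by simp

lemma dist_refl: "x \<in> V \<Longrightarrow> dist x x = 0"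
  by (simp add: dist_eq_0_iff)

lemma dist_le_1_iff: "x \<in> V \<Longrightarrow> y \<in> V \<Longrightarrow> dist x y \<le> 1 \<longleftrightarrow> x = y \<or> {x, y} \<in> E"
  by (auto simp: dist_le_iff)

lemma dist_sym: "x \<in> V \<Longrightarrow> y \<in> V \<Longrightarrow> dist x y = dist y x"
proof (rule dual_order.antisym)
  have sym_steps: "sym (((adj E)\<^sup>=) ^^ n)" for n by (intro sym_relpow sym_Un sym_adj sym_Id)
  show "dist y x \<le> dist x y" if "x \<in> V" "y \<in> V" for x y
    using that dist_le_iff symD[OF sym_steps] by blast
  then show "dist x y \<le> dist y x" if "x \<in> V" "y \<in> V" using that by blast
qed

lemma dist_triangle:
  assumes "x \<in> V" "y \<in> V" "z \<in> V"
  shows "dist x z \<le> dist x y + dist y z"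
proof -
  have "(x, y) \<in> ((adj E)\<^sup>=) ^^ dist x y" "(y, z) \<in> ((adj E)\<^sup>=) ^^ dist y z"
    using dist_le_iff assms by blast+
  then have "(x, z) \<in> ((adj E)\<^sup>=) ^^ (dist x y + dist y z)" by (rule relpow_trans)
  then show ?thesis using dist_le_iff assms by blast
qed

lemma dist_le_SucE:
  assumes "x \<in> V" "y \<in> V" "dist x y \<le> Suc r"
  obtains m where "m \<in> V" "dist x m \<le> r" "m = y \<or> {m, y} \<in> E"
proof -
  have "(x, y) \<in> ((adj E)\<^sup>=) ^^ Suc r" using assms dist_le_iff by blast
  then obtain m where midpoint: "(x, m) \<in> ((adj E)\<^sup>=) ^^ r" "m = y \<or> {m, y} \<in> E" by auto
  then have "m \<in> V" using edgeD assms(2) by blast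
  then show ?thesis using that midpoint dist_le_iff assms(1) by blast
qed

definition dist_ball :: "'v \<Rightarrow> nat \<Rightarrow> 'v set" where
  "dist_ball x r = {y \<in> V. dist x y \<le> r}"

lemma dist_ball_Suc:
  assumes "x \<in> V"
  shows "dist_ball x (Suc r) \<subseteq> (\<Union>z\<in>dist_ball x r. insert z (nbrs E z))"
proof
  fix y assume "y \<in> dist_ball x (Suc r)"
  then have "y \<in> V" "dist x y \<le> Suc r" unfolding dist_ball_def by auto
  with assms obtain m where "m \<in> V" "dist x m \<le> r" "m = y \<or> {m, y} \<in> E" by (rule dist_le_SucE)
  then show "y \<in> (\<Union>z\<in>dist_ball x r. insert z (nbrs E z))"
    unfolding dist_ball_def nbrs_def by (auto simp: insert_commute)
qed

lemma dist_ball_bounded: "\<exists>M. \<forall>x\<in>V. finite (dist_ball x r) \<and> card (dist_ball x r) \<le> M"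
proof (induction r)
  case 0
  have "dist_ball x 0 = {x}" if "x \<in> V" for x
    using that by (auto simp: dist_ball_def dist_eq_0_iff)
  then show ?case by (intro exI[of _ 1]) simp
next
  case (Suc r)
  then obtain M where ball_bound: "\<And>x. x \<in> V \<Longrightarrow> finite (dist_ball x r) \<and> card (dist_ball x r) \<le> M"
    by blast
  obtain N where card_nbrs: "\<And>v. card (nbrs E v) \<le> N" using bounded_degree by blast
  have "finite (dist_ball x (Suc r)) \<and> card (dist_ball x (Suc r)) \<le> M * Suc N"
    if in_V: "x \<in> V" for x
  proof -
    have finite_union: "finite (\<Union>z\<in>dist_ball x r. insert z (nbrs E z))"
      using ball_bound[OF in_V] finite_nbrs by simp
    have "card (\<Union>z\<in>dist_ball x r. insert z (nbrs E z)) \<le>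
        (\<Sum>z\<in>dist_ball x r. card (insert z (nbrs E z)))"
      using ball_bound[OF in_V] by (intro card_UN_le) simp
    also have "\<dots> \<le> (\<Sum>z\<in>dist_ball x r. Suc N)"
      using card_nbrs
      by (intro sum_mono order_trans[OF card_insert_le_m1])
        (auto simp: card_insert_if finite_nbrs le_SucI)
    also have "\<dots> \<le> M * Suc N" unfolding sum_constant
      using ball_bound[OF in_V] by (intro mult_right_mono) auto
    finally show ?thesis
      using card_mono[OF finite_union dist_ball_Suc[OF in_V]]
        finite_subset[OF dist_ball_Suc[OF in_V] finite_union] by linarith
  qed
  then show ?case by blast
qed

lemma finite_dist_ball: "x \<in> V \<Longrightarrow> finite (dist_ball x r)"
  using dist_ball_bounded by blast

abbreviation K :: "nat \<Rightarrow> 'v set set" where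
  "K \<equiv> rips V E"

lemma star_rips: "star (K r) v \<subseteq> (if v \<in> V then dist_ball v r else {})"
  unfolding star_def rips_def dist_ball_def by auto

sublocale rips: bounded_complex "K r" for r
proof
  fix s t assume "s \<in> K r" "t \<subseteq> s" "t \<noteq> {}"
  then show "t \<in> K r" unfolding rips_def by (auto intro: finite_subset)
next
  obtain M where ball_bound: "\<And>v. v \<in> V \<Longrightarrow> finite (dist_ball v r) \<and> card (dist_ball v r) \<le> M"
    using dist_ball_bounded by blast
  have "finite (star (K r) v) \<and> card (star (K r) v) \<le> M" for v
  proof (cases "v \<in> V")
    case True
    then have "star (K r) v \<subseteq> dist_ball v r" using star_rips[of r v] by simp
    then show ?thesis using ball_bound[OF True] by (meson card_mono finite_subset order_trans)
  next
    case False
    then show ?thesis using star_rips[of r v] by simp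
  qed
  then show "\<exists>N. \<forall>v. finite (star (K r) v) \<and> card (star (K r) v) \<le> N" by blast
qed

lemma rips_mono: "r \<le> s \<Longrightarrow> K r \<subseteq> K s"
  unfolding rips_def by (auto intro: order_trans)

lemma pair_in_rips: "x \<in> V \<Longrightarrow> y \<in> V \<Longrightarrow> {x, y} \<in> K r \<longleftrightarrow> dist x y \<le> r"
  using dist_sym[of x y] by (auto simp: rips_def dist_refl)

lemma rips_pairD: "{x, y} \<in> K r \<Longrightarrow> x \<in> V \<and> y \<in> V \<and> dist x y \<le> r"
  unfolding rips_def by auto

lemma graph_subset_rips: "T \<subseteq> K 1"
proof
  fix s assume "s \<in> T"
  then show "s \<in> K 1"
  proof (cases rule: graph_complex_cases)
    case (vertex v)
    then show ?thesis using pair_in_rips[of v v 1] by (simp add: dist_refl)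
  next
    case (edge x y)
    then show ?thesis using pair_in_rips[of x y 1] dist_le_1_iff by simp
  qed
qed

sublocale graph_rips: bounded_complex_pair T "K 1"
  by unfold_locales (rule graph_subset_rips)

lemma cycles_rips_1: "cycles (K 1) 1 = (cycles T 1 :: ('v list \<Rightarrow> 'a::normed_coeff_ring) set)"
proof
  have "c \<in> chains T 1" if chain: "c \<in> chains (K 1) 1" for c :: "'v list \<Rightarrow> 'a"
  proof (rule chains_1_subI[OF chain])
    fix x y assume "c [x, y] \<noteq> 0"
    then have "x \<noteq> y" "{x, y} \<in> K 1" using chains_1D[OF chain] by blast+
    then show "{x, y} \<in> T" using rips_pairD[of x y 1] dist_le_1_iff edge_graph_complex by blast
  qed
  then show "cycles (K 1) 1 \<subseteq> (cycles T 1 :: ('v list \<Rightarrow> 'a) set)" unfolding cycles_def by blast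
qed (rule cycles_mono[OF graph_subset_rips])

definition far :: "nat \<Rightarrow> 'v \<Rightarrow> 'v \<Rightarrow> bool" where
  "far r x y \<longleftrightarrow> x \<in> V \<and> y \<in> V \<and> dist x y = Suc r"

definition relay :: "nat \<Rightarrow> 'v set \<Rightarrow> 'v" where
  "relay r s = (SOME m. m \<in> V \<and> (\<forall>x\<in>s. dist x m \<le> r))"

definition detour_coeff ::
  "nat \<Rightarrow> ('v list \<Rightarrow> 'a::normed_coeff_ring) \<Rightarrow> 'v \<Rightarrow> 'v \<Rightarrow> 'v \<Rightarrow> 'a" where
  "detour_coeff r c x m y = (if far r x y \<and> m = relay r {x, y} then c [x, y] else 0)"

definition detour :: "nat \<Rightarrow> ('v list \<Rightarrow> 'a::normed_coeff_ring) \<Rightarrow> 'v list \<Rightarrow> 'a" where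
  "detour r c xs = (case xs of
     [x, y, z] \<Rightarrow> detour_coeff r c x y z + detour_coeff r c y z x + detour_coeff r c z x y
   | _ \<Rightarrow> 0)"

lemma far_sym: "far r y x \<longleftrightarrow> far r x y"
  unfolding far_def using dist_sym by auto

lemma relay_near:
  assumes "1 \<le> r" "far r x y"
  shows "relay r {x, y} \<in> V \<and> dist x (relay r {x, y}) \<le> r \<and> dist y (relay r {x, y}) \<le> r"
proof -
  have endpoints: "x \<in> V" "y \<in> V" "dist x y \<le> Suc r" using assms(2) unfolding far_def by auto
  then obtain m where midpoint: "m \<in> V" "dist x m \<le> r" "m = y \<or> {m, y} \<in> E" by (rule dist_le_SucE)
  then have "dist y m \<le> 1" using endpoints dist_le_1_iff[of y m] by (auto simp: insert_commute)
  then have "\<exists>m. m \<in> V \<and> (\<forall>z\<in>{x, y}. dist z m \<le> r)" using midpoint assms(1) by auto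
  then show ?thesis unfolding relay_def by (rule someI2_ex) auto
qed

lemma detour_coeff_nonzeroD:
  assumes "1 \<le> r" "detour_coeff r c x m y \<noteq> 0"
  shows "far r x y \<and> m \<in> V \<and> dist x m \<le> r \<and> dist y m \<le> r"
  using assms(2) relay_near[OF assms(1), of x y] unfolding detour_coeff_def
  by (auto split: if_splits)

lemma detour_chain:
  fixes c :: "'v list \<Rightarrow> 'a::normed_coeff_ring"
  assumes scale: "1 \<le> r" and chain: "c \<in> chains (K (Suc r)) 1"
  shows "detour r c \<in> chains (K (Suc r)) 2"
proof -
  obtain N where bound: "N \<ge> 0" "\<And>xs. cnorm (c xs) \<le> N"
    using bounded_funE[OF chains_bounded[OF chain]] by blast
  show ?thesis unfolding detour_def
  proof (rule chains_2_cyclic)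
    show "cnorm (detour_coeff r c x m y) \<le> N" for x m y
      using bound unfolding detour_coeff_def by simp
    show "detour_coeff r c y m x = - detour_coeff r c x m y" for x m y
      using chains_1_antisym[OF chain, of y x] far_sym[of r x y]
      unfolding detour_coeff_def by (simp add: insert_commute)
    show "distinct [x, m, y] \<and> {x, m, y} \<in> K (Suc r)"
      if nonzero: "detour_coeff r c x m y \<noteq> 0" for x m y
    proof -
      have near: "x \<in> V" "y \<in> V" "m \<in> V" "dist x y = Suc r" "dist x m \<le> r" "dist y m \<le> r"
        using detour_coeff_nonzeroD[OF scale nonzero] unfolding far_def by auto
      then have "dist y x = Suc r" "dist m x \<le> r" "dist m y \<le> r" using dist_sym by auto
      then show ?thesis using near dist_refl unfolding rips_def by auto
    qed
  qed
qed

lemma bdry_detour_far: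
  fixes c :: "'v list \<Rightarrow> 'a::normed_coeff_ring"
  assumes scale: "1 \<le> r" and chain: "c \<in> chains (K (Suc r)) 1" and far_apart: "far r y z"
  shows "bdry (detour r c) [y, z] = - c [y, z]"
proof -
  let ?m = "relay r {z, y}"
  have not_near: "\<not> dist y z \<le> r" "\<not> dist z y \<le> r"
    using far_apart far_sym[of r y z] unfolding far_def by auto
  then have "detour_coeff r c x y z = 0" "detour_coeff r c y z x = 0" for x
    using detour_coeff_nonzeroD[OF scale] by blast+
  then have detour: "detour r c [x, y, z] = (if x = ?m then c [z, y] else 0)" for x
    using far_apart far_sym[of r y z] unfolding detour_def by (simp add: detour_coeff_def)
  then have "bdry (detour r c) [y, z] = (\<Sum>x\<in>{?m}. detour r c [x, y, z])"
    by (intro bdry_eq_sum) auto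
  also have "\<dots> = - c [y, z]" using detour chains_1_antisym[OF chain, of z y] by simp
  finally show ?thesis .
qed

lemma shorten_cycle:
  fixes c :: "'v list \<Rightarrow> 'a::normed_coeff_ring"
  assumes scale: "1 \<le> r" and c_cycle: "c \<in> cycles (K (Suc r)) 1"
  shows "\<exists>c'\<in>cycles (K r) 1. (\<lambda>xs. c xs - c' xs) \<in> boundaries (K (Suc r)) 1"
proof -
  have chain: "c \<in> chains (K (Suc r)) 1" using c_cycle unfolding cycles_def by blast
  define c' where "c' = (\<lambda>xs. c xs + bdry (detour r c) xs)"
  have bdry: "bdry (detour r c) \<in> boundaries (K (Suc r)) 1"
    unfolding boundaries_def using detour_chain[OF scale chain] by (simp add: numeral_2_eq_2)
  then have cycle: "c' \<in> cycles (K (Suc r)) 1"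
    unfolding c'_def
    by (intro rips.cycles_add[OF c_cycle] subsetD[OF rips.boundaries_subset_cycles])
  then have chain': "c' \<in> chains (K (Suc r)) 1" unfolding cycles_def by blast
  have "c' \<in> chains (K r) 1"
  proof (rule chains_1_subI[OF chain'])
    fix x y assume nonzero: "c' [x, y] \<noteq> 0"
    then have endpoints: "x \<in> V" "y \<in> V" "dist x y \<le> Suc r"
      using chains_nonzeroD[OF chain' nonzero] rips_pairD[of x y "Suc r"] by auto
    have "\<not> far r x y"
      using nonzero bdry_detour_far[OF scale chain, of x y] unfolding c'_def by auto
    then show "{x, y} \<in> K r" using endpoints pair_in_rips[of x y r] unfolding far_def by auto
  qed
  then have "c' \<in> cycles (K r) 1" using cycle unfolding cycles_def by blast
  moreover have "(\<lambda>xs. c xs - c' xs) \<in> boundaries (K (Suc r)) 1"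
    using rips.boundaries_minus[OF bdry] unfolding c'_def by simp
  ultimately show ?thesis by blast
qed

lemma cycle_homologous_to_flow:
  fixes c :: "'v list \<Rightarrow> 'a::normed_coeff_ring"
  assumes "c \<in> cycles (K (Suc r)) 1"
  shows "\<exists>c'\<in>cycles T 1. (\<lambda>xs. c xs - c' xs) \<in> boundaries (K (Suc r)) 1"
  using assms
proof (induction r arbitrary: c)
  case 0
  then have "c \<in> cycles T 1" using cycles_rips_1 by auto
  then show ?case using rips.boundaries_zero[of 1] by (intro bexI[of _ c]) auto
next
  case (Suc r)
  then obtain c1 where shortened: "c1 \<in> cycles (K (Suc r)) 1"
    "(\<lambda>xs. c xs - c1 xs) \<in> boundaries (K (Suc (Suc r))) 1"
    using shorten_cycle[of "Suc r" c] by auto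
  then obtain c2 where flow: "c2 \<in> cycles T 1" "(\<lambda>xs. c1 xs - c2 xs) \<in> boundaries (K (Suc r)) 1"
    using Suc.IH by blast
  have "boundaries (K (Suc r)) 1 \<subseteq> (boundaries (K (Suc (Suc r))) 1 :: ('v list \<Rightarrow> 'a) set)"
    by (intro boundaries_mono rips_mono) simp
  then have "(\<lambda>xs. (c xs - c1 xs) + (c1 xs - c2 xs)) \<in> boundaries (K (Suc (Suc r))) 1"
    using shortened flow by (intro rips.boundaries_add) auto
  then show ?case using flow by auto
qed

lemma hclass_rips_flow:
  fixes z :: "'v list \<Rightarrow> 'a::normed_coeff_ring"
  assumes "z \<in> cycles (K r) 1"
  shows "\<exists>c\<in>cycles T 1. hclass (K (Suc r)) 1 z = hclass (K (Suc r)) 1 c"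
proof -
  have cycle: "z \<in> cycles (K (Suc r)) 1" using assms cycles_mono[OF rips_mono, of r "Suc r"] by auto
  then obtain c where flow: "c \<in> cycles T 1" "(\<lambda>xs. z xs - c xs) \<in> boundaries (K (Suc r)) 1"
    using cycle_homologous_to_flow by blast
  have "T \<subseteq> K (Suc r)" using graph_subset_rips rips_mono[of 1 "Suc r"] by auto
  then show ?thesis using flow cycle cycles_mono rips.hclass_eq_iff[of z "Suc r" 1 c] by blast
qed

lemma incl_map_rips:
  fixes z :: "'v list \<Rightarrow> 'a::normed_coeff_ring"
  assumes "r \<le> k" "z \<in> cycles (K r) n"
  shows "incl_map (K k) n (hclass (K r) n z) = hclass (K k) n z"
  by (rule bounded_complex_pair.incl_map_hclass) (unfold_locales, use rips_mono assms in auto)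

lemma incl_map_flow:
  fixes z :: "'v list \<Rightarrow> 'a::normed_coeff_ring"
  assumes "1 \<le> k" "z \<in> cycles T 1"
  shows "incl_map (K k) 1 (incl_map (K 1) 1 (hclass T 1 z)) = hclass (K k) 1 z"
  unfolding graph_rips.incl_map_hclass[OF assms(2)]
  by (rule incl_map_rips[OF assms(1)]) (use assms(2) cycles_rips_1 in blast)

end

section \<open>Uniformly finite homology of trees\<close>

lemma rtrancl_distinct_path:
  assumes "(a, x) \<in> r\<^sup>*"
  shows "\<exists>xs. xs \<noteq> [] \<and> hd xs = a \<and> last xs = x \<and> distinct xs \<and> successively (\<lambda>x y. (x, y) \<in> r) xs"
  using assms
proof (induction rule: rtrancl_induct)
  case base
  show ?case by (intro exI[of _ "[a]"]) simp
next
  case (step x y)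
  then obtain xs where path: "xs \<noteq> []" "hd xs = a" "last xs = x" "distinct xs"
    "successively (\<lambda>x y. (x, y) \<in> r) xs" by blast
  show ?case
  proof (cases "y \<in> set xs")
    case True
    then obtain us vs where "xs = (us @ [y]) @ vs" by (auto dest: split_list)
    then show ?thesis using path
      by (intro exI[of _ "us @ [y]"]) (auto simp: successively_append_iff hd_append)
  next
    case False
    then show ?thesis using path step(2)
      by (intro exI[of _ "xs @ [y]"]) (auto simp: successively_append_iff)
  qed
qed

definition side :: "'v set set \<Rightarrow> 'v \<Rightarrow> 'v \<Rightarrow> 'v set" where
  "side E a b = (adj E - {(a, b), (b, a)})\<^sup>* `` {a}"

lemma side_refl: "a \<in> side E a b"
  unfolding side_def by simp

lemma side_closed:
  assumes "x \<in> side E a b" "{x, y} \<in> E" "y \<notin> side E a b"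
  shows "{x, y} = {a, b}"
proof (rule ccontr)
  assume "{x, y} \<noteq> {a, b}"
  then have "(x, y) \<in> adj E - {(a, b), (b, a)}" using assms(2) by auto
  with assms(1) have "y \<in> side E a b"
    unfolding side_def Image_singleton_iff by (rule rtrancl_into_rtrancl)
  then show False using assms(3) by simp
qed

locale bounded_degree_tree = connected_graph V E
  for V :: "'v set" and E :: "'v set set" +
  assumes acyclic: "walk V E xs \<Longrightarrow> distinct xs \<Longrightarrow> length xs \<ge> 3 \<Longrightarrow> {last xs, hd xs} \<notin> E"
begin

lemma side_separates:
  assumes edge: "{a, b} \<in> E"
  shows "b \<notin> side E a b"
proof
  assume "b \<in> side E a b"
  then have "(a, b) \<in> (adj E - {(a, b), (b, a)})\<^sup>*" unfolding side_def by blast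
  from rtrancl_distinct_path[OF this]
  obtain xs where path: "xs \<noteq> []" "hd xs = a" "last xs = b" "distinct xs"
    "successively (\<lambda>x y. (x, y) \<in> adj E - {(a, b), (b, a)}) xs" by blast
  have "a \<noteq> b" "a \<in> V" using edgeD[OF edge] by auto
  have steps: "successively (\<lambda>x y. {x, y} \<in> E) xs" using path(5) by (rule successively_mono) auto
  then have "set xs \<subseteq> V" using path(1,2) \<open>a \<in> V\<close>
  proof (induction xs arbitrary: a)
    case (Cons x xs)
    then show ?case by (cases xs) (auto dest: edgeD)
  qed simp
  then have "walk V E xs" using path(1) steps unfolding walk_def by simp
  moreover have "length xs \<ge> 3"
  proof (rule ccontr)
    assume "\<not> length xs \<ge> 3"
    then consider "xs = []" | z where "xs = [z]" | z w where "xs = [z, w]"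
      by (cases xs rule: remdups_adj.cases) (auto simp: not_le less_Suc_eq_le)
    then show False using path \<open>a \<noteq> b\<close> by cases auto
  qed
  ultimately have "{b, a} \<notin> E" using acyclic[of xs] path by simp
  then show False using edge by (simp add: insert_commute)
qed

lemma side_crossing:
  assumes edge: "{a, b} \<in> E" and "x \<in> side E a b" "y \<notin> side E a b" "{x, y} \<in> E"
  shows "x = a \<and> y = b"
  using side_closed[of x E a b y] assms side_refl[of a E b] side_separates[OF edge]
  by (auto simp: doubleton_eq_iff)

lemma dist_leaving_side:
  assumes edge: "{a, b} \<in> E" and vertices: "x \<in> V" "y \<in> V"
    and side: "x \<in> side E a b" "y \<notin> side E a b"
  shows "dist x a \<le> dist x y"
proof -
  have "\<exists>m\<le>n. (x, a) \<in> ((adj E)\<^sup>=) ^^ m"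
    if "(x, y) \<in> ((adj E)\<^sup>=) ^^ n" "x \<in> side E a b" for n x
    using that
  proof (induction n arbitrary: x)
    case (Suc n)
    then obtain z where step: "(x, z) \<in> (adj E)\<^sup>=" "(z, y) \<in> ((adj E)\<^sup>=) ^^ n"
      by (meson relpow_Suc_D2)
    show ?case
    proof (cases "z \<in> side E a b")
      case True
      then obtain m where reach: "m \<le> n" "(z, a) \<in> ((adj E)\<^sup>=) ^^ m" using Suc.IH step by blast
      then have "(x, a) \<in> ((adj E)\<^sup>=) ^^ Suc m" using relpow_Suc_I2[OF step(1)] by blast
      then show ?thesis using reach(1) by (intro exI[of _ "Suc m"]) simp
    next
      case False
      then have "x = a" using step(1) Suc.prems side_crossing[OF edge, of x z] by auto
      then show ?thesis by (intro exI[of _ 0]) simp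
    qed
  qed (use side in simp)
  then obtain m where "m \<le> dist x y" "(x, a) \<in> ((adj E)\<^sup>=) ^^ m"
    using side(1) dist_le_iff[OF vertices, of "dist x y"] by blast
  then show ?thesis using dist_le_iff[of x a m] vertices(1) edgeD[OF edge] by auto
qed

lemma boundary_flow_edge:
  fixes c :: "'v list \<Rightarrow> 'a::normed_coeff_ring"
  assumes chain: "c \<in> chains T 1" and d_chain: "d \<in> chains (K k) 2" and bounds: "c = bdry d"
    and edge: "{a, b} \<in> E"
  shows "c [a, b] = 0"
proof -
  have vertices: "a \<in> V" "b \<in> V" using edgeD[OF edge] by auto
  let ?S = "side E a b" and ?D = "dist_ball a (2 * k + 1)"
  define A C where "A = ?D \<inter> ?S" and "C = ?D - ?S"
  have finite_parts: "finite A" "finite C"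
    using finite_dist_ball[OF vertices(1)] unfolding A_def C_def by auto
  have "a \<in> A" "b \<in> C"
    using vertices dist_refl dist_le_1_iff[OF vertices] edge
      side_refl[of a E b] side_separates[OF edge]
    unfolding A_def C_def dist_ball_def by auto
  have near: "z \<in> A \<union> C" if parts: "x \<in> A" "y \<in> C" and nonzero: "d [z, x, y] \<noteq> 0" for x y z
  proof -
    have "{z, x, y} \<in> K k" using chains_nonzeroD[OF d_chain nonzero] by simp
    then have triangle: "x \<in> V" "y \<in> V" "z \<in> V" "dist x y \<le> k" "dist x z \<le> k"
      unfolding rips_def by auto
    have "dist a x \<le> dist x y"
      using dist_leaving_side[OF edge triangle(1,2)] parts dist_sym[OF vertices(1) triangle(1)]
      unfolding A_def C_def by simp
    then have "dist a z \<le> 2 * k + 1"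
      using dist_triangle[OF vertices(1) triangle(1,3)] triangle(4,5) by linarith
    then show ?thesis using triangle(3) unfolding A_def C_def dist_ball_def by auto
  qed
  have "c [x, y] = (if y = b then if x = a then c [a, b] else 0 else 0)" if "x \<in> A" "y \<in> C" for x y
  proof (cases "c [x, y] = 0")
    case False
    then have "{x, y} \<in> E" using graph_chain_edge[OF chain] by fastforce
    then show ?thesis using side_crossing[OF edge, of x y] that unfolding A_def C_def by simp
  qed auto
  then have "(\<Sum>x\<in>A. \<Sum>y\<in>C. c [x, y]) =
      (\<Sum>x\<in>A. \<Sum>y\<in>C. if y = b then if x = a then c [a, b] else 0 else 0)"
    by (intro sum.cong) auto
  also have "\<dots> = c [a, b]" using finite_parts \<open>a \<in> A\<close> \<open>b \<in> C\<close> by simp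
  finally have "c [a, b] = (\<Sum>x\<in>A. \<Sum>y\<in>C. bdry d [x, y])" unfolding bounds by simp
  also have "\<dots> = 0"
    by (rule sum_bdry_across_cut[OF d_chain finite_parts _ near]) (auto simp: A_def C_def)
  finally show ?thesis .
qed

lemma boundary_flow_zero:
  fixes c :: "'v list \<Rightarrow> 'a::normed_coeff_ring"
  assumes chain: "c \<in> chains T 1" and boundary: "c \<in> boundaries (K k) 1"
  shows "c = (\<lambda>xs. 0)"
proof -
  obtain d where filling: "d \<in> chains (K k) 2" "c = bdry d"
    using boundary unfolding boundaries_def by (auto simp: numeral_2_eq_2)
  have "c xs = 0" for xs
    using graph_chain_edge[OF chain, of xs] boundary_flow_edge[OF chain filling] by auto
  then show ?thesis by auto
qed

lemma hclass_rips_inj: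
  fixes x y :: "'v list \<Rightarrow> 'a::normed_coeff_ring"
  assumes x_cycle: "x \<in> cycles T 1" and y_cycle: "y \<in> cycles T 1" and scale: "1 \<le> k"
    and same_class: "hclass (K k) 1 x = hclass (K k) 1 y"
  shows "x = y"
proof -
  have "T \<subseteq> K k" using graph_subset_rips rips_mono[OF scale] by blast
  then have "x \<in> cycles (K k) 1" "y \<in> cycles (K k) 1" using x_cycle y_cycle cycles_mono by blast+
  then have "(\<lambda>xs. x xs - y xs) \<in> boundaries (K k) 1" using same_class rips.hclass_eq_iff by blast
  moreover have "(\<lambda>xs. x xs - y xs) \<in> chains T 1"
    using graph.cycles_diff[OF x_cycle y_cycle] unfolding cycles_def by blast
  ultimately show ?thesis
    using boundary_flow_zero[of "\<lambda>xs. x xs - y xs" k] by (simp add: fun_eq_iff)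
qed

theorem suf_to_uf_iso:
  "(suf_to_uf V E 1 :: ('v list \<Rightarrow> 'a::normed_coeff_ring) set \<Rightarrow> _) \<in> iso (H_suf T 1) (H_uf V E 1)"
proof -
  let ?G = "\<lambda>r. H_suf (K r) 1 :: ('v list \<Rightarrow> 'a) set monoid"
  let ?\<phi> = "\<lambda>(r :: nat) s. incl_map (K s) 1 :: ('v list \<Rightarrow> 'a) set \<Rightarrow> _"
  interpret direct_system ?G ?\<phi>
    by (intro direct_system_H_suf rips.bounded_complex_axioms monoI rips_mono)
  have "(\<lambda>X. germ 1 (incl_map (K 1) 1 X)) \<in> iso (H_suf T 1) (dirlim ?G ?\<phi>)"
  proof (rule iso_dirlim[OF graph_rips.incl_map_hom])
    fix X Y :: "('v list \<Rightarrow> 'a) set" and k :: nat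
    assume "X \<in> carrier (H_suf T 1)" "Y \<in> carrier (H_suf T 1)" and scale: "1 \<le> k"
      and same_image:
        "incl_map (K k) 1 (incl_map (K 1) 1 X) = incl_map (K k) 1 (incl_map (K 1) 1 Y)"
    then obtain x y where reps: "x \<in> cycles T 1" "X = hclass T 1 x"
      "y \<in> cycles T 1" "Y = hclass T 1 y"
      unfolding graph.carrier_H_suf by blast
    then have "hclass (K k) 1 x = hclass (K k) 1 y"
      using same_image incl_map_flow[OF scale] by metis
    then show "X = Y" using reps hclass_rips_inj[OF reps(1,3) scale] by simp
  next
    fix m and X :: "('v list \<Rightarrow> 'a) set" assume "X \<in> carrier (?G m)"
    then obtain z where z_rep: "z \<in> cycles (K m) 1" "X = hclass (K m) 1 z"
      unfolding rips.carrier_H_suf by blast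
    obtain c where flow: "c \<in> cycles T 1" "hclass (K (Suc m)) 1 z = hclass (K (Suc m)) 1 c"
      using hclass_rips_flow[OF z_rep(1)] by blast
    then have "incl_map (K (Suc m)) 1 (incl_map (K 1) 1 (hclass T 1 c)) = incl_map (K (Suc m)) 1 X"
      using incl_map_flow[OF _ flow(1), of "Suc m"] incl_map_rips[OF _ z_rep(1), of "Suc m"]
        z_rep(2) by simp
    moreover have "hclass T 1 c \<in> carrier (H_suf T 1)"
      using flow(1) unfolding graph.carrier_H_suf by blast
    ultimately show "\<exists>x\<in>carrier (H_suf T 1). \<exists>k. 1 \<le> k \<and> m \<le> k \<and>
        incl_map (K k) 1 (incl_map (K 1) 1 x) = incl_map (K k) 1 X"
      by (intro bexI[of _ "hclass T 1 c"] exI[of _ "Suc m"]) auto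
  qed
  then show ?thesis unfolding H_uf_def suf_to_uf_def .
qed

end

lemma bounded_degree_treeI:
  assumes "tree V E" and degree: "\<And>v. v \<in> V \<Longrightarrow> finite {e \<in> E. v \<in> e} \<and> vdegree E v \<le> N"
  shows "bounded_degree_tree V E"
proof
  show simple: "simple_graph V E" using assms(1) unfolding tree_def by blast
  show "\<exists>N. \<forall>v. finite (nbrs E v) \<and> card (nbrs E v) \<le> N"
  proof (intro exI allI)
    fix v
    have inj_edge: "inj_on (\<lambda>x. {x, v}) (nbrs E v)" by (auto simp: inj_on_def doubleton_eq_iff)
    have edges: "(\<lambda>x. {x, v}) ` nbrs E v \<subseteq> {e \<in> E. v \<in> e}" unfolding nbrs_def by auto
    show "finite (nbrs E v) \<and> card (nbrs E v) \<le> N"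
    proof (cases "v \<in> V")
      case True
      then show ?thesis
        using inj_on_finite[OF inj_edge edges] card_inj_on_le[OF inj_edge edges] degree
        unfolding vdegree_def
        by (meson order_trans)
    next
      case False
      then show ?thesis by (simp add: nbrs_outside[OF simple])
    qed
  qed
qed (use assms(1) in \<open>auto simp: tree_def\<close>)

lemma trivalent_tree_bounded_degree:
  assumes "trivalent_tree V E"
  shows "bounded_degree_tree V E"
proof (rule bounded_degree_treeI[of V E 3])
  fix v assume "v \<in> V"
  then have "vdegree E v \<in> {2, 3}" using assms unfolding trivalent_tree_def by blast
  then show "finite {e \<in> E. v \<in> e} \<and> vdegree E v \<le> 3"
    unfolding vdegree_def by (auto intro: card_ge_0_finite)
qed (use assms in \<open>simp add: trivalent_tree_def\<close>)

section \<open>Coordinates along the rays\<close>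

lemma UN_Suc_eq:
  assumes "A 0 = {}"
  shows "(\<Union>n. A n) = (\<Union>n. A (Suc n))"
proof (intro equalityI UN_least)
  fix n show "A n \<subseteq> (\<Union>n. A (Suc n))" using assms by (cases n) auto
qed auto

locale ray_tree =
  fixes V :: "'v set" and E :: "'v set set" and mid :: bool
    and L :: "int \<Rightarrow> 'v" and B :: "nat \<Rightarrow> 'v set" and R :: "'v \<Rightarrow> nat \<Rightarrow> 'v"
  assumes construction: "ray_construction V E mid L B R"
begin

abbreviation stage :: "nat \<Rightarrow> 'v set" where
  "stage \<equiv> stage_verts mid L B R"

abbreviation rays_at :: "nat \<Rightarrow> (nat \<Rightarrow> 'v) set" where
  "rays_at \<equiv> rays mid L B R"

definition branch_points :: "'v set" where
  "branch_points = (\<Union>n. B (Suc n))"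

definition all_rays :: "(nat \<Rightarrow> 'v) set" where
  "all_rays = (\<Union>n. rays_at n)"

abbreviation pos_ray :: "nat \<Rightarrow> 'v" where
  "pos_ray \<equiv> \<lambda>i. L (int i)"

abbreviation neg_ray :: "nat \<Rightarrow> 'v" where
  "neg_ray \<equiv> \<lambda>i. L (of_bool mid - int i)"

definition depth :: "'v \<Rightarrow> nat" where
  "depth x = (LEAST n. x \<in> stage n)"

lemma L_eq_iff [simp]: "L i = L j \<longleftrightarrow> i = j"
  using construction by (auto simp: ray_construction_def inj_eq)

lemma V_eq: "V = (\<Union>n. stage n)" and E_eq_stages: "E = (\<Union>n. stage_edges L B R n)"
  using construction unfolding ray_construction_def by blast+

lemma B_subset: "n \<ge> 1 \<Longrightarrow> B n \<subseteq> stage n - stage (n - 1)"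
  using construction unfolding ray_construction_def by blast

lemma R_props:
  assumes "n \<ge> 1" "v \<in> B n"
  shows "R v 0 = v" "inj (R v)" "R v (Suc i) \<notin> stage n"
  using construction assms unfolding ray_construction_def by blast+

lemma R_disjoint:
  assumes "n \<ge> 1" "v \<in> B n" "w \<in> B n" "R v i = R w j"
  shows "v = w"
proof (rule ccontr)
  assume "v \<noteq> w"
  then have "range (R v) \<inter> range (R w) = {}"
    using construction assms(1-3) unfolding ray_construction_def by blast
  with assms(4) show False by blast
qed

lemma branch_pointE:
  assumes "v \<in> branch_points"
  obtains n where "v \<in> B (Suc n)"
  using assms unfolding branch_points_def by blast

lemma branch_pointI: "v \<in> B (Suc n) \<Longrightarrow> v \<in> branch_points"
  unfolding branch_points_def by blast

lemma R_0: "v \<in> branch_points \<Longrightarrow> R v 0 = v"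
  using R_props(1)[of "Suc _"] by (auto elim: branch_pointE)

lemma R_eq_iff: "v \<in> branch_points \<Longrightarrow> w \<in> branch_points \<Longrightarrow> R v = R w \<longleftrightarrow> v = w"
  using R_0 by metis

lemma all_rays_eq: "all_rays = {pos_ray, neg_ray} \<union> R ` branch_points"
proof (intro equalityI subsetI)
  fix r assume "r \<in> all_rays"
  then obtain n where "r \<in> rays_at n" unfolding all_rays_def by blast
  then show "r \<in> {pos_ray, neg_ray} \<union> R ` branch_points"
    by (cases "(mid, L, B, R, n)" rule: rays.cases) (auto intro: branch_pointI)
next
  fix r assume "r \<in> {pos_ray, neg_ray} \<union> R ` branch_points"
  then consider (line) "r \<in> rays_at (Suc 0)" | (branch) v n where "r = R v" "v \<in> B (Suc n)"
    by (auto elim: branch_pointE)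
  then show "r \<in> all_rays"
  proof cases
    case (branch v n)
    then have "r \<in> rays_at (Suc (Suc n))" by simp
    then show ?thesis unfolding all_rays_def by blast
  qed (unfold all_rays_def, blast)
qed

lemma line_rays: "pos_ray \<in> all_rays" "neg_ray \<in> all_rays"
  unfolding all_rays_eq by auto

lemma R_in_all_rays: "v \<in> branch_points \<Longrightarrow> R v \<in> all_rays"
  unfolding all_rays_eq by blast

lemma all_rays_cases:
  assumes "r \<in> all_rays"
  obtains (pos) "r = pos_ray" | (neg) "r = neg_ray" | (branch) v where "v \<in> branch_points" "r = R v"
  using assms unfolding all_rays_eq by blast

lemma pos_ray_neq_neg_ray: "pos_ray \<noteq> neg_ray"
  by (auto simp: fun_eq_iff intro!: exI[of _ 1])

lemma ray_eq_iff:
  assumes "r \<in> all_rays"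
  shows "r i = r j \<longleftrightarrow> i = j"
proof -
  have "inj r" using assms
  proof (cases rule: all_rays_cases)
    case (branch v)
    then show ?thesis using R_props(2)[of "Suc _"] by (auto elim: branch_pointE)
  qed (auto simp: inj_on_def)
  then show ?thesis by (rule inj_eq)
qed

lemma stage_mono: "m \<le> n \<Longrightarrow> stage m \<subseteq> stage n"
proof (rule lift_Suc_mono_le[of stage])
  fix k show "stage k \<subseteq> stage (Suc k)" by (cases k) auto
qed

lemma depth_le: "x \<in> stage n \<Longrightarrow> depth x \<le> n"
  unfolding depth_def by (rule Least_le)

lemma stage_depth: "x \<in> stage n \<Longrightarrow> x \<in> stage (depth x)"
  unfolding depth_def by (rule LeastI)

lemma depth_new: "x \<in> stage n - stage (n - 1) \<Longrightarrow> depth x = n"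
  using depth_le[of x n] stage_depth[of x n] stage_mono[of "depth x" "n - 1"] by fastforce

lemma depth_branch_point: "v \<in> B (Suc n) \<Longrightarrow> depth v = Suc n"
  using depth_new B_subset[of "Suc n"] by auto

lemma depth_branch_point_pos: "v \<in> branch_points \<Longrightarrow> depth v > 0"
  using depth_branch_point by (auto elim: branch_pointE)

lemma ray_in_stage: "r \<in> rays_at n \<Longrightarrow> r k \<in> stage n"
  by (cases "(mid, L, B, R, n)" rule: rays.cases) auto

lemma depth_ray:
  assumes "r \<in> rays_at n"
  shows "depth (r (Suc k)) = n"
proof (rule depth_new)
  have "r (Suc k) \<notin> stage (n - 1)"
    using assms R_props(3) by (cases "(mid, L, B, R, n)" rule: rays.cases) auto
  then show "r (Suc k) \<in> stage n - stage (n - 1)" using ray_in_stage[OF assms] by blast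
qed

lemma depth_R:
  assumes "v \<in> branch_points"
  shows "depth (R v (Suc k)) = Suc (depth v)"
proof -
  obtain n where B_mem: "v \<in> B (Suc n)" using assms by (rule branch_pointE)
  then have "R v \<in> rays_at (Suc (Suc n))" by simp
  then show ?thesis using depth_ray depth_branch_point[OF B_mem] by simp
qed

lemma depth_L: "depth (L j) \<le> 1"
  by (rule depth_le) simp

lemma depth_ray_pos: "r \<in> all_rays \<Longrightarrow> depth (r (Suc k)) > 0"
  unfolding all_rays_def using depth_ray by (auto intro!: Nat.gr0I)

lemma depth_root: "\<not> mid \<Longrightarrow> depth (L 0) = 0"
  using depth_le[of "L 0" 0] by simp

lemma R_not_line:
  assumes "v \<in> branch_points"
  shows "R v (Suc k) \<noteq> L j" "R v \<noteq> pos_ray" "R v \<noteq> neg_ray"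
proof -
  have vertex: "R v (Suc k) \<noteq> L j" for k j
    using depth_R[OF assms, of k] depth_branch_point_pos[OF assms] depth_L[of j] by auto
  show "R v (Suc k) \<noteq> L j" by (rule vertex)
  show "R v \<noteq> pos_ray" "R v \<noteq> neg_ray" using vertex by metis+
qed

lemma ray_coords_unique:
  assumes "r \<in> all_rays" "s \<in> all_rays" "r (Suc k) = s (Suc l)"
  shows "r = s \<and> k = l"
proof -
  obtain m n where levels: "r \<in> rays_at m" "s \<in> rays_at n"
    using assms unfolding all_rays_def by blast
  have [simp]: "m = n"
    using depth_ray[OF levels(1), of k] depth_ray[OF levels(2), of l] assms(3) by simp
  have "r = s"
    using levels assms(3)
    by (cases "(mid, L, B, R, n)" rule: rays.cases) (auto dest: R_disjoint[rotated])
  then show ?thesis using assms ray_eq_iff by blast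
qed

lemma ray_origin_cases:
  assumes r_ray: "r \<in> all_rays" and s_ray: "s \<in> all_rays" and meet: "s 0 = r (Suc k)"
  obtains (branch) "r (Suc k) \<in> branch_points" "s = R (r (Suc k))"
    | (root) "mid" "k = 0" "{r, s} = {pos_ray, neg_ray}"
  using s_ray
proof (cases rule: all_rays_cases)
  case pos
  then have "mid" using meet depth_ray_pos[OF r_ray, of k] depth_root by (cases mid) auto
  then have "r (Suc k) = neg_ray (Suc 0)" using meet pos by simp
  then show ?thesis using ray_coords_unique[OF r_ray line_rays(2)] that(2) \<open>mid\<close> pos by blast
next
  case neg
  then have "mid" using meet depth_ray_pos[OF r_ray, of k] depth_root by (cases mid) auto
  then have "r (Suc k) = pos_ray (Suc 0)" using meet neg by simp
  then show ?thesis using ray_coords_unique[OF r_ray line_rays(1)] that(2) \<open>mid\<close> neg by blast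
next
  case (branch v)
  then show ?thesis using that(1) R_0 meet by simp
qed

text \<open>If the root is suppressed, both rays of the line start by crossing \<open>{L 0, L 1}\<close>.\<close>

lemma opposite_edges:
  assumes r_ray: "r \<in> all_rays" and s_ray: "s \<in> all_rays"
    and opposite: "r k = s (Suc l)" "r (Suc k) = s l"
  shows "mid \<and> k = 0 \<and> l = 0 \<and> {r, s} = {pos_ray, neg_ray}"
proof -
  have [simp]: "k = 0"
  proof (rule ccontr)
    assume "k \<noteq> 0"
    then obtain m where "k = Suc m" using not0_implies_Suc by blast
    then have "r = s" "k = Suc l" using ray_coords_unique[OF r_ray s_ray, of m l] opposite by auto
    then show False using opposite(2) ray_eq_iff[OF s_ray] by simp
  qed
  have [simp]: "l = 0"
  proof (rule ccontr)
    assume "l \<noteq> 0"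
    then obtain m where "l = Suc m" using not0_implies_Suc by blast
    then have "r = s" "l = Suc k" using ray_coords_unique[OF r_ray s_ray, of k m] opposite by auto
    then show False using opposite(1) ray_eq_iff[OF s_ray] by simp
  qed
  from opposite have "r 0 = s (Suc 0)" "s 0 = r (Suc 0)" by simp_all
  from s_ray r_ray this(1) show ?thesis
  proof (cases rule: ray_origin_cases)
    case s_branch: branch
    from r_ray s_ray \<open>s 0 = r (Suc 0)\<close> show ?thesis
    proof (cases rule: ray_origin_cases)
      case r_branch: branch
      have "depth (r (Suc 0)) = Suc (depth (s (Suc 0)))" by (metis depth_R s_branch)
      moreover have "depth (s (Suc 0)) = Suc (depth (r (Suc 0)))" by (metis depth_R r_branch)
      ultimately show ?thesis by simp
    qed simp
  qed (simp add: insert_commute)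
qed

lemma line_edges_eq:
  "range (\<lambda>j. {L j, L (j + 1)}) =
     range (\<lambda>k. {pos_ray k, pos_ray (Suc k)}) \<union> range (\<lambda>k. {neg_ray k, neg_ray (Suc k)})"
proof (intro equalityI subsetI)
  fix e assume "e \<in> range (\<lambda>j. {L j, L (j + 1)})"
  then obtain j where e_eq: "e = {L j, L (j + 1)}" by blast
  show "e \<in> range (\<lambda>k. {pos_ray k, pos_ray (Suc k)}) \<union> range (\<lambda>k. {neg_ray k, neg_ray (Suc k)})"
  proof (cases "j \<ge> 0")
    case True
    then show ?thesis using e_eq by (intro UnI1 range_eqI[of _ _ "nat j"]) (simp add: add.commute)
  next
    case False
    then show ?thesis using e_eq
      by (intro UnI2 range_eqI[of _ _ "nat (of_bool mid - j - 1)"]) (auto simp: algebra_simps)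
  qed
next
  have pos_edge: "{pos_ray k, pos_ray (Suc k)} = {L (int k), L (int k + 1)}" for k
    by (simp add: add.commute)
  have neg_edge:
    "{neg_ray k, neg_ray (Suc k)} = {L (of_bool mid - int k - 1), L (of_bool mid - int k - 1 + 1)}"
    for k
    by (auto simp: algebra_simps)
  fix e
  assume "e \<in> range (\<lambda>k. {pos_ray k, pos_ray (Suc k)}) \<union> range (\<lambda>k. {neg_ray k, neg_ray (Suc k)})"
  then show "e \<in> range (\<lambda>j. {L j, L (j + 1)})" unfolding pos_edge neg_edge by blast
qed

lemma E_eq: "E = {{r k, r (Suc k)} | r k. r \<in> all_rays}"
proof -
  have "stage_edges L B R (Suc n) = range (\<lambda>j. {L j, L (j + 1)}) \<union>
      (\<Union>m\<in>{0..<n}. \<Union>v\<in>B (Suc m). range (\<lambda>k. {R v k, R v (Suc k)}))" for n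
    by (induction n) (auto simp: atLeastLessThanSuc)
  moreover have "E = (\<Union>n. stage_edges L B R (Suc n))"
    unfolding E_eq_stages by (rule UN_Suc_eq) simp
  ultimately have "E = range (\<lambda>j. {L j, L (j + 1)}) \<union>
      (\<Union>v\<in>branch_points. range (\<lambda>k. {R v k, R v (Suc k)}))"
    by (simp add: UN_UN_finite_eq branch_points_def)
  also have "\<dots> = (\<Union>r\<in>all_rays. range (\<lambda>k. {r k, r (Suc k)}))"
    unfolding line_edges_eq all_rays_eq
    by (simp only: UN_Un UN_insert UN_empty Un_empty_right UN_simps)
  finally show ?thesis by blast
qed

lemma ray_edge: "r \<in> all_rays \<Longrightarrow> {r k, r (Suc k)} \<in> E"
  unfolding E_eq by blast

lemma edge_ray_cases:
  assumes "{x, y} \<in> E"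
  obtains (forward) s k where "s \<in> all_rays" "x = s k" "y = s (Suc k)"
    | (backward) s k where "s \<in> all_rays" "x = s (Suc k)" "y = s k"
proof -
  obtain s k where "s \<in> all_rays" "{x, y} = {s k, s (Suc k)}" using assms unfolding E_eq by auto
  then show ?thesis using that by (auto simp: doubleton_eq_iff)
qed

lemma edge_list_induct:
  assumes ray: "\<And>s k. s \<in> all_rays \<Longrightarrow> Q [s k, s (Suc k)]"
    and swap: "\<And>x y. Q [x, y] \<Longrightarrow> Q [y, x]"
    and no_edge: "(\<And>x y. xs = [x, y] \<Longrightarrow> {x, y} \<notin> E) \<Longrightarrow> Q xs"
  shows "Q xs"
proof (cases "\<exists>x y. xs = [x, y] \<and> {x, y} \<in> E")
  case True
  then obtain x y where edge: "xs = [x, y]" "{x, y} \<in> E" by blast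
  from edge(2) show ?thesis by (cases rule: edge_ray_cases) (use ray swap edge(1) in auto)
qed (use no_edge in blast)

lemma new_vertex_on_ray:
  assumes "x \<in> stage n - stage (n - 1)"
  obtains r k where "r \<in> rays_at n" "x = r (Suc k)"
proof (cases "(mid, L, B, R, n)" rule: rays.cases)
  case (2 a b c d)
  then have [simp]: "n = Suc 0" by simp
  obtain j where x_eq: "x = L j" using assms by auto
  show ?thesis
  proof (cases "j \<ge> 1")
    case True
    then show ?thesis using x_eq by (intro that[of pos_ray "nat (j - 1)"]) auto
  next
    case False
    then have "j < of_bool mid" using assms x_eq by (cases mid; cases "j = 0") auto
    then show ?thesis using x_eq by (intro that[of neg_ray "nat (of_bool mid - j - 1)"]) auto
  qed
next
  case (3 a b c d m)
  then have [simp]: "n = Suc (Suc m)" by simp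
  then obtain v i where x_on_R: "v \<in> B (Suc m)" "x = R v i" using assms by auto
  have "x \<noteq> R v 0" using assms x_on_R(1) R_props(1)[of "Suc m" v] B_subset[of "Suc m"] by auto
  then obtain k where "i = Suc k" using x_on_R(2) by (cases i) auto
  then show ?thesis using x_on_R by (intro that[of "R v" k]) auto
qed (use assms in auto)

lemma vertex_cases:
  assumes "x \<in> V"
  obtains (ray) r k where "r \<in> all_rays" "x = r (Suc k)" | (root) "\<not> mid" "x = L 0"
proof (cases "depth x")
  case 0
  then have "x \<in> stage 0" using assms stage_depth unfolding V_eq by fastforce
  then show ?thesis using that(2) by (auto split: if_splits)
next
  case (Suc m)
  have "x \<in> stage (depth x)" using assms stage_depth unfolding V_eq by blast
  moreover have "x \<notin> stage (depth x - 1)" using depth_le[of x "depth x - 1"] Suc by auto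
  ultimately obtain r k where "r \<in> rays_at (depth x)" "x = r (Suc k)"
    using new_vertex_on_ray[of x] by blast
  then show ?thesis using that(1) unfolding all_rays_def by blast
qed

lemma branch_point_coords:
  assumes "v \<in> branch_points"
  obtains r k where "r \<in> all_rays" "v = r (Suc k)"
proof -
  obtain n where B_mem: "v \<in> B (Suc n)" using assms by (rule branch_pointE)
  then have "v \<in> stage (Suc n) - stage (Suc n - 1)" using B_subset[of "Suc n"] by auto
  then obtain r k where "r \<in> rays_at (Suc n)" "v = r (Suc k)" by (rule new_vertex_on_ray)
  then show ?thesis using that unfolding all_rays_def by blast
qed

lemma edge_at_ray_cases:
  assumes r_ray: "r \<in> all_rays" and edge: "{x, r (Suc k)} \<in> E"
  obtains (previous) "x = r k" | (following) "x = r (Suc (Suc k))"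
    | (branch) "r (Suc k) \<in> branch_points" "x = R (r (Suc k)) 1"
  using edge
proof (cases rule: edge_ray_cases)
  case (forward s l)
  then show ?thesis using ray_coords_unique[of r s k l] r_ray previous by auto
next
  case (backward s l)
  show ?thesis
  proof (cases l)
    case (Suc m)
    then show ?thesis using ray_coords_unique[of r s k m] r_ray backward following by auto
  next
    case 0
    then have "s 0 = r (Suc k)" using backward by simp
    with r_ray backward(1) show ?thesis
    proof (cases rule: ray_origin_cases)
      case on_branch: branch
      then show ?thesis using backward(2) 0 branch by simp
    next
      case root
      then consider "r = pos_ray" "s = neg_ray" | "r = neg_ray" "s = pos_ray"
        unfolding doubleton_eq_iff by blast
      then have "x = r k" using backward(2) 0 root(1,2) by cases simp_all
      then show ?thesis by (rule previous)
    qed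
  qed
qed

lemma nbrs_ray:
  assumes r_ray: "r \<in> all_rays"
  shows "nbrs E (r (Suc k)) = {r k, r (Suc (Suc k))} \<union>
    (if r (Suc k) \<in> branch_points then {R (r (Suc k)) 1} else {})" (is "_ = ?M")
proof (intro equalityI subsetI)
  fix x assume "x \<in> nbrs E (r (Suc k))"
  then have "{x, r (Suc k)} \<in> E" unfolding nbrs_def by simp
  with r_ray show "x \<in> ?M" by (cases rule: edge_at_ray_cases) simp_all
next
  fix x assume "x \<in> ?M"
  then show "x \<in> nbrs E (r (Suc k))"
    using ray_edge[OF r_ray, of k] ray_edge[OF r_ray, of "Suc k"]
      ray_edge[OF R_in_all_rays, of "r (Suc k)" 0] R_0
    by (auto simp: nbrs_def insert_commute split: if_splits)
qed

lemma nbrs_root: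
  assumes "\<not> mid"
  shows "nbrs E (L 0) = {L 1, L (- 1)}"
proof (intro equalityI subsetI)
  have not_new: "s (Suc k) \<noteq> L 0" if "s \<in> all_rays" for s k
    using depth_ray_pos[OF that, of k] depth_root[OF assms] by auto
  fix x assume "x \<in> nbrs E (L 0)"
  then have "{x, L 0} \<in> E" unfolding nbrs_def by simp
  then obtain s l where s_edge: "s \<in> all_rays" "x = s (Suc l)" "s l = L 0"
    by (cases rule: edge_ray_cases) (use not_new in metis)+
  then have l_eq: "l = 0" using not_new by (cases l) auto
  show "x \<in> {L 1, L (- 1)}" using s_edge(1)
  proof (cases rule: all_rays_cases)
    case (branch v)
    then have "v = L 0" using s_edge l_eq R_0 by simp
    then show ?thesis using branch_point_coords[OF branch(1)] not_new by metis
  qed (use s_edge l_eq assms in auto)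
next
  fix x assume "x \<in> {L 1, L (- 1)}"
  then show "x \<in> nbrs E (L 0)"
    using ray_edge[OF line_rays(1), of 0] ray_edge[OF line_rays(2), of 0] assms
    by (auto simp: nbrs_def insert_commute)
qed

sublocale bounded_degree_graph V E
proof
  have "r k \<in> V" if "r \<in> all_rays" for r k
    using that ray_in_stage unfolding all_rays_def V_eq by blast
  then have "\<exists>x\<in>V. \<exists>y\<in>V. x \<noteq> y \<and> {r k, r (Suc k)} = {x, y}" if "r \<in> all_rays" for r k
    using that ray_eq_iff[OF that, of k "Suc k"]
    by (intro bexI[of _ "r k"] bexI[of _ "r (Suc k)"]) auto
  then show simple: "simple_graph V E" unfolding simple_graph_def E_eq by blast
  have "finite (nbrs E v) \<and> card (nbrs E v) \<le> 3" for v
  proof (cases "v \<in> V")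
    case True
    then show ?thesis
    proof (cases rule: vertex_cases)
      case (ray r k)
      then show ?thesis by (auto simp: nbrs_ray card_insert_if)
    next
      case root
      then show ?thesis by (simp add: nbrs_root)
    qed
  next
    case False
    then show ?thesis by (simp add: nbrs_outside[OF simple])
  qed
  then show "\<exists>N. \<forall>v. finite (nbrs E v) \<and> card (nbrs E v) \<le> N" by blast
qed

end

section \<open>The bi-infinite paths\<close>

definition arcs :: "(int \<Rightarrow> 'v) \<Rightarrow> ('v \<times> 'v) set" where
  "arcs p = range (\<lambda>k. (p k, p (k + 1)))"

definition ray_arcs :: "(nat \<Rightarrow> 'v) \<Rightarrow> nat set \<Rightarrow> ('v \<times> 'v) set" where
  "ray_arcs r K = (\<lambda>k. (r k, r (Suc k))) ` K"

lemma bip_chain_arcs: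
  "bip_chain p [x, y] = (if (x, y) \<in> arcs p then 1 else if (y, x) \<in> arcs p then - 1 else 0)"
  unfolding bip_chain_def arcs_def by auto

lemma bip_edges_arcs: "{x, y} \<in> bip_edges p \<longleftrightarrow> (x, y) \<in> arcs p \<or> (y, x) \<in> arcs p"
  unfolding bip_edges_def arcs_def by (auto simp: doubleton_eq_iff)

lemma arcs_two_sided:
  "arcs p = (ray_arcs (\<lambda>k. p (- int k)) UNIV)\<inverse> \<union> ray_arcs (\<lambda>k. p (int k)) UNIV"
proof (intro equalityI subsetI)
  fix xy assume "xy \<in> arcs p"
  then obtain k where arc: "xy = (p k, p (k + 1))" unfolding arcs_def by blast
  show "xy \<in> (ray_arcs (\<lambda>k. p (- int k)) UNIV)\<inverse> \<union> ray_arcs (\<lambda>k. p (int k)) UNIV"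
  proof (cases "k \<ge> 0")
    case True
    then show ?thesis using arc unfolding ray_arcs_def
      by (intro UnI2 image_eqI[of _ _ "nat k"]) (simp_all add: add.commute)
  next
    case False
    then have "(p (k + 1), p k) \<in> ray_arcs (\<lambda>k. p (- int k)) UNIV"
      unfolding ray_arcs_def
      by (intro image_eqI[of _ _ "nat (- k - 1)"]) (simp_all add: add.commute)
    then show ?thesis using arc by simp
  qed
next
  have "(p (- int (Suc k)), p (- int k)) \<in> arcs p" for k
    unfolding arcs_def by (rule range_eqI[of _ _ "- int (Suc k)"]) simp
  moreover have "(p (int k), p (int (Suc k))) \<in> arcs p" for k
    unfolding arcs_def by (rule range_eqI[of _ _ "int k"]) (simp add: add.commute)
  moreover fix xy assume "xy \<in> (ray_arcs (\<lambda>k. p (- int k)) UNIV)\<inverse> \<union> ray_arcs (\<lambda>k. p (int k)) UNIV"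
  ultimately show "xy \<in> arcs p" unfolding ray_arcs_def by auto
qed

lemma ray_arcs_shift: "ray_arcs (\<lambda>k. r (i + k)) K = ray_arcs r ((+) i ` K)"
  unfolding ray_arcs_def by (simp add: image_image)

lemma ray_arcs_split: "ray_arcs r UNIV = ray_arcs r {..<n} \<union> ray_arcs (\<lambda>k. r (n + k)) UNIV"
proof -
  have "k \<in> {..<n} \<union> range ((+) n)" for k
    using le_add_diff_inverse[of n k] by (cases "k < n") (auto intro: range_eqI[of _ _ "k - n"])
  then have "UNIV = {..<n} \<union> range ((+) n)" by blast
  then show ?thesis unfolding ray_arcs_shift unfolding ray_arcs_def by (metis image_Un)
qed

lemma ray_arcs_cong:
  "(\<And>k. k \<in> K \<Longrightarrow> r k = s k \<and> r (Suc k) = s (Suc k)) \<Longrightarrow> ray_arcs r K = ray_arcs s K"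
  unfolding ray_arcs_def by (rule image_cong) auto

lemma arcs_join_bip:
  assumes "i < j" "R (r i) 0 = r i" "R (r j) 0 = r j"
  shows "arcs (join_bip R r i j) =
    (ray_arcs (R (r i)) UNIV)\<inverse> \<union> ray_arcs r {i..<j} \<union> ray_arcs (R (r j)) UNIV"
proof -
  let ?p = "\<lambda>k. join_bip R r i j (int k)"
  have "ray_arcs ?p UNIV = ray_arcs ?p {..<j - i} \<union> ray_arcs (\<lambda>k. ?p (j - i + k)) UNIV"
    by (rule ray_arcs_split)
  also have "ray_arcs ?p {..<j - i} = ray_arcs (\<lambda>k. r (i + k)) {..<j - i}"
    by (rule ray_arcs_cong) (use assms in \<open>auto simp: join_bip_def nat_add_distrib\<close>)
  also have "\<dots> = ray_arcs r {i..<j}"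
    unfolding ray_arcs_shift using assms(1) by (simp add: lessThan_atLeast0 add.commute)
  also have "ray_arcs (\<lambda>k. ?p (j - i + k)) UNIV = ray_arcs (R (r j)) UNIV"
    by (rule ray_arcs_cong)
      (use assms in \<open>auto simp: join_bip_def nat_add_distrib nat_diff_distrib\<close>)
  also have "ray_arcs (\<lambda>k. join_bip R r i j (- int k)) UNIV = ray_arcs (R (r i)) UNIV"
    by (rule ray_arcs_cong) (simp add: join_bip_def nat_add_distrib)
  ultimately show ?thesis unfolding arcs_two_sided[of "join_bip R r i j"] by (simp add: Un_assoc)
qed

lemma arcs_end_bip:
  assumes "R (r i) 0 = r i"
  shows "arcs (end_bip R r i) = (ray_arcs (R (r i)) UNIV)\<inverse> \<union> ray_arcs r {i..}"
proof -
  have "ray_arcs (\<lambda>k. end_bip R r i (int k)) UNIV = ray_arcs (\<lambda>k. r (i + k)) UNIV"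
    by (rule ray_arcs_cong) (use assms in \<open>auto simp: end_bip_def nat_add_distrib\<close>)
  also have "\<dots> = ray_arcs r {i..}"
    unfolding ray_arcs_shift
    by (rule arg_cong[of _ _ "ray_arcs r"]) (auto simp: image_iff le_iff_add)
  finally have "ray_arcs (\<lambda>k. end_bip R r i (int k)) UNIV = ray_arcs r {i..}" .
  moreover have "ray_arcs (\<lambda>k. end_bip R r i (- int k)) UNIV = ray_arcs (R (r i)) UNIV"
    by (rule ray_arcs_cong) (simp add: end_bip_def nat_add_distrib)
  ultimately show ?thesis unfolding arcs_two_sided[of "end_bip R r i"] by simp
qed

context ray_tree
begin

abbreviation bpos :: "(nat \<Rightarrow> 'v) \<Rightarrow> nat set" where
  "bpos \<equiv> branch_pos branch_points"

abbreviation P :: "(int \<Rightarrow> 'v) set" where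
  "P \<equiv> bips mid L B R"

lemma bposE:
  assumes "i \<in> bpos r"
  obtains k where "i = Suc k" "r (Suc k) \<in> branch_points"
  using assms unfolding branch_pos_def by (cases i) auto

lemma Suc_bpos_iff: "Suc k \<in> bpos r \<longleftrightarrow> r (Suc k) \<in> branch_points"
  by (simp add: branch_pos_def)

lemma bpos_branch_point: "i \<in> bpos r \<Longrightarrow> r i \<in> branch_points"
  by (simp add: branch_pos_def)

primrec last_branch :: "(nat \<Rightarrow> 'v) \<Rightarrow> nat \<Rightarrow> nat option" where
  "last_branch r 0 = None"
| "last_branch r (Suc k) = (if r (Suc k) \<in> branch_points then Some (Suc k) else last_branch r k)"

lemma last_branch_Some_iff:
  "last_branch r k = Some i \<longleftrightarrow> i \<in> bpos r \<and> i \<le> k \<and> (\<forall>m\<in>bpos r. \<not> (i < m \<and> m \<le> k))"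
proof (induction k)
  case (Suc k)
  then show ?case by (auto simp: branch_pos_def le_Suc_eq)
qed (auto simp: branch_pos_def)

lemma last_branch_bpos: "last_branch r k = Some i \<Longrightarrow> i \<in> bpos r"
  by (simp add: last_branch_Some_iff)

definition next_branch :: "(nat \<Rightarrow> 'v) \<Rightarrow> nat \<Rightarrow> nat \<Rightarrow> bool" where
  "next_branch r i j \<longleftrightarrow> j \<in> bpos r \<and> i < j \<and> (\<forall>m\<in>bpos r. \<not> (i < m \<and> m < j))"

lemma next_branch_bpos: "next_branch r i j \<Longrightarrow> j \<in> bpos r"
  by (simp add: next_branch_def)

lemma next_branch_iff:
  assumes "i \<in> bpos r"
  shows "next_branch r i (Suc j) \<longleftrightarrow> r (Suc j) \<in> branch_points \<and> last_branch r j = Some i"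
  using assms unfolding next_branch_def last_branch_Some_iff
  by (auto simp: branch_pos_def less_Suc_eq_le)

lemma next_branch_unique: "next_branch r i j \<Longrightarrow> next_branch r i k \<Longrightarrow> j = k"
  unfolding next_branch_def by (meson linorder_neqE_nat)

lemma next_branch_cases:
  obtains (following) j where "next_branch r i j" | (final) "\<forall>j\<in>bpos r. j \<le> i"
proof (cases "\<exists>j. j \<in> bpos r \<and> i < j")
  case True
  define j where "j = (LEAST j. j \<in> bpos r \<and> i < j)"
  have "j \<in> bpos r \<and> i < j" unfolding j_def using True by (rule LeastI_ex)
  moreover have "\<not> (i < m \<and> m < j)" if "m \<in> bpos r" for m
    using not_less_Least[of m "\<lambda>j. j \<in> bpos r \<and> i < j"] that unfolding j_def by blast
  ultimately show ?thesis using that(1) unfolding next_branch_def by blast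
qed (use that(2) linorder_not_less in blast)

definition bip_at :: "(nat \<Rightarrow> 'v) \<Rightarrow> nat \<Rightarrow> int \<Rightarrow> 'v" where
  "bip_at r i =
     (if \<exists>j. next_branch r i j then join_bip R r i (THE j. next_branch r i j) else end_bip R r i)"

lemma bip_at_join:
  assumes "next_branch r i j"
  shows "bip_at r i = join_bip R r i j"
proof -
  have "(THE j. next_branch r i j) = j" using assms next_branch_unique by blast
  with assms show ?thesis unfolding bip_at_def by auto
qed

lemma bip_at_end: "\<forall>j\<in>bpos r. j \<le> i \<Longrightarrow> bip_at r i = end_bip R r i"
  unfolding bip_at_def next_branch_def by (metis linorder_not_less)

lemma bip_at_nonpos: "k \<le> 0 \<Longrightarrow> bip_at r i k = R (r i) (nat (- k))"
  by (cases rule: next_branch_cases[of r i])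
    (auto simp: bip_at_join bip_at_end join_bip_def end_bip_def)

lemma bip_at_0: "i \<in> bpos r \<Longrightarrow> bip_at r i 0 = r i"
  using bip_at_nonpos[of 0 r i] R_0 bpos_branch_point by simp

definition bip_coords :: "((nat \<Rightarrow> 'v) \<times> nat) set" where
  "bip_coords = {(r, i). r \<in> all_rays \<and> i \<in> bpos r}"

lemma bip_coordsD: "(r, i) \<in> bip_coords \<Longrightarrow> r \<in> all_rays \<and> i \<in> bpos r"
  unfolding bip_coords_def by simp

lemma inj_on_bip_at: "inj_on (\<lambda>(r, i). bip_at r i) bip_coords"
proof (rule inj_onI, clarify)
  fix r i s j
  assume coords: "(r, i) \<in> bip_coords" "(s, j) \<in> bip_coords" and same_bip: "bip_at r i = bip_at s j"
  then have members: "r \<in> all_rays" "s \<in> all_rays" "i \<in> bpos r" "j \<in> bpos s"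
    unfolding bip_coords_def by auto
  obtain k l where indices: "i = Suc k" "j = Suc l" using members(3,4) by (auto elim!: bposE)
  have "r i = s j" using same_bip members bip_at_0 by metis
  then show "r = s \<and> i = j" using ray_coords_unique[OF members(1,2)] indices by simp
qed

lemma bip_at_eq_iff:
  "(r, i) \<in> bip_coords \<Longrightarrow> (s, j) \<in> bip_coords \<Longrightarrow> bip_at r i = bip_at s j \<longleftrightarrow> r = s \<and> i = j"
  using inj_on_eq_iff[OF inj_on_bip_at, of "(r, i)" "(s, j)"] by simp

lemma bip_at_neq_L:
  assumes "i \<in> bpos r"
  shows "bip_at r i \<noteq> L"
  using bip_at_nonpos[of "-1" r i] R_not_line(1)[OF bpos_branch_point[OF assms], of 0 "-1"] by auto

lemma ray_bips_eq: "ray_bips R branch_points r = bip_at r ` bpos r"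
proof (intro equalityI subsetI)
  fix p assume "p \<in> ray_bips R branch_points r"
  then consider i j where "i \<in> bpos r" "next_branch r i j" "p = join_bip R r i j"
    | i where "i \<in> bpos r" "\<forall>j\<in>bpos r. j \<le> i" "p = end_bip R r i"
    unfolding ray_bips_def next_branch_def by blast
  then show "p \<in> bip_at r ` bpos r" by cases (auto simp flip: bip_at_join bip_at_end)
next
  fix p assume "p \<in> bip_at r ` bpos r"
  then obtain i where index: "i \<in> bpos r" "p = bip_at r i" by blast
  show "p \<in> ray_bips R branch_points r"
  proof (cases rule: next_branch_cases[of r i])
    case (following j)
    then show ?thesis
      using index bip_at_join[OF following] unfolding ray_bips_def next_branch_def by blast
  next
    case final
    then show ?thesis using index bip_at_end[OF final] unfolding ray_bips_def by blast
  qed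
qed

lemma branch_pos_B:
  assumes "r \<in> rays_at n"
  shows "branch_pos (B n) r = bpos r"
proof -
  have "r (Suc k) \<in> B n \<longleftrightarrow> r (Suc k) \<in> branch_points" for k
    using assms depth_ray[OF assms, of k] depth_branch_point
    by (cases n) (auto intro: branch_pointI elim!: branch_pointE)
  then show ?thesis unfolding branch_pos_def by (metis Suc_le_D One_nat_def)
qed

lemma bips_upto_eq:
  "bips_upto mid L B R (Suc n) = insert L (\<Union>m\<in>{..n}. \<Union>r\<in>rays_at m. bip_at r ` bpos r)"
proof (induction n)
  case (Suc n)
  have "ray_bips R (B (Suc n)) r = bip_at r ` bpos r" if "r \<in> rays_at (Suc n)" for r
    using branch_pos_B[OF that] ray_bips_eq[of r] unfolding ray_bips_def by simp
  then have "bips_upto mid L B R (Suc (Suc n)) =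
      bips_upto mid L B R (Suc n) \<union> (\<Union>r\<in>rays_at (Suc n). bip_at r ` bpos r)"
    by (simp cong: SUP_cong)
  then show ?case
    by (simp only: Suc.IH atMost_Suc UN_insert Un_insert_left Un_insert_right Un_commute)
qed simp

lemma bips_eq: "P = insert L ((\<lambda>(r, i). bip_at r i) ` bip_coords)"
proof -
  have "P = (\<Union>n. bips_upto mid L B R (Suc n))"
    unfolding bips_def by (rule UN_Suc_eq) simp
  also have "\<dots> = insert L (\<Union>r\<in>all_rays. bip_at r ` bpos r)"
    unfolding bips_upto_eq all_rays_def by blast
  also have "(\<Union>r\<in>all_rays. bip_at r ` bpos r) = (\<lambda>(r, i). bip_at r i) ` bip_coords"
    unfolding bip_coords_def by auto
  finally show ?thesis .
qed

lemma L_in_P: "L \<in> P"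
  unfolding bips_eq by simp

lemma bip_at_in_P: "(r, i) \<in> bip_coords \<Longrightarrow> bip_at r i \<in> P"
  unfolding bips_eq by force

lemma P_cases:
  assumes "p \<in> P"
  obtains (line) "p = L" | (branch) r i where "(r, i) \<in> bip_coords" "p = bip_at r i"
  using assms unfolding bips_eq by auto

section \<open>The bips crossing an edge\<close>

lemma arcs_line: "arcs L = (ray_arcs neg_ray UNIV)\<inverse> \<union> ray_arcs pos_ray UNIV"
proof (cases mid)
  case True
  have "ray_arcs neg_ray UNIV = insert (L 1, L 0) (ray_arcs (\<lambda>k. L (- int k)) UNIV)"
    using True unfolding ray_arcs_split[of neg_ray 1] by (simp add: ray_arcs_def lessThan_Suc)
  moreover have "(L 0, L 1) \<in> ray_arcs pos_ray UNIV"
    unfolding ray_arcs_def by (rule image_eqI[of _ _ 0]) simp_all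
  ultimately show ?thesis unfolding arcs_two_sided[of L] by auto
qed (simp add: arcs_two_sided[of L])

lemma arcs_bip_at:
  assumes "i \<in> bpos r"
  shows "arcs (bip_at r i) = (ray_arcs (R (r i)) UNIV)\<inverse> \<union> ray_arcs r {k. last_branch r k = Some i}
    \<union> (\<Union>j\<in>{j. next_branch r i j}. ray_arcs (R (r j)) UNIV)"
proof (cases rule: next_branch_cases[of r i])
  case (following j)
  have "{k. last_branch r k = Some i} = {i..<j}"
    using following assms unfolding last_branch_Some_iff next_branch_def by fastforce
  moreover have "{j. next_branch r i j} = {j}" using following next_branch_unique by blast
  moreover have "i < j" using following unfolding next_branch_def by blast
  ultimately show ?thesis
    using arcs_join_bip[of i j R r] R_0 bpos_branch_point assms next_branch_bpos[OF following]
    by (simp add: bip_at_join[OF following])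
next
  case final
  have "{k. last_branch r k = Some i} = {i..}"
    using final assms unfolding last_branch_Some_iff by fastforce
  moreover have "{j. next_branch r i j} = {}" using final unfolding next_branch_def by fastforce
  ultimately show ?thesis
    using arcs_end_bip[of R r i] R_0 bpos_branch_point assms by (simp add: bip_at_end[OF final])
qed

lemma forward_arc_ray:
  assumes "r \<in> all_rays" "s \<in> all_rays"
  shows "(s k, s (Suc k)) \<in> ray_arcs r K \<longleftrightarrow> s = r \<and> k \<in> K"
proof
  assume "(s k, s (Suc k)) \<in> ray_arcs r K"
  then obtain l where "l \<in> K" "r (Suc l) = s (Suc k)" unfolding ray_arcs_def by auto
  then show "s = r \<and> k \<in> K" using ray_coords_unique[OF assms, of l k] by simp
qed (auto simp: ray_arcs_def)

lemma backward_arc_ray: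
  assumes "r \<in> all_rays" "s \<in> all_rays" "(s (Suc k), s k) \<in> ray_arcs r K"
  shows "mid \<and> k = 0 \<and> 0 \<in> K \<and> {r, s} = {pos_ray, neg_ray}"
proof -
  obtain l where "l \<in> K" "r l = s (Suc k)" "r (Suc l) = s k"
    using assms(3) unfolding ray_arcs_def by auto
  then show ?thesis using opposite_edges[OF assms(1,2), of l k] by auto
qed

lemma backward_arc_R: "v \<in> branch_points \<Longrightarrow> s \<in> all_rays \<Longrightarrow> (s (Suc k), s k) \<notin> ray_arcs (R v) K"
  using backward_arc_ray[OF R_in_all_rays, of v s k K] R_not_line(2,3)[of v]
  by (auto simp: doubleton_eq_iff)

lemma ray_arc_bip_at:
  assumes coords: "(r, i) \<in> bip_coords" and s_ray: "s \<in> all_rays"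
  shows "(s k, s (Suc k)) \<in> arcs (bip_at r i) \<longleftrightarrow>
      s = r \<and> last_branch r k = Some i \<or> (\<exists>j. next_branch r i j \<and> s = R (r j))"
    and "(s (Suc k), s k) \<in> arcs (bip_at r i) \<longleftrightarrow> s = R (r i)"
proof -
  have r_ray: "r \<in> all_rays" and i_bpos: "i \<in> bpos r" using bip_coordsD[OF coords] by auto
  have branch: "r i \<in> branch_points" "\<And>j. next_branch r i j \<Longrightarrow> r j \<in> branch_points"
    using i_bpos next_branch_bpos bpos_branch_point by blast+
  have "(s (Suc k), s k) \<notin> ray_arcs r {k. last_branch r k = Some i}"
    using backward_arc_ray[OF r_ray s_ray] by fastforce
  then show "(s (Suc k), s k) \<in> arcs (bip_at r i) \<longleftrightarrow> s = R (r i)"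
    using branch s_ray
    by (auto simp: arcs_bip_at[OF i_bpos] forward_arc_ray R_in_all_rays backward_arc_R)
  show "(s k, s (Suc k)) \<in> arcs (bip_at r i) \<longleftrightarrow>
      s = r \<and> last_branch r k = Some i \<or> (\<exists>j. next_branch r i j \<and> s = R (r j))"
    using branch r_ray s_ray
    by (auto simp: arcs_bip_at[OF i_bpos] forward_arc_ray R_in_all_rays backward_arc_R)
qed

lemma ray_arc_line:
  assumes s_ray: "s \<in> all_rays"
  shows "(s k, s (Suc k)) \<in> arcs L \<longleftrightarrow> s = pos_ray" "(s (Suc k), s k) \<in> arcs L \<longleftrightarrow> s = neg_ray"
proof -
  have "s = pos_ray" if "(s (Suc k), s k) \<in> ray_arcs neg_ray UNIV"
    using backward_arc_ray[OF line_rays(2) s_ray that] by (metis doubleton_eq_iff)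
  moreover have "s = neg_ray" if "(s (Suc k), s k) \<in> ray_arcs pos_ray UNIV"
    using backward_arc_ray[OF line_rays(1) s_ray that] by (metis doubleton_eq_iff)
  ultimately show "(s k, s (Suc k)) \<in> arcs L \<longleftrightarrow> s = pos_ray"
    "(s (Suc k), s k) \<in> arcs L \<longleftrightarrow> s = neg_ray"
    unfolding arcs_line Un_iff converse_iff
      forward_arc_ray[OF line_rays(1) s_ray] forward_arc_ray[OF line_rays(2) s_ray] by blast+
qed

definition bips_over :: "(nat \<Rightarrow> 'v) \<Rightarrow> nat \<Rightarrow> (int \<Rightarrow> 'v) set" where
  "bips_over s k = {p \<in> P. {s k, s (Suc k)} \<in> bip_edges p}"

lemma L_over_iff: "s \<in> all_rays \<Longrightarrow> L \<in> bips_over s k \<longleftrightarrow> s = pos_ray \<or> s = neg_ray"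
  unfolding bips_over_def by (simp add: L_in_P bip_edges_arcs ray_arc_line)

lemma bip_at_over_iff:
  assumes "(r, i) \<in> bip_coords" "s \<in> all_rays"
  shows "bip_at r i \<in> bips_over s k \<longleftrightarrow>
    s = r \<and> last_branch r k = Some i \<or> (\<exists>j. next_branch r i j \<and> s = R (r j)) \<or> s = R (r i)"
  unfolding bips_over_def by (auto simp: bip_at_in_P assms bip_edges_arcs ray_arc_bip_at)

lemma ray_neq_R:
  assumes "r \<in> all_rays" "i \<in> bpos r"
  shows "r \<noteq> R (r i)"
proof
  assume "r = R (r i)"
  then have "r 0 = r i" using R_0[OF bpos_branch_point[OF assms(2)]] by metis
  then have "i = 0" using ray_eq_iff[OF assms(1)] by simp
  then show False using assms(2) by (simp add: branch_pos_def)
qed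

lemma next_R_neq_R:
  assumes "r \<in> all_rays" "i \<in> bpos r" "next_branch r i j"
  shows "R (r j) \<noteq> R (r i)"
proof -
  have "i \<noteq> j" using assms(3) unfolding next_branch_def by simp
  then show ?thesis
    using R_eq_iff bpos_branch_point[OF assms(2)]
      bpos_branch_point[OF next_branch_bpos[OF assms(3)]]
      ray_eq_iff[OF assms(1)] by metis
qed

lemma bip_at_not_over_first:
  assumes "s \<in> all_rays" "i \<in> bpos s"
  shows "bip_at s i \<notin> bips_over s 0"
proof -
  have "(s, i) \<in> bip_coords" using assms unfolding bip_coords_def by simp
  moreover have "s \<noteq> R (s j)" if "next_branch s i j" for j
    using ray_neq_R[OF assms(1) next_branch_bpos[OF that]] .
  ultimately show ?thesis using bip_at_over_iff[of s i s 0] ray_neq_R[OF assms] assms by auto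
qed

lemma bips_over_ray:
  assumes s_ray: "s \<in> all_rays"
  shows "bips_over s k = bips_over s 0 \<union> bip_at s ` set_option (last_branch s k)"
proof (intro equalityI subsetI)
  fix p assume over: "p \<in> bips_over s k"
  then have "p \<in> P" unfolding bips_over_def by blast
  then show "p \<in> bips_over s 0 \<union> bip_at s ` set_option (last_branch s k)"
    by (cases rule: P_cases) (use over L_over_iff[OF s_ray] bip_at_over_iff[OF _ s_ray] in auto)
next
  fix p assume "p \<in> bips_over s 0 \<union> bip_at s ` set_option (last_branch s k)"
  then consider (whole) "p \<in> bips_over s 0"
    | (part) i where "p = bip_at s i" "last_branch s k = Some i" by auto
  then show "p \<in> bips_over s k"
  proof cases
    case whole
    then have "p \<in> P" unfolding bips_over_def by blast
    then show ?thesis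
      by (cases rule: P_cases) (use whole L_over_iff[OF s_ray] bip_at_over_iff[OF _ s_ray] in auto)
  next
    case (part i)
    then have "(s, i) \<in> bip_coords" using s_ray last_branch_bpos unfolding bip_coords_def by blast
    then show ?thesis using part bip_at_over_iff[OF _ s_ray] by blast
  qed
qed

lemma bips_over_line:
  assumes "s = pos_ray \<or> s = neg_ray"
  shows "bips_over s 0 = {L}"
proof -
  have s_ray: "s \<in> all_rays" using assms line_rays by blast
  have "bip_at r i \<notin> bips_over s 0" if "(r, i) \<in> bip_coords" for r i
  proof -
    have i_bpos: "i \<in> bpos r" using bip_coordsD[OF that] by blast
    have "s \<noteq> R (r j)" if "j \<in> bpos r" for j
      using R_not_line(2,3)[OF bpos_branch_point[OF that]] assms by auto
    then show ?thesis using bip_at_over_iff[OF that s_ray, of 0] i_bpos next_branch_bpos by auto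
  qed
  moreover have "bips_over s 0 \<subseteq> P" unfolding bips_over_def by blast
  moreover have "L \<in> bips_over s 0" using L_over_iff[OF s_ray] assms by blast
  ultimately show ?thesis unfolding bips_eq by auto
qed

lemma ray_at_branch_eq_iff:
  assumes "r \<in> all_rays" "r (Suc i) \<in> branch_points" and "q \<in> all_rays" "m \<in> bpos q"
  shows "R (r (Suc i)) = R (q m) \<longleftrightarrow> q = r \<and> m = Suc i"
proof -
  obtain l where "m = Suc l" "q (Suc l) \<in> branch_points" using assms(4) by (rule bposE)
  then show ?thesis
    using R_eq_iff[OF assms(2), of "q m"] ray_coords_unique[OF assms(1,3), of i l] by auto
qed

lemma bips_over_branch:
  assumes r_ray: "r \<in> all_rays" and branch: "r (Suc i) \<in> branch_points"
  shows "bips_over (R (r (Suc i))) 0 =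
    insert (bip_at r (Suc i)) (bip_at r ` set_option (last_branch r i))" (is "bips_over ?s 0 = ?M")
proof -
  have s_ray: "?s \<in> all_rays" using branch R_in_all_rays by blast
  have over_iff: "bip_at q j \<in> bips_over ?s 0 \<longleftrightarrow> q = r \<and> (last_branch r i = Some j \<or> j = Suc i)"
    if q_coords: "(q, j) \<in> bip_coords" for q j
  proof -
    have q_ray: "q \<in> all_rays" "j \<in> bpos q" using bip_coordsD[OF q_coords] by auto
    have "(\<exists>m. next_branch q j m \<and> ?s = R (q m)) \<longleftrightarrow> q = r \<and> next_branch r j (Suc i)"
      using ray_at_branch_eq_iff[OF r_ray branch q_ray(1) next_branch_bpos] by blast
    also have "\<dots> \<longleftrightarrow> q = r \<and> last_branch r i = Some j"
      using next_branch_iff[of j r i] q_ray(2) branch by blast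
    finally show ?thesis unfolding bip_at_over_iff[OF q_coords s_ray]
      using ray_at_branch_eq_iff[OF r_ray branch q_ray] by auto
  qed
  have coords: "(r, j) \<in> bip_coords" if "last_branch r i = Some j \<or> j = Suc i" for j
    using that r_ray branch last_branch_bpos unfolding bip_coords_def by (auto simp: Suc_bpos_iff)
  show ?thesis
  proof (intro equalityI subsetI)
    fix p assume over: "p \<in> bips_over ?s 0"
    then have "p \<in> P" unfolding bips_over_def by blast
    then show "p \<in> ?M"
      by (cases rule: P_cases)
        (use over over_iff L_over_iff[OF s_ray] R_not_line(2,3)[OF branch] in auto)
  next
    fix p assume "p \<in> ?M"
    then obtain j where "p = bip_at r j" "last_branch r i = Some j \<or> j = Suc i" by auto
    then show "p \<in> bips_over ?s 0" using over_iff[OF coords] by blast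
  qed
qed

lemma finite_bips_over_first:
  assumes "s \<in> all_rays"
  shows "finite (bips_over s 0)"
  using assms
proof (cases rule: all_rays_cases)
  case (branch v)
  then obtain r i where "r \<in> all_rays" "v = r (Suc i)" using branch_point_coords by blast
  then show ?thesis using branch bips_over_branch by simp
qed (use bips_over_line in simp_all)

section \<open>The flow of a function on the bips\<close>

definition branch_term :: "((int \<Rightarrow> 'v) \<Rightarrow> 'a::normed_coeff_ring) \<Rightarrow> (nat \<Rightarrow> 'v) \<Rightarrow> nat \<Rightarrow> 'a" where
  "branch_term f r k = (case last_branch r k of None \<Rightarrow> 0 | Some i \<Rightarrow> f (bip_at r i))"

lemma branch_term_0: "branch_term f r 0 = 0"
  by (simp add: branch_term_def)

lemma branch_term_Suc:
  "branch_term f r (Suc k) =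
    (if r (Suc k) \<in> branch_points then f (bip_at r (Suc k)) else branch_term f r k)"
  by (simp add: branch_term_def)

definition ray_flow :: "('v list \<Rightarrow> 'a::normed_coeff_ring) \<Rightarrow> (nat \<Rightarrow> 'v) \<Rightarrow> nat \<Rightarrow> 'a" where
  "ray_flow c r k = c [r k, r (Suc k)]"

lemma bip_sum_ray_flow:
  "ray_flow (bip_sum P f) s k = (\<Sum>p\<in>bips_over s k. f p * bip_chain p [s k, s (Suc k)])"
  unfolding ray_flow_def bip_sum_def bips_over_def by simp

lemma bip_chain_ray_const:
  assumes s_ray: "s \<in> all_rays" and over: "p \<in> bips_over s 0"
  shows "bip_chain p [s k, s (Suc k)] = bip_chain p [s 0, s (Suc 0)]"
proof -
  have "p \<in> P" using over unfolding bips_over_def by blast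
  then have "((s k, s (Suc k)) \<in> arcs p \<longleftrightarrow> (s 0, s (Suc 0)) \<in> arcs p) \<and>
      ((s (Suc k), s k) \<in> arcs p \<longleftrightarrow> (s (Suc 0), s 0) \<in> arcs p)"
  proof (cases rule: P_cases)
    case line
    then show ?thesis by (simp add: ray_arc_line[OF s_ray])
  next
    case (branch r i)
    then have "\<not> (s = r \<and> last_branch r k = Some i)"
      using over s_ray bip_at_not_over_first last_branch_bpos by blast
    then show ?thesis unfolding branch(2) ray_arc_bip_at[OF branch(1) s_ray] by auto
  qed
  then show ?thesis unfolding bip_chain_arcs by simp
qed

lemma bip_chain_last_branch:
  assumes s_ray: "s \<in> all_rays" and last: "last_branch s k = Some i"
  shows "bip_chain (bip_at s i) [s k, s (Suc k)] = 1"
proof -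
  have "(s, i) \<in> bip_coords" using s_ray last_branch_bpos[OF last] unfolding bip_coords_def by simp
  then show ?thesis using s_ray last by (simp add: bip_chain_arcs ray_arc_bip_at)
qed

lemma ray_flow_bip_sum:
  fixes f :: "(int \<Rightarrow> 'v) \<Rightarrow> 'a::normed_coeff_ring"
  assumes s_ray: "s \<in> all_rays"
  shows "ray_flow (bip_sum P f) s k = ray_flow (bip_sum P f) s 0 + branch_term f s k"
proof -
  have const: "(\<Sum>p\<in>bips_over s 0. f p * bip_chain p [s k, s (Suc k)]) = ray_flow (bip_sum P f) s 0"
    unfolding bip_sum_ray_flow
    by (intro sum.cong refl arg_cong2[where f = "(*)"] bip_chain_ray_const[OF s_ray])
  show ?thesis
  proof (cases "last_branch s k")
    case None
    then have "bips_over s k = bips_over s 0" using bips_over_ray[OF s_ray, of k] by simp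
    then show ?thesis
      using None const unfolding bip_sum_ray_flow[of f s k] by (simp add: branch_term_def)
  next
    case (Some i)
    then have "bips_over s k = insert (bip_at s i) (bips_over s 0)"
      using bips_over_ray[OF s_ray, of k] by simp
    moreover have "bip_at s i \<notin> bips_over s 0"
      using bip_at_not_over_first[OF s_ray last_branch_bpos[OF Some]] .
    ultimately show ?thesis
      using Some const finite_bips_over_first[OF s_ray] unfolding bip_sum_ray_flow[of f s k]
      by (simp add: branch_term_def bip_chain_last_branch[OF s_ray Some])
  qed
qed

lemma ray_flow_bip_sum_line:
  "ray_flow (bip_sum P f) pos_ray 0 = f L" "ray_flow (bip_sum P f) neg_ray 0 = - f L"
  using ray_arc_line[OF line_rays(1), of 0] ray_arc_line[OF line_rays(2), of 0] pos_ray_neq_neg_ray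
  unfolding bip_sum_ray_flow by (simp_all add: bips_over_line bip_chain_arcs)

lemma ray_flow_bip_sum_branch:
  fixes f :: "(int \<Rightarrow> 'v) \<Rightarrow> 'a::normed_coeff_ring"
  assumes r_ray: "r \<in> all_rays" and branch: "r (Suc i) \<in> branch_points"
  shows "ray_flow (bip_sum P f) (R (r (Suc i))) 0 = branch_term f r i - f (bip_at r (Suc i))"
proof -
  let ?s = "R (r (Suc i))"
  have s_ray: "?s \<in> all_rays" using branch R_in_all_rays by blast
  have coords: "(r, Suc i) \<in> bip_coords"
    using r_ray branch unfolding bip_coords_def by (simp add: Suc_bpos_iff)
  have in_sign: "bip_chain (bip_at r (Suc i)) [?s 0, ?s (Suc 0)] = (- 1 :: 'a)"
  proof -
    have "(?s 0, ?s (Suc 0)) \<notin> arcs (bip_at r (Suc i))"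
      using ray_neq_R[OF r_ray] next_R_neq_R[OF r_ray] bip_coordsD[OF coords]
      unfolding ray_arc_bip_at[OF coords s_ray] by metis
    then show ?thesis using ray_arc_bip_at(2)[OF coords s_ray, of 0] by (simp add: bip_chain_arcs)
  qed
  show ?thesis
  proof (cases "last_branch r i")
    case None
    then show ?thesis
      unfolding bip_sum_ray_flow bips_over_branch[OF assms] by (simp add: in_sign branch_term_def)
  next
    case (Some j)
    then have previous: "(r, j) \<in> bip_coords" "next_branch r j (Suc i)"
      using r_ray branch last_branch_bpos next_branch_iff unfolding bip_coords_def by blast+
    then have "bip_chain (bip_at r j) [?s 0, ?s (Suc 0)] = (1 :: 'a)"
      using s_ray by (auto simp: bip_chain_arcs ray_arc_bip_at)
    moreover have "bip_at r (Suc i) \<noteq> bip_at r j"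
      using bip_at_eq_iff[OF coords previous(1)] previous(2) unfolding next_branch_def by simp
    ultimately show ?thesis
      using Some unfolding bip_sum_ray_flow bips_over_branch[OF assms]
      by (simp add: in_sign branch_term_def)
  qed
qed

lemma arc_in_E:
  assumes "p \<in> P" "(x, y) \<in> arcs p"
  shows "{x, y} \<in> E"
proof -
  have ray_arc_edge: "{x, y} \<in> E"
    if "r \<in> all_rays" "(x, y) \<in> ray_arcs r K \<or> (y, x) \<in> ray_arcs r K" for r K
    using that ray_edge unfolding ray_arcs_def by (auto simp: insert_commute)
  from assms(1) show ?thesis
  proof (cases rule: P_cases)
    case line
    then have "(y, x) \<in> ray_arcs neg_ray UNIV \<or> (x, y) \<in> ray_arcs pos_ray UNIV"
      using assms(2) unfolding line arcs_line by blast
    then show ?thesis using ray_arc_edge line_rays by blast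
  next
    case (branch r i)
    then have members: "r \<in> all_rays" "i \<in> bpos r" using bip_coordsD by auto
    have glued: "R (r j) \<in> all_rays" if "j \<in> bpos r" for j
      using R_in_all_rays[OF bpos_branch_point[OF that]] .
    consider "(y, x) \<in> ray_arcs (R (r i)) UNIV" | K where "(x, y) \<in> ray_arcs r K"
      | j where "next_branch r i j" "(x, y) \<in> ray_arcs (R (r j)) UNIV"
      using assms(2) unfolding branch(2) arcs_bip_at[OF members(2)] by blast
    then show ?thesis by cases (use ray_arc_edge members glued next_branch_bpos in blast)+
  qed
qed

lemma arcs_antisym:
  assumes bip: "p \<in> P" and arc: "(x, y) \<in> arcs p"
  shows "(y, x) \<notin> arcs p"
proof -
  have one_way: "(s k, s (Suc k)) \<notin> arcs p \<or> (s (Suc k), s k) \<notin> arcs p"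
    if s_ray: "s \<in> all_rays" for s k
    using bip
  proof (cases rule: P_cases)
    case line
    then show ?thesis using pos_ray_neq_neg_ray by (auto simp: ray_arc_line[OF s_ray])
  next
    case (branch r i)
    then show ?thesis
      using ray_neq_R next_R_neq_R bip_coordsD[OF branch(1)]
      unfolding branch(2) ray_arc_bip_at[OF branch(1) s_ray] by metis
  qed
  show ?thesis by (rule edge_ray_cases[OF arc_in_E[OF bip arc]]) (use one_way arc in auto)
qed

lemma bip_sum_antisym:
  fixes f :: "(int \<Rightarrow> 'v) \<Rightarrow> 'a::normed_coeff_ring"
  shows "bip_sum P f [y, x] = - bip_sum P f [x, y]"
proof -
  have "bip_chain p [y, x] = (- bip_chain p [x, y] :: 'a)" if "p \<in> P" for p
    using arcs_antisym[OF that] by (auto simp: bip_chain_arcs)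
  then show ?thesis
    unfolding bip_sum_def by (auto simp: insert_commute simp flip: sum_negf intro!: sum.cong)
qed

lemma bip_sum_nonzero:
  fixes f :: "(int \<Rightarrow> 'v) \<Rightarrow> 'a::normed_coeff_ring"
  assumes "bip_sum P f xs \<noteq> 0"
  shows "\<exists>x y. xs = [x, y] \<and> {x, y} \<in> E"
proof -
  obtain p where bip: "p \<in> P" "f p * bip_chain p xs \<noteq> 0"
    using assms unfolding bip_sum_def by (metis (mono_tags, lifting) mem_Collect_eq sum.neutral)
  then have nonzero: "bip_chain p xs \<noteq> (0 :: 'a)" by auto
  then obtain x y where xs_eq: "xs = [x, y]" unfolding bip_chain_def by (auto split: if_splits)
  then have "(x, y) \<in> arcs p \<or> (y, x) \<in> arcs p"
    using nonzero by (auto simp: bip_chain_arcs split: if_splits)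
  then have "{x, y} \<in> E" using arc_in_E[OF bip(1)] by (metis insert_commute)
  with xs_eq show ?thesis by blast
qed

section \<open>The conservation law along the rays\<close>

definition branch_flow :: "('v list \<Rightarrow> 'a::normed_coeff_ring) \<Rightarrow> 'v \<Rightarrow> 'a" where
  "branch_flow c v = (if v \<in> branch_points then ray_flow c (R v) 0 else 0)"

lemma inflow_ray:
  fixes c :: "'v list \<Rightarrow> 'a::normed_coeff_ring"
  assumes chain: "c \<in> chains T 1" and r_ray: "r \<in> all_rays"
  shows "(\<Sum>x\<in>nbrs E (r (Suc k)). c [x, r (Suc k)]) =
    ray_flow c r k - ray_flow c r (Suc k) - branch_flow c (r (Suc k))"
proof -
  let ?v = "r (Suc k)"
  have two_sided: "r k \<noteq> r (Suc (Suc k))" "c [r (Suc (Suc k)), ?v] = - ray_flow c r (Suc k)"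
    using ray_eq_iff[OF r_ray] chains_1_antisym[OF chain, of "r (Suc (Suc k))" ?v]
    unfolding ray_flow_def by simp_all
  show ?thesis
  proof (cases "?v \<in> branch_points")
    case False
    then show ?thesis unfolding nbrs_ray[OF r_ray]
      using two_sided by (simp add: branch_flow_def) (simp add: ray_flow_def)
  next
    case True
    have R_ray: "R ?v \<in> all_rays" "R ?v 0 = ?v" by (rule R_in_all_rays[OF True], rule R_0[OF True])
    have "R ?v 1 \<noteq> r (Suc (Suc k))" using ray_coords_unique[OF r_ray R_ray(1), of "Suc k" 0] by auto
    moreover have "r k \<noteq> R ?v (Suc 0)"
    proof
      assume "r k = R ?v (Suc 0)"
      then have "{r, R ?v} = {pos_ray, neg_ray}"
        using opposite_edges[OF r_ray R_ray(1) _ R_ray(2)[symmetric]] by blast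
      then show False using R_not_line(2,3)[OF True] by (metis doubleton_eq_iff)
    qed
    moreover have "c [R ?v 1, ?v] = - ray_flow c (R ?v) 0"
      using chains_1_antisym[OF chain, of "R ?v 1" ?v] R_ray(2) unfolding ray_flow_def by simp
    ultimately show ?thesis unfolding nbrs_ray[OF r_ray] using True two_sided
      by (simp add: branch_flow_def) (simp add: ray_flow_def)
  qed
qed

lemma inflow_root:
  fixes c :: "'v list \<Rightarrow> 'a::normed_coeff_ring"
  assumes chain: "c \<in> chains T 1" and "\<not> mid"
  shows "(\<Sum>x\<in>nbrs E (L 0). c [x, L 0]) = - ray_flow c pos_ray 0 - ray_flow c neg_ray 0"
  using chains_1_antisym[OF chain, of "L 1" "L 0"]
    chains_1_antisym[OF chain, of "L (- 1)" "L 0"] \<open>\<not> mid\<close>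
  by (simp add: nbrs_root ray_flow_def)

lemma ray_flow_suppressed_root:
  assumes "c \<in> chains T 1" "mid"
  shows "ray_flow c pos_ray 0 = - ray_flow c neg_ray 0"
  using chains_1_antisym[OF assms(1), of "L 1" "L 0"] assms(2) by (simp add: ray_flow_def)

lemma cycles_ray_iff:
  fixes c :: "'v list \<Rightarrow> 'a::normed_coeff_ring"
  shows "c \<in> cycles T 1 \<longleftrightarrow> c \<in> chains T 1 \<and> ray_flow c pos_ray 0 = - ray_flow c neg_ray 0 \<and>
    (\<forall>r\<in>all_rays. \<forall>k. ray_flow c r k = ray_flow c r (Suc k) + branch_flow c (r (Suc k)))"
    (is "_ \<longleftrightarrow> _ \<and> ?root \<and> ?rays")
proof (cases "c \<in> chains T 1")
  case chain: True
  have inner: "(\<Sum>x\<in>nbrs E (r (Suc k)). c [x, r (Suc k)]) = 0 \<longleftrightarrow>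
      ray_flow c r k = ray_flow c r (Suc k) + branch_flow c (r (Suc k))" if "r \<in> all_rays" for r k
    unfolding inflow_ray[OF chain that] by (simp add: diff_diff_eq)
  have root: "(\<Sum>x\<in>nbrs E (L 0). c [x, L 0]) = 0 \<longleftrightarrow> ?root" if "\<not> mid"
    unfolding inflow_root[OF chain that] right_minus_eq minus_equation_iff[of "ray_flow c pos_ray 0"]
    by (rule eq_commute)
  have "(\<forall>y. (\<Sum>x\<in>nbrs E y. c [x, y]) = 0) \<longleftrightarrow> ?root \<and> ?rays"
  proof (intro iffI conjI ballI allI)
    assume "\<forall>y. (\<Sum>x\<in>nbrs E y. c [x, y]) = 0"
    then show ?root using root ray_flow_suppressed_root[OF chain] by blast
  next
    fix r k assume "\<forall>y. (\<Sum>x\<in>nbrs E y. c [x, y]) = 0" "r \<in> all_rays"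
    then show "ray_flow c r k = ray_flow c r (Suc k) + branch_flow c (r (Suc k))"
      using inner by blast
  next
    fix y assume conserved: "?root \<and> ?rays"
    show "(\<Sum>x\<in>nbrs E y. c [x, y]) = 0"
    proof (cases "y \<in> V")
      case True
      then show ?thesis
      proof (cases rule: vertex_cases)
        case (ray r k)
        then show ?thesis using conserved inner by blast
      next
        case on_root: root
        then show ?thesis using conserved root by blast
      qed
    next
      case False
      then show ?thesis by (simp add: nbrs_outside[OF simple])
    qed
  qed
  then show ?thesis unfolding cycles_graph_iff using chain by blast
qed (simp add: cycles_def)

lemma cycles_rayD:
  assumes "c \<in> cycles T 1" "r \<in> all_rays"
  shows "ray_flow c r k = ray_flow c r (Suc k) + branch_flow c (r (Suc k))"
  using assms unfolding cycles_ray_iff by blast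

section \<open>The isomorphism\<close>

lemma cnorm_bip_sum:
  fixes f :: "(int \<Rightarrow> 'v) \<Rightarrow> 'a::normed_coeff_ring"
  assumes bound: "\<And>p. cnorm (f p) \<le> M"
  shows "cnorm (bip_sum P f xs) \<le> 3 * M"
proof (rule edge_list_induct[of "\<lambda>xs. cnorm (bip_sum P f xs) \<le> 3 * M"])
  have nonneg: "0 \<le> M" using cnorm_nonneg bound order_trans by blast
  have branch_bound: "cnorm (branch_term f r k) \<le> M" for r k
    using bound nonneg unfolding branch_term_def by (auto split: option.split)
  have first_bound: "cnorm (ray_flow (bip_sum P f) s 0) \<le> M + M" if "s \<in> all_rays" for s
    using that
  proof (cases rule: all_rays_cases)
    case (branch v)
    then obtain r i where parent: "r \<in> all_rays" "v = r (Suc i)" using branch_point_coords by blast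
    have "cnorm (branch_term f r i - f (bip_at r (Suc i))) \<le> M + M"
      by (intro order_trans[OF cnorm_diff] add_mono branch_bound bound)
    then show ?thesis using ray_flow_bip_sum_branch[OF parent(1), of i f] branch parent(2) by simp
  qed (use bound[of L] nonneg in \<open>simp_all add: ray_flow_bip_sum_line\<close>)
  fix s k assume s_ray: "s \<in> all_rays"
  have "cnorm (ray_flow (bip_sum P f) s 0 + branch_term f s k) \<le> M + M + M"
    by (intro order_trans[OF cnorm_add] add_mono first_bound s_ray branch_bound)
  then show "cnorm (bip_sum P f [s k, s (Suc k)]) \<le> 3 * M"
    using ray_flow_bip_sum[OF s_ray, of f k] unfolding ray_flow_def by simp
next
  show "cnorm (bip_sum P f [y, x]) \<le> 3 * M" if "cnorm (bip_sum P f [x, y]) \<le> 3 * M" for x y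
    using that bip_sum_antisym[of f y x] by simp
next
  assume "\<And>x y. xs = [x, y] \<Longrightarrow> {x, y} \<notin> E"
  then have "bip_sum P f xs = 0" using bip_sum_nonzero by blast
  moreover have "0 \<le> M" using cnorm_nonneg bound order_trans by blast
  ultimately show "cnorm (bip_sum P f xs) \<le> 3 * M" by simp
qed

lemma bip_sum_cycle:
  fixes f :: "(int \<Rightarrow> 'v) \<Rightarrow> 'a::normed_coeff_ring"
  assumes "bounded_fun f"
  shows "bip_sum P f \<in> cycles T 1"
  unfolding cycles_ray_iff
proof (intro conjI ballI allI)
  obtain M where "\<And>p. cnorm (f p) \<le> M" using assms unfolding bounded_fun_def by blast
  then have "bounded_fun (bip_sum P f)" by (intro bounded_funI[of _ "3 * M"] cnorm_bip_sum)
  moreover have "\<exists>x y. xs = [x, y] \<and> x \<noteq> y \<and> {x, y} \<in> T" if "bip_sum P f xs \<noteq> 0" for xs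
    using bip_sum_nonzero[OF that] edgeD edge_graph_complex by blast
  ultimately show "bip_sum P f \<in> chains T 1" by (intro chains_1I bip_sum_antisym)
  show "ray_flow (bip_sum P f) pos_ray 0 = - ray_flow (bip_sum P f) neg_ray 0"
    by (simp add: ray_flow_bip_sum_line)
  fix r k assume r_ray: "r \<in> all_rays"
  show "ray_flow (bip_sum P f) r k =
      ray_flow (bip_sum P f) r (Suc k) + branch_flow (bip_sum P f) (r (Suc k))"
    unfolding ray_flow_bip_sum[OF r_ray, of f k] ray_flow_bip_sum[OF r_ray, of f "Suc k"]
    by (simp add: branch_flow_def branch_term_Suc ray_flow_bip_sum_branch[OF r_ray])
qed

lemma bip_sum_eq_0D:
  fixes f :: "(int \<Rightarrow> 'v) \<Rightarrow> 'a::normed_coeff_ring"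
  assumes zero: "bip_sum P f = (\<lambda>xs. 0)" and "p \<in> P"
  shows "f p = 0"
  using \<open>p \<in> P\<close>
proof (cases rule: P_cases)
  case line
  then show ?thesis using ray_flow_bip_sum_line(1)[of f] zero by (simp add: ray_flow_def)
next
  case (branch r i)
  then have "r \<in> all_rays" "last_branch r i = Some i"
    using bip_coordsD unfolding last_branch_Some_iff by auto
  then show ?thesis
    using ray_flow_bip_sum[of r f i] zero branch by (simp add: ray_flow_def branch_term_def)
qed

definition bip_coeff :: "('v list \<Rightarrow> 'a::normed_coeff_ring) \<Rightarrow> (int \<Rightarrow> 'v) \<Rightarrow> 'a" where
  "bip_coeff c p =
     (if p = L then ray_flow c pos_ray 0
      else if p \<in> P then case inv_into bip_coords (\<lambda>(r, i). bip_at r i) p of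
        (r, i) \<Rightarrow> ray_flow c r i - ray_flow c r 0
      else 0)"

lemma bip_coeff_bip_at:
  assumes "(r, i) \<in> bip_coords"
  shows "bip_coeff c (bip_at r i) = ray_flow c r i - ray_flow c r 0"
  using inv_into_f_f[OF inj_on_bip_at assms] bip_at_neq_L bip_at_in_P[OF assms]
    bip_coordsD[OF assms]
  by (simp add: bip_coeff_def)

lemma bip_coeff_outside: "p \<notin> P \<Longrightarrow> bip_coeff c p = 0"
  using L_in_P by (auto simp: bip_coeff_def)

lemma bounded_fun_bip_coeff:
  assumes "bounded_fun c"
  shows "bounded_fun (bip_coeff c)"
proof -
  obtain M where bound: "M \<ge> 0" "\<And>xs. cnorm (c xs) \<le> M" using bounded_funE[OF assms] by blast
  have "cnorm (ray_flow c r i - ray_flow c s j) \<le> M + M" for r s i j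
    unfolding ray_flow_def by (intro order_trans[OF cnorm_diff] add_mono bound(2))
  moreover have "cnorm (ray_flow c r i) \<le> M + M" for r i
    using bound(1) bound(2)[of "[r i, r (Suc i)]"] unfolding ray_flow_def by linarith
  ultimately have "cnorm (bip_coeff c p) \<le> M + M" for p
    using bound(1) by (simp add: bip_coeff_def split: prod.split)
  then show ?thesis by (rule bounded_funI)
qed

lemma branch_term_bip_coeff:
  fixes c :: "'v list \<Rightarrow> 'a::normed_coeff_ring"
  assumes cycle: "c \<in> cycles T 1" and r_ray: "r \<in> all_rays"
  shows "branch_term (bip_coeff c) r k = ray_flow c r k - ray_flow c r 0"
proof (induction k)
  case (Suc k)
  show ?case
  proof (cases "r (Suc k) \<in> branch_points")
    case True
    then have "(r, Suc k) \<in> bip_coords" using r_ray by (simp add: bip_coords_def Suc_bpos_iff)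
    then show ?thesis using True by (simp add: branch_term_Suc bip_coeff_bip_at)
  next
    case False
    then have "ray_flow c r k = ray_flow c r (Suc k)"
      using cycles_rayD[OF cycle r_ray, of k] by (simp add: branch_flow_def)
    then show ?thesis using Suc.IH False by (simp add: branch_term_Suc)
  qed
qed (simp add: branch_term_0)

lemma ray_flow_bip_coeff:
  fixes c :: "'v list \<Rightarrow> 'a::normed_coeff_ring"
  assumes cycle: "c \<in> cycles T 1" and r_ray: "r \<in> all_rays"
  shows "ray_flow (bip_sum P (bip_coeff c)) r k = ray_flow c r k"
proof -
  have "ray_flow (bip_sum P (bip_coeff c)) r 0 = ray_flow c r 0" using r_ray
  proof (cases rule: all_rays_cases)
    case neg
    have "ray_flow c pos_ray 0 = - ray_flow c neg_ray 0"
      using cycle unfolding cycles_ray_iff by blast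
    then show ?thesis using neg by (simp add: ray_flow_bip_sum_line bip_coeff_def)
  next
    case (branch v)
    then obtain s i where parent: "s \<in> all_rays" "v = s (Suc i)" using branch_point_coords by blast
    then have "(s, Suc i) \<in> bip_coords" using branch by (simp add: bip_coords_def Suc_bpos_iff)
    then have "ray_flow (bip_sum P (bip_coeff c)) r 0 = ray_flow c s i - ray_flow c s (Suc i)"
      using ray_flow_bip_sum_branch[OF parent(1), of i "bip_coeff c"] branch parent
      by (simp add: bip_coeff_bip_at branch_term_bip_coeff[OF cycle])
    also have "\<dots> = ray_flow c r 0"
      using cycles_rayD[OF cycle parent(1), of i] parent(2) branch by (simp add: branch_flow_def)
    finally show ?thesis .
  qed (simp add: ray_flow_bip_sum_line bip_coeff_def)
  then show ?thesis
    by (simp add: ray_flow_bip_sum[OF r_ray, of _ k] branch_term_bip_coeff[OF cycle r_ray])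
qed

lemma bip_sum_bip_coeff:
  fixes c :: "'v list \<Rightarrow> 'a::normed_coeff_ring"
  assumes cycle: "c \<in> cycles T 1"
  shows "bip_sum P (bip_coeff c) = c"
proof
  have chain: "c \<in> chains T 1" using cycle unfolding cycles_def by blast
  fix xs
  show "bip_sum P (bip_coeff c) xs = c xs"
  proof (rule edge_list_induct[of "\<lambda>xs. bip_sum P (bip_coeff c) xs = c xs"])
    show "bip_sum P (bip_coeff c) [s k, s (Suc k)] = c [s k, s (Suc k)]" if "s \<in> all_rays" for s k
      using ray_flow_bip_coeff[OF cycle that, of k] unfolding ray_flow_def .
    show "bip_sum P (bip_coeff c) [y, x] = c [y, x]"
      if "bip_sum P (bip_coeff c) [x, y] = c [x, y]" for x y
      using that bip_sum_antisym[of "bip_coeff c" y x] chains_1_antisym[OF chain, of y x] by simp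
    assume "\<And>x y. xs = [x, y] \<Longrightarrow> {x, y} \<notin> E"
    then show "bip_sum P (bip_coeff c) xs = c xs"
      using bip_sum_nonzero[of "bip_coeff c" xs] graph_chain_edge[OF chain, of xs] by metis
  qed
qed

lemma bip_sum_add: "bip_sum P (\<lambda>p. f p + g p) = (\<lambda>xs. bip_sum P f xs + bip_sum P g xs)"
  unfolding bip_sum_def by (auto simp: sum.distrib distrib_right)

lemma bip_sum_diff: "bip_sum P (\<lambda>p. f p - g p) = (\<lambda>xs. bip_sum P f xs - bip_sum P g xs)"
  unfolding bip_sum_def by (auto simp: sum_subtractf left_diff_distrib)

lemma bip_sum_hom:
  "(bip_sum P :: ((int \<Rightarrow> 'v) \<Rightarrow> 'a::normed_coeff_ring) \<Rightarrow> _) \<in> hom (linf P) (fun_group (cycles T 1))"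
proof (rule homI)
  fix f g :: "(int \<Rightarrow> 'v) \<Rightarrow> 'a"
  assume "f \<in> carrier (linf P)"
  then show "bip_sum P f \<in> carrier (fun_group (cycles T 1))"
    unfolding carrier_linf carrier_fun_group using bip_sum_cycle by blast
  show "bip_sum P (f \<otimes>\<^bsub>linf P\<^esub> g) = bip_sum P f \<otimes>\<^bsub>fun_group (cycles T 1)\<^esub> bip_sum P g"
    by (simp add: linf_def bip_sum_add)
qed

lemma bip_sum_iso:
  "(bip_sum P :: ((int \<Rightarrow> 'v) \<Rightarrow> 'a::normed_coeff_ring) \<Rightarrow> _) \<in> iso (linf P) (fun_group (cycles T 1))"
proof -
  let ?\<Phi> = "bip_sum P :: ((int \<Rightarrow> 'v) \<Rightarrow> 'a) \<Rightarrow> _"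
  interpret group_hom "linf P" "fun_group (cycles T 1)" ?\<Phi>
    by (intro group_hom.intro group_hom_axioms.intro group_linf graph.group_cycles bip_sum_hom)
  show ?thesis unfolding iso_iff
  proof (intro conjI ballI impI subsetI)
    fix c :: "'v list \<Rightarrow> 'a" assume "c \<in> carrier (fun_group (cycles T 1))"
    then have cycle: "c \<in> cycles T 1" by simp
    then have "bounded_fun c" unfolding cycles_def using chains_bounded by blast
    then have "bip_coeff c \<in> carrier (linf P)"
      by (simp add: carrier_linf bip_coeff_outside bounded_fun_bip_coeff)
    then show "c \<in> ?\<Phi> ` carrier (linf P)" using bip_sum_bip_coeff[OF cycle] by (metis imageI)
  next
    fix f :: "(int \<Rightarrow> 'v) \<Rightarrow> 'a"
    assume kernel: "f \<in> carrier (linf P)" "?\<Phi> f = \<one>\<^bsub>fun_group (cycles T 1)\<^esub>"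
    then have "f p = 0" for p using bip_sum_eq_0D[of f p] by (auto simp: carrier_linf)
    then show "f = \<one>\<^bsub>linf P\<^esub>" by (auto simp: linf_def)
  qed
qed

theorem bip_map_iso:
  "(bip_map V E P :: ((int \<Rightarrow> 'v) \<Rightarrow> 'a::normed_coeff_ring) \<Rightarrow> _) \<in> iso (linf P) (H_suf T 1)"
proof -
  have "bip_map V E P = hclass T 1 \<circ> (bip_sum P :: ((int \<Rightarrow> 'v) \<Rightarrow> 'a) \<Rightarrow> _)"
    by (auto simp: bip_map_def)
  then show ?thesis using iso_set_trans[OF bip_sum_iso hclass_graph_iso] by simp
qed

lemma bip_map_eq: "bip_map V E P f = {bip_sum P f :: 'v list \<Rightarrow> 'a::normed_coeff_ring}"
  unfolding bip_map_def by (rule hclass_graph)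

lemma sup_norm_bip_sum:
  fixes f :: "(int \<Rightarrow> 'v) \<Rightarrow> 'a::normed_coeff_ring"
  assumes "bounded_fun f"
  shows "sup_norm (bip_sum P f) \<le> 3 * sup_norm f"
  unfolding sup_norm_def[of "bip_sum P f"]
  using cnorm_bip_sum[OF sup_norm_upper[OF assms]] by (intro cSUP_least) auto

lemma class_norm_bip_map:
  fixes f :: "(int \<Rightarrow> 'v) \<Rightarrow> 'a::normed_coeff_ring"
  assumes "f \<in> carrier (linf P)"
  shows "class_norm (bip_map V E P f) \<le> 3 * sup_norm f"
  using sup_norm_bip_sum[of f] assms unfolding bip_map_eq class_norm_def carrier_linf by simp

lemma class_dist_bip_map:
  fixes f g :: "(int \<Rightarrow> 'v) \<Rightarrow> 'a::normed_coeff_ring"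
  assumes "f \<in> carrier (linf P)" "g \<in> carrier (linf P)"
  shows "class_dist (bip_map V E P g) (bip_map V E P f) \<le> 3 * sup_norm (\<lambda>p. g p - f p)"
proof -
  have "bounded_fun (\<lambda>p. g p - f p)"
    using additive_fun_set.diff_mem[OF linf_additive] assms unfolding carrier_linf by blast
  then show ?thesis
    using sup_norm_bip_sum[of "\<lambda>p. g p - f p"] unfolding class_dist_def class_norm_def bip_map_eq
    by (simp add: bip_sum_diff)
qed

lemma bip_map_continuous:
  fixes f :: "(int \<Rightarrow> 'v) \<Rightarrow> 'a::normed_coeff_ring"
  assumes "f \<in> carrier (linf P)" "\<epsilon> > 0"
  shows "\<exists>\<delta>>0. \<forall>g\<in>carrier (linf P). sup_norm (\<lambda>p. g p - f p) < \<delta> \<longrightarrow>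
    class_dist (bip_map V E P g) (bip_map V E P f) < \<epsilon>"
  using class_dist_bip_map[OF assms(1)] assms(2) by (intro exI[of _ "\<epsilon> / 3"]) fastforce

end

theorem theorem3p6:
  fixes V :: "'v set" and E :: "'v set set" and mid :: bool
    and L :: "int \<Rightarrow> 'v" and B :: "nat \<Rightarrow> 'v set" and R :: "'v \<Rightarrow> nat \<Rightarrow> 'v"
    and P :: "(int \<Rightarrow> 'v) set"
  assumes "trivalent_tree V E" and "leafless V E"
    and "ray_construction V E mid L B R"
    and "P = bips mid L B R"
  shows "(bip_map V E P :: ((int \<Rightarrow> 'v) \<Rightarrow> int) \<Rightarrow> _)
           \<in> iso (linf P) (H_suf (graph_complex V E) 1) \<and>
         (suf_to_uf V E 1 :: ('v list \<Rightarrow> int) set \<Rightarrow> _)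
           \<in> iso (H_suf (graph_complex V E) 1) (H_uf V E 1) \<and>
         (bip_map V E P :: ((int \<Rightarrow> 'v) \<Rightarrow> bit) \<Rightarrow> _)
           \<in> iso (linf P) (H_suf (graph_complex V E) 1) \<and>
         (suf_to_uf V E 1 :: ('v list \<Rightarrow> bit) set \<Rightarrow> _)
           \<in> iso (H_suf (graph_complex V E) 1) (H_uf V E 1) \<and>
         (\<forall>f \<in> carrier (linf P :: ((int \<Rightarrow> 'v) \<Rightarrow> int) monoid). \<forall>\<epsilon>>0. \<exists>\<delta>>0.
           \<forall>g \<in> carrier (linf P). sup_norm (\<lambda>p. g p - f p) < \<delta> \<longrightarrow>
             class_dist (bip_map V E P g) (bip_map V E P f) < \<epsilon>) \<and>
         (\<exists>C. \<forall>f \<in> carrier (linf P :: ((int \<Rightarrow> 'v) \<Rightarrow> int) monoid).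
           class_norm (bip_map V E P f) \<le> C * sup_norm f)"
proof -
  interpret tree: bounded_degree_tree V E by (rule trivalent_tree_bounded_degree[OF assms(1)])
  interpret rays: ray_tree V E mid L B R by (rule ray_tree.intro[OF assms(3)])
  have bounded: "\<exists>C. \<forall>f\<in>carrier (linf rays.P :: ((int \<Rightarrow> 'v) \<Rightarrow> int) monoid).
      class_norm (bip_map V E rays.P f) \<le> C * sup_norm f"
    using rays.class_norm_bip_map by blast
  show ?thesis
    unfolding assms(4)
    by (intro conjI ballI allI impI bounded rays.bip_map_iso
        tree.suf_to_uf_iso rays.bip_map_continuous)
qed

end
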